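(* Let $\mathcal{B} \subset \mathcal{A}$ be a regular inclusion of simple unital $C^*$-algebras such that there exists a finite-index conditional expectation from $\mathcal{A}$ onto $\mathcal{B}$. Let $E_0 : \mathcal{A} \to \mathcal{B}$ be the unique minimal conditional expectation and $\tau_0 := (E_0)|_{\mathcal{C}_{\mathcal{A}}(\mathcal{B})} : \mathcal{C}_{\mathcal{A}}(\mathcal{B}) \to \mathbb{C}$. Then the following hold: (1) There exists a unitary orthonormal quasi-basis for $\tau_0$. (2) The conditional expectation $E_0$ admits a unitary orthonormal quasi-basis.
   Context: Inclusions of unital $C^*$-algebras have a common unit; $\mathcal{U}(\cdot)$ denotes the unitary group. For a conditional expectation $E: \mathcal{A} \to \mathcal{B}$, a finite set $\{\lambda_i\} \subset \mathcal{A}$ is a (right) quasi-basis for $E$ if $x = \sum_i E(x\lambda_i)\lambda_i^*$ for all $x \in \mathcal{A}$. It is orthonormal if $E(\lambda_i^*\lambda_j) = \delta_{i,j}$ for all $i,j$, and unitary if all $\lambda_i$ are unitaries. "Quasi-basis" means right quasi-basis. $E$ has finite index if it admits a quasi-basis, and then $\mathrm{Ind}_W(E) = \sum_i \lambda_i\lambda_i^*$ (independent of the quasi-basis; a scalar if $\mathcal{A}$ is simple). For an inclusion $\mathcal{B} \subset \mathcal{A}$ of simple unital $C^*$-algebras admitting a finite-index conditional expectation, there is a unique conditional expectation $E_0 : \mathcal{A} \to \mathcal{B}$ with smallest Watatani index $\mathrm{Ind}_W$ (Watatani), called the minimal conditional expectation. The centralizer is $\mathcal{C}_{\mathcal{A}}(\mathcal{B})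 = \{x \in \mathcal{A} : xb = bx \ \forall b \in \mathcal{B}\}$; in this setting it is finite-dimensional, and $\tau_0$ is a faithful tracial state on it, regarded as a conditional expectation $\mathcal{C}_{\mathcal{A}}(\mathcal{B}) \to \mathbb{C}$. The inclusion is regular if $\mathcal{N}_{\mathcal{A}}(\mathcal{B}) = \{u \in \mathcal{U}(\mathcal{A}) : u\mathcal{B}u^* = \mathcal{B}\}$ generates $\mathcal{A}$ as a $C^*$-algebra. *)

theory Defs
  imports "HOL-Analysis.Analysis"
begin

text \<open>
  Nonzero unital complex C*-algebras. The inherited real structure is the restriction of the
  complex one; \<^class>\<open>real_normed_algebra_1\<close> contributes \<open>norm 1 = 1\<close>, which holds in every
  C*-algebra with \<open>1 \<noteq> 0\<close>.
\<close>

class unital_cstar_algebra = real_normed_algebra_1 + banach +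
  fixes scaleC :: "complex \<Rightarrow> 'a \<Rightarrow> 'a"
    and cstar :: "'a \<Rightarrow> 'a"
  assumes scaleC_add_right: "scaleC c (x + y) = scaleC c x + scaleC c y"
    and scaleC_add_left: "scaleC (c + d) x = scaleC c x + scaleC d x"
    and scaleC_scaleC: "scaleC c (scaleC d x) = scaleC (c * d) x"
    and scaleC_of_real: "scaleC (complex_of_real r) x = scaleR r x"
    and mult_scaleC_left: "scaleC c x * y = scaleC c (x * y)"
    and mult_scaleC_right: "x * scaleC c y = scaleC c (x * y)"
    and norm_scaleC: "norm (scaleC c x) = cmod c * norm x"
    and cstar_cstar: "cstar (cstar x) = x"
    and cstar_add: "cstar (x + y) = cstar x + cstar y"
    and cstar_scaleC: "cstar (scaleC c x) = scaleC (cnj c) (cstar x)"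
    and cstar_mult: "cstar (x * y) = cstar y * cstar x"
    and cstar_identity: "norm (cstar x * x) = (norm x)\<^sup>2"

text \<open>
  The notions below are relative to a unital C*-subalgebra \<open>A\<close> of the ambient algebra, because
  they are needed both for the whole algebra (\<open>A = UNIV\<close>) and for the centralizer of \<open>B\<close> in it.
\<close>

definition cstar_subalgebra :: "'a::unital_cstar_algebra set \<Rightarrow> bool" where
  "cstar_subalgebra A \<longleftrightarrow>
     1 \<in> A \<and> closed A \<and>
     (\<forall>x\<in>A. \<forall>y\<in>A. x + y \<in> A) \<and>
     (\<forall>x\<in>A. \<forall>y\<in>A. x * y \<in> A) \<and>
     (\<forall>c. \<forall>x\<in>A. scaleC c x \<in> A) \<and>
     (\<forall>x\<in>A. cstar x \<in> A)"

definition cstar_generated :: "'a::unital_cstar_algebra set \<Rightarrow> 'a set" where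
  "cstar_generated S = \<Inter>{C. cstar_subalgebra C \<and> S \<subseteq> C}"

definition scalars :: "'a::unital_cstar_algebra set" where
  "scalars = range (\<lambda>c. scaleC c 1)"

definition closed_ideal :: "'a::unital_cstar_algebra set \<Rightarrow> 'a set \<Rightarrow> bool" where
  "closed_ideal A I \<longleftrightarrow>
     I \<subseteq> A \<and> 0 \<in> I \<and> closed I \<and>
     (\<forall>x\<in>I. \<forall>y\<in>I. x + y \<in> I) \<and>
     (\<forall>c. \<forall>x\<in>I. scaleC c x \<in> I) \<and>
     (\<forall>a\<in>A. \<forall>x\<in>I. a * x \<in> I \<and> x * a \<in> I)"

definition cstar_simple :: "'a::unital_cstar_algebra set \<Rightarrow> bool" where
  "cstar_simple A \<longleftrightarrow> (\<forall>I. closed_ideal A I \<longrightarrow> I = {0} \<or> I = A)"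

definition cstar_pos :: "'a::unital_cstar_algebra set \<Rightarrow> 'a set" where
  "cstar_pos A = {cstar y * y | y. y \<in> A}"

definition unitaries :: "'a::unital_cstar_algebra set \<Rightarrow> 'a set" where
  "unitaries A = {u \<in> A. cstar u * u = 1 \<and> u * cstar u = 1}"

definition centralizer_in :: "'a::unital_cstar_algebra set \<Rightarrow> 'a set \<Rightarrow> 'a set" where
  "centralizer_in A B = {x \<in> A. \<forall>b\<in>B. x * b = b * x}"

definition unitary_normalizer :: "'a::unital_cstar_algebra set \<Rightarrow> 'a set \<Rightarrow> 'a set" where
  "unitary_normalizer A B = {u \<in> unitaries A. (\<lambda>b. u * b * cstar u) ` B = B}"

definition regular_inclusion :: "'a::unital_cstar_algebra set \<Rightarrow> 'a set \<Rightarrow> bool" where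
  "regular_inclusion A B \<longleftrightarrow> cstar_generated (unitary_normalizer A B) = A"

text \<open>
  Conditional expectations of \<open>A\<close> onto \<open>B\<close> are positive \<open>B\<close>-bimodule projections. An expectation
  onto \<open>\<complex>\<close> is one onto \<^const>\<open>scalars\<close>.
\<close>

definition cond_expectation ::
  "'a::unital_cstar_algebra set \<Rightarrow> 'a set \<Rightarrow> ('a \<Rightarrow> 'a) \<Rightarrow> bool" where
  "cond_expectation A B E \<longleftrightarrow>
     B \<subseteq> A \<and> E ` A \<subseteq> B \<and>
     (\<forall>x\<in>A. \<forall>y\<in>A. E (x + y) = E x + E y) \<and>
     (\<forall>c. \<forall>x\<in>A. E (scaleC c x) = scaleC c (E x)) \<and>
     (\<forall>b\<in>B. E b = b) \<and>
     (\<forall>b\<in>B. \<forall>x\<in>A. E (b * x) = b * E x \<and> E (x * b) = E x * b) \<and>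
     (\<forall>x\<in>cstar_pos A. E x \<in> cstar_pos B)"

definition quasi_basis ::
  "'a::unital_cstar_algebra set \<Rightarrow> 'a set \<Rightarrow> ('a \<Rightarrow> 'a) \<Rightarrow> 'a set \<Rightarrow> bool" where
  "quasi_basis A B E L \<longleftrightarrow>
     cond_expectation A B E \<and> finite L \<and> L \<subseteq> A \<and>
     (\<forall>x\<in>A. x = (\<Sum>l\<in>L. E (x * l) * cstar l))"

definition orthonormal_for :: "('a::unital_cstar_algebra \<Rightarrow> 'a) \<Rightarrow> 'a set \<Rightarrow> bool" where
  "orthonormal_for E L \<longleftrightarrow> (\<forall>l\<in>L. \<forall>m\<in>L. E (cstar l * m) = (if l = m then 1 else 0))"

definition unitary_orthonormal_quasi_basis ::
  "'a::unital_cstar_algebra set \<Rightarrow> 'a set \<Rightarrow> ('a \<Rightarrow> 'a) \<Rightarrow> 'a set \<Rightarrow> bool" where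
  "unitary_orthonormal_quasi_basis A B E L \<longleftrightarrow>
     quasi_basis A B E L \<and> orthonormal_for E L \<and> L \<subseteq> unitaries A"

definition finite_index ::
  "'a::unital_cstar_algebra set \<Rightarrow> 'a set \<Rightarrow> ('a \<Rightarrow> 'a) \<Rightarrow> bool" where
  "finite_index A B E \<longleftrightarrow> (\<exists>L. quasi_basis A B E L)"

text \<open>
  The index does not depend on the quasi-basis, so the description is proper whenever
  \<open>finite_index A B E\<close> holds; it is meaningless otherwise.
\<close>

definition watatani_index ::
  "'a::unital_cstar_algebra set \<Rightarrow> 'a set \<Rightarrow> ('a \<Rightarrow> 'a) \<Rightarrow> 'a" where
  "watatani_index A B E = (THE d. \<exists>L. quasi_basis A B E L \<and> d = (\<Sum>l\<in>L. l * cstar l))"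

text \<open>
  Smallest refers to the order of the positive cone; for simple \<open>A\<close> the indices are scalars and
  this is the usual order of the real numbers.
\<close>

definition minimal_cond_expectation ::
  "'a::unital_cstar_algebra set \<Rightarrow> 'a set \<Rightarrow> ('a \<Rightarrow> 'a) \<Rightarrow> bool" where
  "minimal_cond_expectation A B E \<longleftrightarrow>
     finite_index A B E \<and>
     (\<forall>F. finite_index A B F \<longrightarrow> watatani_index A B F - watatani_index A B E \<in> cstar_pos A)"

end

theory Submission
  imports Defs
begin

text \<open>
  Let \<open>C\<close> be the commutant of \<open>B\<close>. A normalizer that does not act on \<open>B\<close> by an inner automorphism is
  orthogonal to \<open>C\<close> for every expectation, so by regularity and finiteness of the index \<open>A\<close> is a finite
  sum of spaces \<open>B * C * cstar u\<close>, and an expectation is determined by its restriction to \<open>C\<close>. The algebra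
  \<open>C\<close> is finite dimensional; simplicity of \<open>A\<close> forces its blocks to have equal size, so that \<open>C\<close> has a basis of
  unitaries (products of discrete Fourier matrices) which is orthonormal for the normalised trace. Multiplied by
  the coset representatives \<open>u\<close> it becomes a unitary orthonormal basis for the expectation \<open>F\<close> extending the
  trace. Finally \<open>E\<^sub>0 = F\<close>: if \<open>\<sigma>\<close> is the density of \<open>F\<close> relative to \<open>E\<^sub>0\<close>, then minimality gives
  \<open>F \<sigma> \<le> 1\<close>, while \<open>E\<^sub>0 ((1 - \<sigma>)\<^sup>2) = F \<sigma> - 1\<close>.
\<close>

section \<open>Unital C*-algebras\<close>

text \<open>Positivity is developed from the norm alone: spectra and continuous functional calculus
  are replaced by square roots obtained as fixed points, and by the principle that a self-adjoint
  element which lies between two multiples of \<open>k\<close> and is comparable with every real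
  multiple of \<open>k\<close> is itself such a multiple. One Bessel inequality yields both
  finiteness statements: orthogonal families in \<open>C\<close>, and normalizers that are pairwise
  inequivalent modulo inner ones, give orthonormal systems, so the index bounds their number. It
  involves no trace, which matters because \<open>E\<^sub>0\<close> is not known to be tracial on
  \<open>C\<close> at the outset. This is also the reason for the detour through \<open>F\<close>:
  the explicit unitary basis is orthonormal for the trace. Multiplied on the right by a square root
  of \<sigma> it becomes a quasi-basis of \<open>E\<^sub>0\<close>, and the two indices can be
  compared term by term.\<close>

interpretation cvs: vector_space "scaleC :: complex \<Rightarrow> 'a::unital_cstar_algebra \<Rightarrow> 'a"
  by unfold_locales (simp_all add: scaleC_add_right scaleC_add_left scaleC_scaleC
      scaleC_of_real[of 1, simplified])

lemma mult_scaleC [simp]: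
  fixes x y :: "'a::unital_cstar_algebra"
  shows "scaleC c x * y = scaleC c (x * y)" "x * scaleC c y = scaleC c (x * y)"
  by (simp_all add: mult_scaleC_left mult_scaleC_right)

lemma scaleC_scaleR: "scaleC c (r *\<^sub>R x) = r *\<^sub>R scaleC c (x::'a::unital_cstar_algebra)"
  by (simp add: scaleC_of_real[symmetric] scaleC_scaleC mult.commute)

lemma of_real_scaleC: "(of_real r :: 'a::unital_cstar_algebra) = scaleC (complex_of_real r) 1"
  by (simp only: scaleC_of_real) (simp add: of_real_def)

lemma cstar_scaleR [simp]: "cstar (r *\<^sub>R x) = r *\<^sub>R cstar (x::'a::unital_cstar_algebra)"
  using cstar_scaleC[of "of_real r" x] by (simp add: scaleC_of_real)

lemma cstar_zero [simp]: "cstar (0::'a::unital_cstar_algebra) = 0"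
  using cstar_add[of "0::'a" 0] by simp

lemma cstar_one [simp]: "cstar (1::'a::unital_cstar_algebra) = 1"
  by (metis cstar_cstar cstar_mult mult_1 mult_1_right)

lemma cstar_minus [simp]: "cstar (- x) = - cstar (x::'a::unital_cstar_algebra)"
  using cstar_scaleR[of "-1" x] by simp

lemma cstar_diff [simp]: "cstar (x - y) = cstar x - cstar (y::'a::unital_cstar_algebra)"
  using cstar_add[of x "- y"] by simp

lemma cstar_of_real [simp]: "cstar (of_real r) = (of_real r :: 'a::unital_cstar_algebra)"
  by (simp add: of_real_def)

lemma cstar_sum [simp]: "cstar (sum f A) = (\<Sum>i\<in>A. cstar (f i :: 'a::unital_cstar_algebra))"
  by (induction A rule: infinite_finite_induct) (simp_all add: cstar_add)

lemma cstar_power: "cstar (x ^ n) = cstar (x::'a::unital_cstar_algebra) ^ n"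
  by (induction n) (simp_all add: cstar_mult power_commutes)

declare cstar_cstar [simp] cstar_add [simp] cstar_mult [simp] cstar_scaleC [simp]

lemma norm_cstar [simp]: "norm (cstar x) = norm (x::'a::unital_cstar_algebra)"
proof -
  have le: "norm x \<le> norm (cstar x)" for x :: 'a
  proof (cases "x = 0")
    case False
    have "norm x * norm x \<le> norm (cstar x) * norm x"
      using norm_mult_ineq[of "cstar x" x] by (simp add: cstar_identity power2_eq_square)
    with False show ?thesis by simp
  qed simp
  show ?thesis using le[of x] le[of "cstar x"] by simp
qed

lemma cstar_identity': "norm (x * cstar x) = (norm (x::'a::unital_cstar_algebra))\<^sup>2"
  using cstar_identity[of "cstar x"] by simp

lemma bounded_linear_cstar: "bounded_linear (cstar :: 'a::unital_cstar_algebra \<Rightarrow> 'a)"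
  by (rule bounded_linear_intro[where K=1]) simp_all

lemmas continuous_cstar [continuous_intros] =
  bounded_linear.continuous_on[OF bounded_linear_cstar]

lemma bounded_linear_scaleC: "bounded_linear (scaleC c :: 'a::unital_cstar_algebra \<Rightarrow> 'a)"
  by (rule bounded_linear_intro[where K="cmod c"])
    (simp_all add: scaleC_add_right scaleC_scaleR norm_scaleC mult.commute)

lemmas continuous_scaleC [continuous_intros] =
  bounded_linear.continuous_on[OF bounded_linear_scaleC]

section \<open>C*-subalgebras and the subalgebra generated by a set\<close>

context
  fixes D :: "'a::unital_cstar_algebra set"
  assumes D: "cstar_subalgebra D"
begin

lemma cstar_subalgebraD:
  "1 \<in> D" "closed D" "x \<in> D \<Longrightarrow> y \<in> D \<Longrightarrow> x + y \<in> D" "x \<in> D \<Longrightarrow> y \<in> D \<Longrightarrow> x * y \<in> D"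
  "x \<in> D \<Longrightarrow> scaleC c x \<in> D" "x \<in> D \<Longrightarrow> cstar x \<in> D"
  using D by (auto simp: cstar_subalgebra_def)

lemma cstar_subalgebra_scaleR: "x \<in> D \<Longrightarrow> r *\<^sub>R x \<in> D"
  by (metis cstar_subalgebraD(5) scaleC_of_real)

lemma cstar_subalgebra_of_real: "of_real r \<in> D"
  by (simp add: of_real_def cstar_subalgebra_scaleR cstar_subalgebraD)

lemma cstar_subalgebra_zero: "0 \<in> D"
  using cstar_subalgebra_of_real[of 0] by simp

lemma cstar_subalgebra_minus: "x \<in> D \<Longrightarrow> - x \<in> D"
  using cstar_subalgebra_scaleR[of x "-1"] by simp

lemma cstar_subalgebra_diff: "x \<in> D \<Longrightarrow> y \<in> D \<Longrightarrow> x - y \<in> D"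
  using cstar_subalgebraD(3)[of x "- y"] by (simp add: cstar_subalgebra_minus)

lemma cstar_subalgebra_sum: "(\<And>i. i \<in> A \<Longrightarrow> f i \<in> D) \<Longrightarrow> sum f A \<in> D"
  by (induction A rule: infinite_finite_induct) (auto intro: cstar_subalgebraD cstar_subalgebra_zero)

lemmas cstar_subalgebra_intros = cstar_subalgebraD cstar_subalgebra_scaleR cstar_subalgebra_of_real
  cstar_subalgebra_zero cstar_subalgebra_minus cstar_subalgebra_diff cstar_subalgebra_sum

end

lemma cstar_subalgebra_UNIV: "cstar_subalgebra UNIV"
  by (simp add: cstar_subalgebra_def)

lemma cstar_subalgebra_Inter:
  "(\<And>D. D \<in> \<D> \<Longrightarrow> cstar_subalgebra D) \<Longrightarrow> cstar_subalgebra (\<Inter>\<D>)"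
  unfolding cstar_subalgebra_def by auto

lemma cstar_subalgebra_Int:
  "cstar_subalgebra C \<Longrightarrow> cstar_subalgebra D \<Longrightarrow> cstar_subalgebra (C \<inter> D)"
  using cstar_subalgebra_Inter[of "{C, D}"] by auto

lemma cstar_subalgebra_generated: "cstar_subalgebra (cstar_generated S)"
  unfolding cstar_generated_def by (rule cstar_subalgebra_Inter) simp

lemma generated_superset: "S \<subseteq> cstar_generated S"
  by (auto simp: cstar_generated_def)

lemma generated_minimal: "cstar_subalgebra D \<Longrightarrow> S \<subseteq> D \<Longrightarrow> cstar_generated S \<subseteq> D"
  by (auto simp: cstar_generated_def)

lemma generated_mono: "x \<in> cstar_generated {y} \<Longrightarrow> cstar_generated {x} \<subseteq> cstar_generated {y}"
  by (simp add: generated_minimal cstar_subalgebra_generated)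

lemma cstar_subalgebra_centralizer:
  assumes "cstar ` S \<subseteq> S"
  shows "cstar_subalgebra (centralizer_in UNIV S)"
proof -
  have "cstar x * b = b * cstar x" if "\<And>b. b \<in> S \<Longrightarrow> x * b = b * x" "b \<in> S" for x b
    using that(1)[of "cstar b"] that(2) assms
    by (metis cstar_cstar cstar_mult image_subset_iff)
  moreover have "closed {x. \<forall>b\<in>S. x * b = b * x}"
  proof -
    have "{x. \<forall>b\<in>S. x * b = b * x} = (\<Inter>b\<in>S. {x. x * b = b * x})" by auto
    moreover have "closed {x. x * b = b * x}" for b :: 'a
      by (intro closed_Collect_eq continuous_intros)
    ultimately show ?thesis by auto
  qed
  moreover have "x * y * b = b * (x * y)" if "x * b = b * x" "y * b = b * y" for x y b :: 'a
    by (simp only: mult.assoc that(2)) (simp only: mult.assoc[symmetric] that(1))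
  ultimately show ?thesis
    unfolding cstar_subalgebra_def centralizer_in_def by (simp add: distrib_left distrib_right)
qed

text \<open>The commutant of \<open>y\<close> is a C*-subalgebra because \<open>y\<close> is
  self-adjoint, and it contains \<open>x\<close>. Square roots are recorded as elements of
  \<open>cstar_generated {x}\<close>, and this lemma then supplies the commutation relations that
  functional calculus would give.\<close>

lemma generated_commute:
  assumes "t \<in> cstar_generated {x}" "x * y = y * x" "cstar y = y"
  shows "t * y = y * t"
proof -
  have "cstar_generated {x} \<subseteq> centralizer_in UNIV {y}"
  proof (rule generated_minimal)
    show "cstar_subalgebra (centralizer_in UNIV {y})"
      using assms(3) by (intro cstar_subalgebra_centralizer) simp
  qed (use assms(2) in \<open>simp add: centralizer_in_def\<close>)
  with assms(1) show ?thesis by (auto simp: centralizer_in_def)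
qed

lemma generated_commutative:
  assumes "t \<in> cstar_generated {x}" "r \<in> cstar_generated {x}" "cstar x = x" "cstar r = r"
  shows "t * r = r * t"
proof -
  have "r * x = x * r" using generated_commute[OF assms(2) refl assms(3)] .
  then show ?thesis using generated_commute[OF assms(1) _ assms(4)] by simp
qed

text \<open>Iterated C*-identity. It plays the role of the spectral radius formula: norms of
  self-adjoint elements can be compared through the growth of powers.\<close>

lemma norm_power_pow2_sa:
  fixes h :: "'a::unital_cstar_algebra"
  assumes "cstar h = h"
  shows "norm (h ^ (2 ^ k)) = norm h ^ (2 ^ k)"
proof (induction k)
  case (Suc k)
  have "h ^ 2 ^ Suc k = cstar (h ^ 2 ^ k) * h ^ 2 ^ k"
    unfolding cstar_power assms power_Suc mult_2 power_add ..
  then have "norm (h ^ 2 ^ Suc k) = norm (cstar (h ^ 2 ^ k) * h ^ 2 ^ k)"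
    by (simp only:)
  also have "\<dots> = (norm h ^ 2 ^ k)\<^sup>2" by (simp add: cstar_identity Suc)
  finally show ?case by (simp add: power_mult[symmetric] mult.commute)
qed simp

lemma norm_square_sa: "cstar h = h \<Longrightarrow> norm (h * h) = (norm (h::'a::unital_cstar_algebra))\<^sup>2"
  using cstar_identity[of h] by simp

section \<open>Positive elements\<close>

text \<open>The solution is \<open>1 - s\<close> for the fixed point \<open>s = (x + s\<^sup>2) / 2\<close> of a contraction.\<close>

lemma sqrt_one_minus:
  fixes x :: "'a::unital_cstar_algebra"
  assumes sa: "cstar x = x" and nx: "norm x < 1"
  shows "\<exists>t\<in>cstar_generated {x}. cstar t = t \<and> t * t = 1 - x \<and> norm (1 - t) \<le> 1"
proof -
  let ?D = "cstar_generated {x}"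
  note D = cstar_subalgebra_intros[OF cstar_subalgebra_generated[of "{x}"]]
  \<comment> \<open>\<beta> solves the scalar equation
    \<open>2 * \<beta> = norm x + \<beta> * \<beta>\<close>, so \<open>f\<close> maps the ball of
    radius \<beta> into itself; there \<open>f\<close> has Lipschitz constant \<beta>, which is
    below 1 because \<open>norm x < 1\<close>.\<close>
  define \<beta> where "\<beta> = 1 - sqrt (1 - norm x)"
  have b: "0 \<le> \<beta>" "\<beta> < 1" using nx by (auto simp: \<beta>_def)
  have bb: "norm x + \<beta> * \<beta> = 2 * \<beta>" using nx by (simp add: \<beta>_def algebra_simps)
  define S where "S = ?D \<inter> cball 0 \<beta> \<inter> {s. cstar s = s}"
  define f where "f s = (1/2) *\<^sub>R (x + s * s)" for s
  have "closed {s::'a. cstar s = s}" by (intro closed_Collect_eq continuous_intros)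
  then have "complete S"
    unfolding S_def complete_eq_closed by (intro closed_Int D(2) closed_cball)
  moreover have "0 \<in> S" using b by (simp add: S_def D)
  moreover have "f ` S \<subseteq> S"
  proof safe
    fix s assume s: "s \<in> S"
    have "norm (s * s) \<le> \<beta> * \<beta>"
      using s by (intro order_trans[OF norm_mult_ineq] mult_mono) (auto simp: S_def b)
    then have "norm (x + s * s) \<le> 2 * \<beta>"
      using norm_triangle_ineq[of x "s * s"] bb by linarith
    then show "f s \<in> S" using s generated_superset[of "{x}"] by (auto simp: S_def f_def sa intro!: D)
  qed
  moreover have "dist (f s) (f r) \<le> \<beta> * dist s r" if "s \<in> S" "r \<in> S" for s r
  proof -
    have "f s - f r = (1/2) *\<^sub>R (s * (s - r) + (s - r) * r)"
      by (simp add: f_def algebra_simps)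
    also have "norm \<dots> \<le> (1/2) * (\<beta> * norm (s - r) + norm (s - r) * \<beta>)"
      using that unfolding norm_scaleR S_def
      by (intro mult_mono order_trans[OF norm_triangle_ineq] add_mono order_trans[OF norm_mult_ineq]) (auto simp: b)
    finally show ?thesis by (simp add: dist_norm mult.commute)
  qed
  ultimately obtain s where s: "s \<in> S" "f s = s"
    using Banach_fix[of S \<beta> f] b by auto
  have "2 *\<^sub>R f s = x + s * s" by (simp add: f_def)
  then have "s * s = 2 *\<^sub>R s - x" using s(2) by (simp add: algebra_simps)
  then have "(1 - s) * (1 - s) = 1 - x" by (simp add: algebra_simps scaleR_2)
  then show ?thesis using s b by (intro bexI[of _ "1 - s"]) (auto simp: S_def intro!: D)
qed


text \<open>\<open>h\<close> and \<open>d\<close> are the real and imaginary parts of a normal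
  \<open>v\<close> with \<open>cstar v * v = of_real c\<close>; the C*-identity gives the norm of
  \<open>v\<close>, and \<open>h\<close> is the average of \<open>v\<close> and
  \<open>cstar v\<close>.\<close>

lemma norm_le_of_squares:
  fixes h d :: "'a::unital_cstar_algebra"
  assumes sa: "cstar h = h" "cstar d = d" and comm: "h * d = d * h"
    and sq: "h * h + d * d = of_real c" and c: "0 \<le> c"
  shows "(norm h)\<^sup>2 \<le> c"
proof -
  define v where "v = h + scaleC \<i> d"
  have cv: "cstar v = h - scaleC \<i> d" by (simp add: v_def sa cvs.scale_minus_left)
  have "cstar v * v = h * h + d * d"
    unfolding cv by (simp add: v_def algebra_simps scaleC_scaleC comm cvs.scale_minus_left)
  then have "(norm v)\<^sup>2 = c" using cstar_identity[of v] sq c by simp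
  moreover have "2 *\<^sub>R h = v + cstar v" unfolding cv by (simp add: v_def scaleR_2)
  then have "2 * norm h \<le> 2 * norm v"
    using norm_triangle_ineq[of v "cstar v"] by (metis norm_cstar norm_scaleR abs_numeral mult_2)
  ultimately show ?thesis by (metis mult_le_cancel_left_pos norm_ge_zero power_mono zero_less_numeral)
qed

text \<open>For \<open>s\<close> strictly above \<open>(norm h)\<^sup>2\<close> the difference is a
  square \<open>d * d\<close> with \<open>d\<close> commuting with \<open>h\<close>, and
  \<open>norm_le_of_squares\<close> applies with the roles of \<open>h\<close> and \<open>d\<close>
  exchanged. The boundary case follows by letting \<open>s\<close> decrease.\<close>

lemma norm_of_real_diff_square:
  fixes h :: "'a::unital_cstar_algebra"
  assumes sa: "cstar h = h" and s: "(norm h)\<^sup>2 \<le> s"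
  shows "norm (of_real s - h * h) \<le> s"
proof -
  have strict: "norm (of_real s - h * h) \<le> s" if s: "(norm h)\<^sup>2 < s" for s
  proof -
    have s0: "0 < s" using s by (meson le_less_trans zero_le_power2)
    define x where "x = (1/s) *\<^sub>R (h * h)"
    have "norm x < 1" using s s0 by (simp add: x_def norm_square_sa sa field_simps)
    moreover have "cstar x = x" by (simp add: x_def sa)
    ultimately obtain t where t: "t \<in> cstar_generated {x}" "cstar t = t" "t * t = 1 - x"
      using sqrt_one_minus by blast
    have th: "t * h = h * t"
      using t(1) by (rule generated_commute) (simp_all add: x_def sa mult.assoc)
    define d where "d = sqrt s *\<^sub>R t"
    have "d * d = s *\<^sub>R (1 - x)" using s0 by (simp add: d_def t)
    also have "\<dots> = of_real s - h * h" using s0 by (simp add: x_def algebra_simps of_real_def)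
    finally have dd: "d * d = of_real s - h * h" .
    have sad: "cstar d = d" and dh: "d * h = h * d" by (simp_all add: d_def t th)
    have "(norm d)\<^sup>2 \<le> s"
      using s0 dd dh sad sa by (intro norm_le_of_squares[of d h]) simp_all
    then show ?thesis using norm_square_sa[OF sad] by (simp add: dd)
  qed
  have "norm (of_real s - h * h) \<le> s + e" if "e > 0" for e :: real
  proof -
    have "(norm h)\<^sup>2 < s + e/2" using s that by linarith
    from strict[OF this] have "norm (of_real (s + e/2) - h * h) \<le> s + e/2" .
    moreover have "of_real s - h * h = (of_real (s + e/2) - h * h) - of_real (e/2)" by simp
    ultimately show ?thesis
      using norm_triangle_ineq4[of "of_real (s + e/2) - h * h" "of_real (e/2)"] that by simp
  qed
  then show ?thesis by (rule field_le_epsilon)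
qed

text \<open>Positivity through the norm: for self-adjoint \<open>x\<close> it means that the
  spectrum lies in some \<open>[0, 2 * s]\<close>. In this form sums are immediate, whereas
  positivity of \<open>cstar y * y\<close> becomes a theorem; the two notions agree by
  \<open>cstar_pos_UNIV\<close>.\<close>

definition cpos :: "'a::unital_cstar_algebra \<Rightarrow> bool" where
  "cpos x \<longleftrightarrow> cstar x = x \<and> (\<exists>s. norm (of_real s - x) \<le> s)"

lemma cpos_sa: "cpos x \<Longrightarrow> cstar x = x"
  by (simp add: cpos_def)

lemma cposI: "cstar x = x \<Longrightarrow> norm (of_real s - x) \<le> s \<Longrightarrow> cpos x"
  unfolding cpos_def by blast

lemma cpos_add: "cpos x \<Longrightarrow> cpos y \<Longrightarrow> cpos (x + y)"
proof -
  assume "cpos x" "cpos y"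
  then obtain s t where st: "cstar x = x" "cstar y = y" "norm (of_real s - x) \<le> s" "norm (of_real t - y) \<le> t"
    by (auto simp: cpos_def)
  have "norm (of_real (s + t) - (x + y)) = norm ((of_real s - x) + (of_real t - y))"
    by (simp add: algebra_simps)
  also have "\<dots> \<le> s + t" using st by (meson add_mono norm_triangle_ineq order_trans)
  finally show ?thesis using st by (intro cposI[of _ "s + t"]) simp_all
qed

lemma cpos_of_real: "0 \<le> c \<Longrightarrow> cpos (of_real c)"
  by (rule cposI[of _ c]) simp_all

lemma cpos_zero [simp]: "cpos 0"
  using cpos_of_real[of 0] by simp

lemma cpos_scaleR: "cpos x \<Longrightarrow> 0 \<le> c \<Longrightarrow> cpos (c *\<^sub>R x)"
proof -
  assume "cpos x" and c: "0 \<le> c"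
  then obtain s where s: "cstar x = x" "norm (of_real s - x) \<le> s" by (auto simp: cpos_def)
  have "norm (of_real (c * s) - c *\<^sub>R x) = norm (c *\<^sub>R (of_real s - x))"
    by (simp add: scaleR_diff_right of_real_def)
  also have "\<dots> \<le> c * s" using s c by (simp add: mult_left_mono)
  finally show ?thesis using s by (intro cposI[of _ "c * s"]) simp_all
qed

lemma cpos_sum: "(\<And>i. i \<in> A \<Longrightarrow> cpos (f i)) \<Longrightarrow> cpos (sum f A)"
  by (induction A rule: infinite_finite_induct) (auto intro: cpos_add)

lemma cpos_square: "cstar h = h \<Longrightarrow> cpos (h * h)"
  by (rule cposI, simp, erule norm_of_real_diff_square[OF _ order_refl])

lemma cpos_norm_minus: "cstar h = h \<Longrightarrow> norm h \<le> c \<Longrightarrow> cpos (of_real c - h)"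
  by (rule cposI[of _ c]) simp_all

lemma cpos_norm_plus: "cstar h = h \<Longrightarrow> norm h \<le> c \<Longrightarrow> cpos (of_real c + h)"
  using cpos_norm_minus[of "- h" c] by simp

text \<open>The shift by \<open>e\<close> gives \<open>x = (s - p) / (s + e)\<close> norm below 1,
  so \<open>sqrt_one_minus\<close> applies to \<open>1 - x = (p + e) / (s + e)\<close>. The exact
  root needs a limit and comes in \<open>cpos_sqrt\<close>.\<close>

lemma cpos_sqrt_eps:
  fixes p :: "'a::unital_cstar_algebra"
  assumes p: "cpos p" and e: "0 < e"
  shows "\<exists>t\<in>cstar_generated {p}. cpos t \<and> t * t = p + of_real e"
proof -
  note D = cstar_subalgebra_intros[OF cstar_subalgebra_generated[of "{p}"]]
  obtain s where s: "cstar p = p" "norm (of_real s - p) \<le> s" using p by (auto simp: cpos_def)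
  have s0: "0 \<le> s" using s(2) norm_ge_zero order_trans by blast
  define x where "x = (1/(s + e)) *\<^sub>R (of_real s - p)"
  have xg: "x \<in> cstar_generated {p}" unfolding x_def using generated_superset[of "{p}"] by (auto intro!: D)
  have "norm (of_real s - p) < s + e" using s e by simp
  then have "norm x < 1" unfolding x_def norm_scaleR using s0 e by (simp add: divide_less_eq)
  moreover have "cstar x = x" by (simp add: x_def s)
  ultimately obtain t where t: "t \<in> cstar_generated {x}" "cstar t = t" "t * t = 1 - x" "norm (1 - t) \<le> 1"
    using sqrt_one_minus by blast
  define r where "r = sqrt (s + e) *\<^sub>R t"
  have "r * r = (s + e) *\<^sub>R (1 - x)" using s0 e by (simp add: r_def t)
  also have "\<dots> = p + of_real e" using s0 e by (simp add: x_def scaleR_diff_right) (simp add: of_real_def algebra_simps)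
  finally have "r * r = p + of_real e" .
  moreover have "cpos t" using t by (intro cposI[of _ 1]) simp_all
  then have "cpos r" unfolding r_def using s0 e by (intro cpos_scaleR) auto
  moreover have "r \<in> cstar_generated {p}" unfolding r_def using generated_mono[OF xg] t(1) by (auto intro!: D)
  ultimately show ?thesis by blast
qed

text \<open>Every \<open>s\<close> above the norm is a valid witness in \<open>cpos\<close>. Hence
  the witness may be taken to be \<open>norm p\<close>, which depends continuously on
  \<open>p\<close> and makes the positive cone closed.\<close>

lemma cpos_norm_bound:
  assumes p: "cpos p" and s: "norm p \<le> s"
  shows "norm (of_real s - p) \<le> s"
proof (rule field_le_epsilon)
  fix e :: real assume e: "0 < e"
  obtain t where t: "cpos t" "t * t = p + of_real e" using cpos_sqrt_eps[OF p e] by blast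
  have "(norm t)\<^sup>2 \<le> s + e"
    using norm_square_sa[OF cpos_sa[OF t(1)]] norm_triangle_ineq[of p "of_real e"] s e by (simp add: t)
  from norm_of_real_diff_square[OF cpos_sa[OF t(1)] this]
  show "norm (of_real s - p) \<le> s + e" by (simp add: t)
qed

lemma closed_cpos: "closed {x :: 'a::unital_cstar_algebra. cpos x}"
proof -
  have "{x :: 'a. cpos x} = {x. cstar x = x} \<inter> {x. norm (of_real (norm x) - x) \<le> norm x}"
    using cpos_norm_bound by (auto simp: cpos_def)
  moreover have "closed {x::'a. cstar x = x}" by (intro closed_Collect_eq continuous_intros)
  moreover have "closed {x::'a. norm (of_real (norm x) - x) \<le> norm x}"
    by (intro closed_Collect_le continuous_intros)
  ultimately show ?thesis by auto
qed

lemma cpos_tendsto: "(f \<longlongrightarrow> p) F \<Longrightarrow> eventually (\<lambda>e. cpos (f e)) F \<Longrightarrow> F \<noteq> bot \<Longrightarrow> cpos p"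
  using Lim_in_closed_set[OF closed_cpos, of f F p] by simp

lemma cpos_limI:
  assumes "\<And>e. e > 0 \<Longrightarrow> cpos (p + e *\<^sub>R c)"
  shows "cpos p"
proof (rule cpos_tendsto[of "\<lambda>e. p + e *\<^sub>R c" p "at_right 0"])
  show "((\<lambda>e. p + e *\<^sub>R c) \<longlongrightarrow> p) (at_right 0)" by (auto intro!: tendsto_eq_intros)
  show "\<forall>\<^sub>F e in at_right 0. cpos (p + e *\<^sub>R c)"
    using eventually_at_right_less[of 0] by eventually_elim (rule assms)
qed simp

lemma cpos_conj_commuting:
  assumes q: "cpos q" and t: "cstar t = t" "t * q = q * t"
  shows "cpos (t * q * t)"
proof (rule cpos_limI[where c="t * t"])
  fix e :: real assume e: "0 < e"
  obtain r where r: "r \<in> cstar_generated {q}" "cpos r" "r * r = q + of_real e"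
    using cpos_sqrt_eps[OF q e] by blast
  have "r * t = t * r" using generated_commute[OF r(1)] t by simp
  then have "(r * t) * (r * t) = t * (r * r) * t" by (simp add: mult.assoc)
  moreover have "cstar (r * t) = r * t" by (simp add: cpos_sa[OF r(2)] t \<open>r * t = t * r\<close>)
  ultimately have "cpos (t * (r * r) * t)" using cpos_square by metis
  then show "cpos (t * q * t + e *\<^sub>R (t * t))" by (simp add: r algebra_simps of_real_def)
qed

lemma cpos_mult:
  assumes p: "cpos p" and q: "cpos q" and comm: "p * q = q * p"
  shows "cpos (p * q)"
proof (rule cpos_limI[where c=q])
  fix e :: real assume e: "0 < e"
  obtain t where t: "t \<in> cstar_generated {p}" "cpos t" "t * t = p + of_real e"
    using cpos_sqrt_eps[OF p e] by blast
  have tq: "t * q = q * t" using generated_commute[OF t(1) comm cpos_sa[OF q]] .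
  have "t * q * t = t * t * q" by (simp only: mult.assoc tq[symmetric])
  moreover have "cpos (t * q * t)" using q cpos_sa[OF t(2)] tq by (rule cpos_conj_commuting)
  ultimately show "cpos (p * q + e *\<^sub>R q)" by (simp add: t distrib_right of_real_def)
qed

text \<open>\<open>(c - h) * (c + h) = c\<^sup>2 - h * h\<close> is a product of commuting positive
  elements. Shifted by \<open>e\<close> it is a square \<open>d * d\<close>, so
  \<open>h * h + d * d\<close> is the scalar \<open>c\<^sup>2 + e\<close> and
  \<open>norm_le_of_squares\<close> applies.\<close>

lemma norm_le_of_cpos:
  assumes m: "cpos (of_real c - h)" and p: "cpos (of_real c + h)" and c: "0 \<le> c"
  shows "norm h \<le> c"
proof -
  have sa: "cstar h = h" using cpos_sa[OF p] by simp
  have "cpos ((of_real c - h) * (of_real c + h))"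
    using m p by (rule cpos_mult) (simp add: algebra_simps of_real_def)
  moreover have "(of_real c - h) * (of_real c + h) = of_real (c\<^sup>2) - h * h"
    by (simp add: algebra_simps of_real_def power2_eq_square)
  ultimately have pos: "cpos (of_real (c\<^sup>2) - h * h)" by simp
  have "(norm h)\<^sup>2 \<le> c\<^sup>2 + e" if e: "e > 0" for e
  proof -
    obtain d where d: "d \<in> cstar_generated {of_real (c\<^sup>2) - h * h}" "cpos d"
      "d * d = of_real (c\<^sup>2) - h * h + of_real e"
      using cpos_sqrt_eps[OF pos e] by blast
    have "d * h = h * d"
      using d(1) by (rule generated_commute) (simp_all add: sa algebra_simps of_real_def)
    then show ?thesis
      using e by (intro norm_le_of_squares[of h d]) (simp_all add: sa cpos_sa[OF d(2)] d)
  qed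
  then have "(norm h)\<^sup>2 \<le> c\<^sup>2" by (rule field_le_epsilon)
  then show ?thesis using c by (rule power2_le_imp_le)
qed

lemma cpos_antisym:
  assumes p: "cpos p" and m: "cpos (- p)"
  shows "p = 0"
proof (rule ccontr)
  assume "p \<noteq> 0"
  then have n: "norm p > 0" by simp
  \<comment> \<open>Rescaling to norm 2: if \<open>p\<close> and \<open>- p\<close> are positive,
    then so are \<open>1 - ?q\<close> and \<open>1 + ?q\<close>, which forces norm at most
    1.\<close>
  let ?q = "(2 / norm p) *\<^sub>R p"
  have "cpos (of_real 1 - ?q)" "cpos (of_real 1 + ?q)"
    using cpos_add[OF cpos_of_real[of 1] cpos_scaleR[OF m, of "2 / norm p"]]
      cpos_add[OF cpos_of_real[of 1] cpos_scaleR[OF p, of "2 / norm p"]] n by simp_all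
  then have "norm ?q \<le> 1" by (rule norm_le_of_cpos) simp
  then show False using n by simp
qed

lemma cpos_of_real_iff [simp]: "cpos (of_real c :: 'a::unital_cstar_algebra) \<longleftrightarrow> 0 \<le> c"
proof
  assume pos: "cpos (of_real c :: 'a)"
  show "0 \<le> c"
  proof (rule ccontr)
    assume "\<not> 0 \<le> c"
    then have "cpos (- (of_real c :: 'a))" using cpos_of_real[of "- c"] by simp
    with pos have "(of_real c :: 'a) = 0" by (rule cpos_antisym)
    with \<open>\<not> 0 \<le> c\<close> show False by simp
  qed
qed (rule cpos_of_real)

lemma cpos_norm_le:
  assumes a: "cpos a" and c: "cpos (of_real c - a)"
  shows "norm a \<le> c"
proof -
  have c0: "0 \<le> c" using cpos_add[OF a c] by simp
  have "cpos (of_real c + a)" using a c0 by (intro cpos_add cpos_of_real)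
  then show ?thesis using c c0 by (intro norm_le_of_cpos)
qed

text \<open>For the commuting \<open>d = q - r\<close> and \<open>s = q + r\<close> the difference
  \<open>s * s - d * d\<close> is four times \<open>q * r\<close>, hence positive; so
  \<open>d ^ 4\<close> is below the square of \<open>d * s\<close>, and norms respect the order on
  positive elements. This makes the roots of \<open>p + 1 / n\<close> a Cauchy sequence.\<close>

lemma cpos_sqrt_norm_diff:
  assumes q: "cpos q" and r: "cpos r" and comm: "q * r = r * q"
  shows "(norm (q - r))\<^sup>2 \<le> norm (q * q - r * r)"
proof -
  define d s where "d = q - r" and "s = q + r"
  have sa: "cstar d = d" "cstar s = s" using cpos_sa[OF q] cpos_sa[OF r] by (simp_all add: d_def s_def)
  have ds: "d * s = q * q - r * r" "s * d = d * s"
    by (simp_all add: d_def s_def algebra_simps comm)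
  have "cpos (4 *\<^sub>R (q * r))" using cpos_mult[OF q r comm] by (rule cpos_scaleR) simp
  moreover have "4 *\<^sub>R (q * r) = s * s - d * d"
    by (simp add: d_def s_def algebra_simps comm scaleR_left.add[of 2 2, simplified] scaleR_2)
  ultimately have "cpos (s * s - d * d)" by simp
  then have "cpos (d * (s * s - d * d) * d)"
    by (rule cpos_conj_commuting) (simp add: sa, simp add: algebra_simps ds(2)[symmetric], metis ds(2) mult.assoc)
  moreover have "d * (s * s - d * d) * d = (d * s) * (d * s) - (d * d) * (d * d)"
    by (simp add: algebra_simps) (metis ds(2) mult.assoc)
  ultimately have "cpos ((d * s) * (d * s) - (d * d) * (d * d))" by simp
  moreover have sads: "cstar (d * s) = d * s" by (simp add: sa ds(2))
  have "cpos (of_real (norm ((d * s) * (d * s))) - (d * s) * (d * s))"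
    by (rule cpos_norm_minus, subst cstar_mult, simp_all only: sads)
  ultimately have "cpos (of_real (norm ((d * s) * (d * s))) - (d * d) * (d * d))"
    using cpos_add by fastforce
  moreover have "cpos ((d * d) * (d * d))" by (rule cpos_square) (simp add: sa)
  ultimately have "norm ((d * d) * (d * d)) \<le> norm ((d * s) * (d * s))" by (intro cpos_norm_le)
  then have "((norm d)\<^sup>2)\<^sup>2 \<le> (norm (d * s))\<^sup>2"
    using norm_square_sa[of "d * d"] norm_square_sa[of d] norm_square_sa[OF sads] sa by simp
  then have "(norm d)\<^sup>2 \<le> norm (d * s)" by (rule power2_le_imp_le) simp
  then show ?thesis by (simp add: ds) (simp add: d_def)
qed

lemma cpos_sqrt:
  fixes p :: "'a::unital_cstar_algebra"
  assumes p: "cpos p"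
  shows "\<exists>q\<in>cstar_generated {p}. cpos q \<and> q * q = p"
proof -
  let ?e = "\<lambda>n. inverse (real (Suc n))"
  have "\<exists>t. t \<in> cstar_generated {p} \<and> cpos t \<and> t * t = p + of_real (?e n)" for n
    using cpos_sqrt_eps[OF p, of "?e n"] by auto
  then obtain t where t: "\<And>n. t n \<in> cstar_generated {p}" "\<And>n. cpos (t n)"
    "\<And>n. t n * t n = p + of_real (?e n)"
    by metis
  have bd: "(norm (t n - t k))\<^sup>2 \<le> \<bar>?e n - ?e k\<bar>" for n k
  proof -
    have "t n * t k = t k * t n"
      using t(1)[of n] t(1)[of k] cpos_sa[OF p] cpos_sa[OF t(2)[of k]] by (rule generated_commutative)
    from cpos_sqrt_norm_diff[OF t(2) t(2) this] show ?thesis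
      by (simp only: t(3) add_diff_cancel_left of_real_diff[symmetric] norm_of_real)
  qed
  have "Cauchy t"
  proof (rule metric_CauchyI)
    fix e :: real assume e: "0 < e"
    have "Cauchy ?e" by (rule convergent_Cauchy, rule convergentI, rule LIMSEQ_inverse_real_of_nat)
    then obtain M where M: "\<And>m n. m \<ge> M \<Longrightarrow> n \<ge> M \<Longrightarrow> dist (?e m) (?e n) < e\<^sup>2"
      using metric_CauchyD[of ?e "e\<^sup>2"] e by auto
    have "dist (t m) (t n) < e" if "m \<ge> M" "n \<ge> M" for m n
    proof -
      have "(norm (t m - t n))\<^sup>2 < e\<^sup>2" using bd[of m n] M[OF that] by (simp add: dist_real_def)
      then show ?thesis using e by (simp add: dist_norm power2_less_imp_less)
    qed
    then show "\<exists>M. \<forall>m\<ge>M. \<forall>n\<ge>M. dist (t m) (t n) < e" by blast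
  qed
  then obtain q where q: "t \<longlonglongrightarrow> q" using Cauchy_convergent_iff convergent_def by blast
  have "q \<in> cstar_generated {p}"
    using closed_sequentially[OF cstar_subalgebraD(2)[OF cstar_subalgebra_generated] t(1) q] .
  moreover have "cpos q" by (rule cpos_tendsto[OF q]) (simp_all add: t)
  moreover have "(\<lambda>n. t n * t n) \<longlonglongrightarrow> p + of_real 0"
    unfolding t(3) by (intro tendsto_intros LIMSEQ_inverse_real_of_nat)
  then have "q * q = p" using LIMSEQ_unique[OF tendsto_mult[OF q q]] by simp
  ultimately show ?thesis by blast
qed

section \<open>Positivity of \<open>cstar y * y\<close>\<close>

lemma le_of_pow2_le:
  fixes N M Y :: real
  assumes "\<And>k. N ^ (2 ^ k) \<le> M ^ (2 ^ k) * (1 + real (2 ^ k) * Y)" and M: "0 < M" and N: "0 \<le> N"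
  shows "N \<le> M"
proof (rule ccontr)
  assume "\<not> N \<le> M"
  then have NM: "M < N" by simp
  \<comment> \<open>After division by the power of \<open>N\<close> the geometric decay of
    \<open>x ^ n\<close> beats the factor linear in \<open>n\<close>.\<close>
  define x where "x = M / N"
  have x: "0 < x" "x < 1" using M NM by (auto simp: x_def)
  have "(\<lambda>n. x ^ n + Y * (of_nat n * x ^ n)) \<longlonglongrightarrow> 0 + Y * 0"
    using x by (intro tendsto_intros LIMSEQ_power_zero powser_times_n_limit_0) auto
  then have "(\<lambda>n. x ^ n + Y * (of_nat n * x ^ n)) \<longlonglongrightarrow> 0" by simp
  from LIMSEQ_D[OF this, of 1] obtain K where K: "\<And>n. n \<ge> K \<Longrightarrow> \<bar>x ^ n + Y * (real n * x ^ n)\<bar> < 1"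
    by auto
  have "K \<le> 2 ^ K" by (simp add: less_exp less_imp_le)
  from K[OF this] have lt: "x ^ (2 ^ K) * (1 + real (2 ^ K) * Y) < 1" by (simp add: algebra_simps)
  have Np: "0 < N ^ (2 ^ K)" using NM M by simp
  have "1 \<le> x ^ (2 ^ K) * (1 + real (2 ^ K) * Y)"
    using assms(1)[of K] Np by (simp add: x_def power_divide field_simps)
  with lt show False by simp
qed

text \<open>The norm inequality replaces the equality of the nonzero spectra of \<open>y * cstar y\<close> and
  \<open>cstar y * y\<close>.\<close>

lemma norm_shift_mult_cstar:
  fixes y :: "'a::unital_cstar_algebra"
  assumes s: "0 \<le> s" and le: "norm (of_real s + cstar y * y) \<le> M" "s \<le> M"
  shows "norm (of_real s + y * cstar y) \<le> M"
proof (rule field_le_epsilon)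
  fix e :: real assume e: "0 < e"
  define a b where "a = cstar y * y" and "b = y * cstar y"
  define L where "L = M + e"
  have L: "0 < L" "s \<le> L" "norm (of_real s + a) \<le> L" using s le e by (auto simp: L_def a_def)
  \<comment> \<open>Pulling \<open>y\<close> and \<open>cstar y\<close> to the outside turns powers
    of \<open>s + y * cstar y\<close> into powers of \<open>s + cstar y * y\<close>, whose norm is
    controlled. The estimate is \<open>norm g \<le> n * L ^ (n - 1)\<close>, multiplied by
    \<open>L\<close> to avoid the exponent \<open>n - 1\<close>.\<close>
  have "\<exists>g. (of_real s + b) ^ n = of_real (s ^ n) + y * g * cstar y \<and> norm g * L \<le> real n * L ^ n" for n
  proof (induction n)
    case 0 then show ?case by (intro exI[of _ 0]) simp
  next
    case (Suc n)
    then obtain g where g: "(of_real s + b) ^ n = of_real (s ^ n) + y * g * cstar y" "norm g * L \<le> real n * L ^ n"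
      by blast
    let ?g = "of_real (s ^ n) + g * (of_real s + a)"
    have "(of_real s + b) ^ Suc n = (of_real (s ^ n) + y * g * cstar y) * (of_real s + b)"
      by (simp only: power_Suc2 g)
    also have "\<dots> = of_real (s ^ Suc n) + y * ?g * cstar y"
      by (simp only: a_def b_def of_real_def)
        (simp add: algebra_simps)
    finally have 1: "(of_real s + b) ^ Suc n = of_real (s ^ Suc n) + y * ?g * cstar y" .
    have "norm ?g \<le> s ^ n + norm g * L"
      using order_trans[OF norm_mult_ineq mult_left_mono[OF L(3) norm_ge_zero]] s
      by (intro order_trans[OF norm_triangle_ineq] add_mono) (simp_all del: of_real_power)
    also have "\<dots> \<le> L ^ n + real n * L ^ n" using g(2) s L by (intro add_mono power_mono) auto
    finally have "norm ?g * L \<le> (L ^ n + real n * L ^ n) * L" using L by (intro mult_right_mono) auto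
    then have "norm ?g * L \<le> real (Suc n) * L ^ Suc n" by (simp add: algebra_simps)
    with 1 show ?case by blast
  qed
  then have pw: "norm ((of_real s + b) ^ n) \<le> L ^ n * (1 + real n * ((norm y)\<^sup>2 / L))" for n
  proof -
    obtain g where g: "(of_real s + b) ^ n = of_real (s ^ n) + y * g * cstar y" "norm g * L \<le> real n * L ^ n"
      using \<open>\<And>n. \<exists>g. _ n g\<close> by blast
    have "norm (y * g * cstar y) \<le> norm y * norm g * norm y"
      using norm_mult_ineq[of "y * g" "cstar y"] norm_mult_ineq[of y g]
      by (smt (verit) mult_right_mono norm_cstar norm_ge_zero)
    then have "norm ((of_real s + b) ^ n) \<le> s ^ n + (norm y)\<^sup>2 * norm g"
      unfolding g using norm_triangle_ineq[of "of_real (s ^ n)" "y * g * cstar y"] s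
      by (simp add: power2_eq_square algebra_simps del: of_real_power)
    also have "\<dots> \<le> L ^ n + (norm y)\<^sup>2 * (real n * L ^ n / L)"
      using g(2) s L by (intro add_mono power_mono mult_left_mono) (auto simp: field_simps)
    finally show ?thesis by (simp add: algebra_simps)
  qed
  have sab: "cstar (of_real s + b) = of_real s + b" by (simp add: b_def)
  have "norm (of_real s + b) \<le> L"
    by (rule le_of_pow2_le[where Y="(norm y)\<^sup>2 / L"])
      (use pw[of "2 ^ _"] L norm_power_pow2_sa[OF sab] in auto)
  then show "norm (of_real s + y * cstar y) \<le> M + e" by (simp add: b_def L_def)
qed

text \<open>Positivity of \<open>cstar y * y\<close> is still open here. With \<open>s\<close> the
  norm of \<open>d - cstar y * y\<close>, the norm criterion reads
  \<open>norm (s + cstar y * y) \<le> s + d\<close>, an inequality that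
  \<open>norm_shift_mult_cstar\<close> carries over to \<open>y * cstar y\<close>.\<close>

lemma cpos_shift_mult_cstar:
  fixes y :: "'a::unital_cstar_algebra"
  assumes d: "0 \<le> d" and pos: "cpos (of_real d - cstar y * y)"
  shows "cpos (of_real d - y * cstar y)"
proof -
  define s where "s = norm (of_real d - cstar y * y)"
  have s: "0 \<le> s" by (simp add: s_def)
  have "norm (of_real (s + d) - (of_real d - cstar y * y)) \<le> s + d"
    using pos d by (intro cpos_norm_bound) (simp_all add: s_def)
  then have "norm (of_real s + cstar y * y) \<le> s + d" by simp
  then have "norm (of_real s + y * cstar y) \<le> s + d" using s d by (intro norm_shift_mult_cstar) auto
  then show ?thesis using d by (intro cposI[of _ "s + d"]) simp_all
qed

lemma inverse_one_minus:
  fixes x :: "'a::unital_cstar_algebra"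
  assumes x: "norm x < 1"
  shows "\<exists>y\<in>cstar_generated {x}. (1 - x) * y = 1"
proof -
  let ?D = "cstar_generated {x}"
  note D = cstar_subalgebra_intros[OF cstar_subalgebra_generated[of "{x}"]]
  have "dist (1 + x * y) (1 + x * z) \<le> norm x * dist y z" for y z
    using norm_mult_ineq[of x "y - z"] by (simp add: dist_norm right_diff_distrib)
  moreover have "complete ?D" unfolding complete_eq_closed by (rule D(2))
  moreover have "(\<lambda>y. 1 + x * y) ` ?D \<subseteq> ?D"
    using generated_superset[of "{x}"] by (auto intro!: D)
  moreover have "0 \<in> ?D" by (rule D)
  ultimately obtain y where "y \<in> ?D" "1 + x * y = y"
    using Banach_fix[of ?D "norm x" "\<lambda>y. 1 + x * y"] x by auto
  then show ?thesis by (intro bexI[of _ y]) (simp_all add: algebra_simps)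
qed

lemma cpos_inverse:
  fixes p :: "'a::unital_cstar_algebra"
  assumes p: "cpos p" and e: "0 < e" and q: "cpos q" "q * q = p + of_real e"
  shows "\<exists>w. cpos w \<and> w * q = 1 \<and> q * w = 1"
proof -
  obtain s where s: "cstar p = p" "norm (of_real s - p) \<le> s" using p by (auto simp: cpos_def)
  have s0: "0 \<le> s" using s(2) norm_ge_zero order_trans by blast
  define x where "x = (1/(s + e)) *\<^sub>R (of_real s - p)"
  have "norm (of_real s - p) < s + e" using s e by simp
  then have "norm x < 1" unfolding x_def norm_scaleR using s0 e by (simp add: divide_less_eq)
  then obtain y where y: "(1 - x) * y = 1" using inverse_one_minus by blast
  have xs: "cstar x = x" by (simp add: x_def s)
  have y': "cstar y * (1 - x) = 1" using arg_cong[OF y, of cstar] by (simp add: xs)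
  have ys: "cstar y = y" by (metis y y' mult.assoc mult_1 mult_1_right)
  have qq: "q * q = (s + e) *\<^sub>R (1 - x)"
    using s0 e by (simp add: q x_def scaleR_diff_right) (simp add: of_real_def algebra_simps)
  define w where "w = q * ((1/(s + e)) *\<^sub>R y)"
  have qw: "q * w = 1" using s0 e y by (simp add: w_def mult.assoc[symmetric] qq)
  have wq: "cstar w * q = 1" using arg_cong[OF qw, of cstar] by (simp add: cpos_sa[OF q(1)])
  have ws: "cstar w = w" by (metis qw wq mult.assoc mult_1 mult_1_right)
  \<comment> \<open>\<open>w\<close> equals \<open>q * (w * w)\<close>, a product of commuting
    positive elements.\<close>
  have "cpos (q * (w * w))"
    using q(1) cpos_square[OF ws] by (rule cpos_mult) (metis qw wq ws mult.assoc)
  moreover have "q * (w * w) = w" by (simp add: mult.assoc[symmetric] qw)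
  ultimately show ?thesis using qw wq ws by auto
qed


text \<open>Kelley and Vaught: if \<open>n\<close> is twice the negative part of \<open>p = cstar y * y\<close> and \<open>z = y * n\<close>, then
  \<open>2 * (cstar z * z) = - n\<^sup>3\<close>, which forces \<open>n = 0\<close>. The argument is run with the regularised
  absolute value \<open>q = sqrt (p\<^sup>2 + e)\<close>, so that \<open>n = q - p\<close> only becomes small.\<close>

lemma cpos_cstar_mult:
  fixes y :: "'a::unital_cstar_algebra"
  shows "cpos (cstar y * y)"
proof -
  define p where "p = cstar y * y"
  have sap: "cstar p = p" by (simp add: p_def)
  have key: "\<exists>n. (norm n)\<^sup>2 \<le> 4 * e \<and> cpos (p + n)" if e: "0 < e" for e
  proof -
    obtain q where q: "q \<in> cstar_generated {p * p}" "cpos q" "q * q = p * p + of_real e"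
      using cpos_sqrt_eps[OF cpos_square[OF sap] e] by blast
    have qp: "q * p = p * q" using q(1) by (rule generated_commute) (simp_all add: sap mult.assoc)
    obtain w where w: "cpos w" "w * q = 1" "q * w = 1"
      using cpos_inverse[OF cpos_square[OF sap] e q(2,3)] by blast
    define n where "n = q - p"
    have san: "cstar n = n" by (simp add: n_def cpos_sa[OF q(2)] sap)
    have nm: "n * (q + p) = of_real e" by (simp add: n_def algebra_simps q(3) qp)
    have "n * n = 2 *\<^sub>R (n * q) - n * (q + p)" by (simp add: n_def algebra_simps scaleR_2)
    then have nn: "2 *\<^sub>R (n * q) = n * n + of_real e" by (simp add: nm)
    have nq: "n * q = q * n" by (simp add: n_def algebra_simps qp)
    have wn: "w * n = n * w"
    proof -
      have "w * n = w * (n * q) * w" by (simp add: mult.assoc w)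
      also have "\<dots> = n * w" unfolding nq by (simp add: mult.assoc[symmetric] w)
      finally show ?thesis .
    qed
    have wnn: "w * (n * n) = n * n * w"
      by (simp add: mult.assoc[symmetric] wn) (simp add: mult.assoc wn)
    \<comment> \<open>A regularised form of the fact that \<open>p\<close> is below its absolute
      value: by \<open>2 * n * q = n * n + e\<close>, \<open>n\<close> is half the product of the
      positive \<open>n * n + e\<close> with the positive inverse \<open>w\<close> of
      \<open>q\<close>.\<close>
    have cn: "cpos n"
    proof -
      have "cpos (n * n + of_real e)" using e by (intro cpos_add cpos_square san) simp
      then have "cpos ((n * n + of_real e) * w)"
        using w(1) by (rule cpos_mult) (simp add: distrib_left distrib_right of_real_def wnn)
      moreover have "(n * n + of_real e) * w = 2 *\<^sub>R n"
        unfolding nn[symmetric] by (simp add: mult.assoc w)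
      ultimately have "cpos (2 *\<^sub>R n)" by simp
      from cpos_scaleR[OF this, of "1/2"] show ?thesis by simp
    qed
    define z where "z = y * n"
    define X where "X = cstar z * z"
    have pn: "2 *\<^sub>R (n * p) = of_real e - n * n"
      unfolding nm[symmetric] by (simp add: n_def algebra_simps scaleR_2)
    have "X = n * p * n" by (simp add: X_def z_def san p_def mult.assoc)
    then have "2 *\<^sub>R X = (2 *\<^sub>R (n * p)) * n" by simp
    then have X: "2 *\<^sub>R X = e *\<^sub>R n - n * n * n" by (simp add: pn left_diff_distrib of_real_def)
    define d where "d = e * norm n"
    have d0: "0 \<le> d" using e by (simp add: d_def)
    have n3: "cpos (n * n * n)" using cpos_square[OF san] cn by (rule cpos_mult) (simp add: mult.assoc)
    have "cpos (e *\<^sub>R (of_real (norm n) - n) + n * n * n)"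
      using e by (intro cpos_add cpos_scaleR cpos_norm_minus n3 san) auto
    moreover have "e *\<^sub>R (of_real (norm n) - n) + n * n * n = of_real d - 2 *\<^sub>R X"
      by (simp add: X d_def scaleR_diff_right of_real_def)
    ultimately have "cpos ((1/2) *\<^sub>R (of_real d - 2 *\<^sub>R X))" by (intro cpos_scaleR) auto
    then have dX: "cpos (of_real (d/2) - X)" by (simp add: scaleR_diff_right of_real_def)
    define Y where "Y = z * cstar z"
    have dY: "cpos (of_real (d/2) - Y)"
      unfolding Y_def using d0 dX by (intro cpos_shift_mult_cstar) (simp_all add: X_def)
    \<comment> \<open>With \<open>z = h + \<i> k\<close> the sum
      \<open>cstar z * z + z * cstar z\<close> is \<open>2 * (h * h + k * k)\<close>. Together with
      the upper bound for \<open>Y\<close> it bounds \<open>X\<close> from below by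
      \<open>- d / 2\<close>.\<close>
    have XY: "cpos (X + Y)"
    proof -
      define h k where "h = (1/2) *\<^sub>R (z + cstar z)" and "k = scaleC (\<i>/2) (cstar z - z)"
      have "cstar h = h" "cstar k = k"
        by (simp_all add: h_def k_def algebra_simps cvs.scale_right_diff_distrib cvs.scale_minus_left)
      then have pos: "cpos (2 *\<^sub>R (h * h + k * k))" by (intro cpos_scaleR cpos_add cpos_square) auto
      have "h * h = (1/4) *\<^sub>R ((z + cstar z) * (z + cstar z))" by (simp add: h_def)
      moreover have "\<i> / 2 * (\<i> / 2) = complex_of_real (- 1/4)" by simp
      then have "k * k = - ((1/4) *\<^sub>R ((cstar z - z) * (cstar z - z)))"
        by (simp only: k_def mult_scaleC scaleC_scaleC scaleC_of_real) simp
      ultimately have "2 *\<^sub>R (h * h + k * k) =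
          (1/2) *\<^sub>R ((z + cstar z) * (z + cstar z) - (cstar z - z) * (cstar z - z))"
        by (simp add: scaleR_diff_right scaleR_add_right)
      also have "(z + cstar z) * (z + cstar z) - (cstar z - z) * (cstar z - z) = 2 *\<^sub>R (X + Y)"
        by (simp add: X_def Y_def algebra_simps scaleR_2)
      finally show ?thesis using pos by simp
    qed
    have "cpos (of_real (d/2) + X)" using cpos_add[OF XY dY] by (simp add: algebra_simps)
    then have "norm X \<le> d / 2" using dX d0 by (intro norm_le_of_cpos) auto
    then have "norm (e *\<^sub>R n - n * n * n) \<le> d" unfolding X[symmetric] by simp
    then have n3n: "norm (n * n * n) \<le> 2 * d"
      using norm_triangle_ineq4[of "e *\<^sub>R n" "e *\<^sub>R n - n * n * n"] e by (simp add: d_def)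
    have "((norm n)\<^sup>2)\<^sup>2 = norm (n * n * n * n)"
      using norm_square_sa[of "n * n"] norm_square_sa[OF san] by (simp add: san mult.assoc)
    also have "\<dots> \<le> 2 * d * norm n"
      by (rule order_trans[OF norm_mult_ineq mult_right_mono[OF n3n norm_ge_zero]])
    also have "\<dots> = 2 * e * (norm n)\<^sup>2" by (simp add: d_def power2_eq_square)
    finally have "(norm n)\<^sup>2 * (norm n)\<^sup>2 \<le> 2 * e * (norm n)\<^sup>2"
      by (simp only: power2_eq_square[of "(norm n)\<^sup>2"])
    then have "(norm n)\<^sup>2 \<le> 2 * e" if "n \<noteq> 0"
      by (rule mult_right_le_imp_le) (use that in auto)
    then have "(norm n)\<^sup>2 \<le> 4 * e" using e by (cases "n = 0") auto
    moreover have "cpos (p + n)" by (simp add: n_def q)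
    ultimately show ?thesis by blast
  qed
  have "\<exists>n. (norm n)\<^sup>2 \<le> 4 * inverse (real (Suc k)) \<and> cpos (p + n)" for k
    by (rule key) simp
  then obtain n where n: "\<And>k. (norm (n k))\<^sup>2 \<le> 4 * inverse (real (Suc k))" "\<And>k. cpos (p + n k)"
    by metis
  have "(\<lambda>k. (norm (n k))\<^sup>2) \<longlonglongrightarrow> 0"
  proof (rule tendsto_sandwich[OF _ _ tendsto_const])
    show "(\<lambda>k. 4 * inverse (real (Suc k))) \<longlonglongrightarrow> 0"
      using tendsto_mult_right_zero[OF LIMSEQ_inverse_real_of_nat] .
  qed (use n in auto)
  then have "n \<longlonglongrightarrow> 0" by (simp add: tendsto_norm_zero_iff)
  then have "(\<lambda>k. p + n k) \<longlonglongrightarrow> p + 0" by (intro tendsto_intros)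
  then have "cpos (p + 0)" by (rule cpos_tendsto) (simp_all add: n)
  then show ?thesis by (simp add: p_def)
qed

lemma cpos_mult_cstar: "cpos (y * cstar y)"
  using cpos_cstar_mult[of "cstar y"] by simp

lemma cpos_conj:
  assumes y: "cpos y"
  shows "cpos (cstar c * y * c)"
proof (rule cpos_limI[where c="cstar c * c"])
  fix e :: real assume e: "0 < e"
  obtain r where r: "cpos r" "r * r = y + of_real e" using cpos_sqrt_eps[OF y e] by blast
  have "cstar (r * c) * (r * c) = cstar c * (r * r) * c" by (simp add: cpos_sa[OF r(1)] mult.assoc)
  also have "\<dots> = cstar c * y * c + e *\<^sub>R (cstar c * c)" by (simp add: r algebra_simps of_real_def)
  finally show "cpos (cstar c * y * c + e *\<^sub>R (cstar c * c))" using cpos_cstar_mult by metis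
qed

lemma cpos_conj': "cpos y \<Longrightarrow> cpos (c * y * cstar c)"
  using cpos_conj[of y "cstar c"] by simp

lemma cpos_ex_cstar_mult: "cpos p \<Longrightarrow> \<exists>q\<in>cstar_generated {p}. p = cstar q * q"
  using cpos_sqrt cpos_sa by metis

lemma cstar_pos_cpos: "x \<in> cstar_pos A \<Longrightarrow> cpos x"
  by (auto simp: cstar_pos_def cpos_cstar_mult)

lemma cstar_pos_UNIV: "x \<in> cstar_pos UNIV \<longleftrightarrow> cpos x"
  using cstar_pos_cpos[of x UNIV] cpos_ex_cstar_mult[of x] unfolding cstar_pos_def by blast

lemma cstar_mult_eq_0_iff [simp]: "cstar x * x = 0 \<longleftrightarrow> (x::'a::unital_cstar_algebra) = 0"
  using cstar_identity[of x] by auto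

section \<open>Order dichotomy and scalars\<close>

text \<open>\<open>q\<close> is the absolute value of \<open>w\<close>; \<open>q + w\<close> and
  \<open>q - w\<close> are twice its positive and negative parts, and their product
  vanishes.\<close>

lemma sa_abs:
  fixes w :: "'a::unital_cstar_algebra"
  assumes w: "cstar w = w"
  shows "\<exists>q\<in>cstar_generated {w}. cpos q \<and> q * q = w * w \<and> (q + w) * (q - w) = 0"
proof -
  obtain q where q: "q \<in> cstar_generated {w * w}" "cpos q" "q * q = w * w"
    using cpos_sqrt[OF cpos_square[OF w]] by blast
  have "w * w \<in> cstar_generated {w}"
    using cstar_subalgebraD(4)[OF cstar_subalgebra_generated] generated_superset[of "{w}"] by auto
  then have "q \<in> cstar_generated {w}" using q(1) generated_mono by blast
  moreover have "q * w = w * q" using q(1) by (rule generated_commute) (simp_all add: w mult.assoc)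
  then have "(q + w) * (q - w) = 0" by (simp add: algebra_simps q(3))
  ultimately show ?thesis using q by blast
qed

text \<open>The real \<open>t\<close> with \<open>t * k\<close> below \<open>x\<close> and those
  with \<open>t * k\<close> above \<open>x\<close> form two closed sets that cover the connected
  interval \<open>{a..b}\<close> and both meet it, so some \<open>t\<close> lies in both. This
  replaces the argument that an element with one-point spectrum is scalar.\<close>

lemma eq_scaleR_of_dichotomy:
  fixes x k :: "'a::unital_cstar_algebra"
  assumes di: "\<And>t::real. cpos (x - t *\<^sub>R k) \<or> cpos (t *\<^sub>R k - x)"
    and a: "cpos (x - a *\<^sub>R k)" and b: "cpos (b *\<^sub>R k - x)" and ab: "a \<le> b"
  shows "\<exists>t. x = t *\<^sub>R k"
proof -
  let ?S = "{t. cpos (x - t *\<^sub>R k)}" and ?T = "{t. cpos (t *\<^sub>R k - x)}"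
  have "closed ?S" "closed ?T"
    using continuous_closed_vimage[OF closed_cpos, of "\<lambda>t. x - t *\<^sub>R k"]
      continuous_closed_vimage[OF closed_cpos, of "\<lambda>t. t *\<^sub>R k - x"]
    by (auto simp: vimage_def intro!: continuous_intros)
  moreover have "connected {a..b}" by simp
  ultimately have "\<not> ({a..b} \<subseteq> ?S \<union> ?T \<and> ?S \<inter> ?T \<inter> {a..b} = {} \<and> ?S \<inter> {a..b} \<noteq> {} \<and> ?T \<inter> {a..b} \<noteq> {})"
    unfolding connected_closed by blast
  then obtain t where "cpos (x - t *\<^sub>R k)" "cpos (t *\<^sub>R k - x)" using di a b ab by fastforce
  then have "x - t *\<^sub>R k = 0" by (intro cpos_antisym) auto
  then show ?thesis by auto
qed

section \<open>Conditional expectations\<close>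

text \<open>The explicit formulas are part of the conclusion because subalgebras containing
  \<open>x\<close> must be seen to contain \<open>h\<close> and \<open>k\<close>.\<close>

lemma cartesian_decomposition:
  fixes x :: "'a::unital_cstar_algebra"
  obtains h k where "cstar h = h" "cstar k = k" "x = h + scaleC \<i> k" "norm h \<le> norm x" "norm k \<le> norm x"
    "h = (1/2) *\<^sub>R (x + cstar x)" "k = scaleC (- \<i>/2) (x - cstar x)"
proof
  let ?h = "(1/2) *\<^sub>R (x + cstar x)" and ?k = "scaleC (- \<i>/2) (x - cstar x)"
  show "cstar ?h = ?h" by (simp add: algebra_simps)
  show "cstar ?k = ?k"
    by (simp add: algebra_simps cvs.scale_right_diff_distrib cvs.scale_minus_left)
  show "x = ?h + scaleC \<i> ?k"
    using scaleC_of_real[of "1/2" "x - cstar x"] by (simp add: scaleC_scaleC algebra_simps flip: scaleR_add_left)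
  show "norm ?h \<le> norm x" using norm_triangle_ineq[of x "cstar x"] by simp
  have half: "cmod (- \<i>/2) = 1/2" by (simp add: norm_divide)
  show "norm ?k \<le> norm x"
    unfolding norm_scaleC half using norm_triangle_ineq4[of x "cstar x"] norm_cstar[of x] by linarith
qed (rule refl)+

locale cexp =
  fixes B :: "'a::unital_cstar_algebra set" and E :: "'a \<Rightarrow> 'a"
  assumes subalg: "cstar_subalgebra B" and cexp: "cond_expectation UNIV B E"
begin

lemma E_in [simp]: "E x \<in> B"
  and E_add: "E (x + y) = E x + E y"
  and E_scaleC: "E (scaleC c x) = scaleC c (E x)"
  and E_id: "b \<in> B \<Longrightarrow> E b = b"
  and E_left: "b \<in> B \<Longrightarrow> E (b * x) = b * E x"
  and E_right: "b \<in> B \<Longrightarrow> E (x * b) = E x * b"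
  using cexp by (auto simp: cond_expectation_def)

lemma E_one [simp]: "E 1 = 1"
  by (simp add: E_id cstar_subalgebraD[OF subalg])

lemma E_scaleR: "E (r *\<^sub>R x) = r *\<^sub>R E x"
  using E_scaleC[of "of_real r" x] by (simp add: scaleC_of_real)

lemma E_of_real [simp]: "E (of_real r) = of_real r"
  by (simp add: of_real_def E_scaleR)

lemma E_zero [simp]: "E 0 = 0"
  using E_of_real[of 0] by simp

lemma E_minus: "E (- x) = - E x"
  using E_scaleR[of "-1" x] by simp

lemma E_diff: "E (x - y) = E x - E y"
  using E_add[of x "- y"] by (simp add: E_minus)

lemma E_sum: "E (sum f A) = (\<Sum>i\<in>A. E (f i))"
  by (induction A rule: infinite_finite_induct) (simp_all add: E_add)

lemma E_cpos: "cpos x \<Longrightarrow> cpos (E x)"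
  using cexp cstar_pos_UNIV cstar_pos_cpos unfolding cond_expectation_def by blast

lemma E_cstar: "E (cstar x) = cstar (E x)"
proof -
  have sa: "cstar (E h) = E h" if "cstar h = h" for h
    using cpos_sa[OF E_cpos[OF cpos_norm_plus[OF that order_refl]]] by (simp add: E_add)
  obtain h k where hk: "cstar h = h" "cstar k = k" "x = h + scaleC \<i> k"
    using cartesian_decomposition by blast
  then show ?thesis by (simp add: E_add E_diff E_scaleC sa)
qed

text \<open>Positivity gives the constant 1 on self-adjoint elements; the factor 2 comes from
  treating real and imaginary parts separately and suffices for continuity.\<close>

lemma E_norm: "norm (E x) \<le> 2 * norm x"
proof -
  have sa: "norm (E h) \<le> norm h" if "cstar h = h" for h
    using E_cpos[OF cpos_norm_plus[OF that order_refl]] E_cpos[OF cpos_norm_minus[OF that order_refl]]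
    by (intro norm_le_of_cpos) (simp_all add: E_add E_diff)
  obtain h k where hk: "cstar h = h" "cstar k = k" "x = h + scaleC \<i> k" "norm h \<le> norm x" "norm k \<le> norm x"
    using cartesian_decomposition by blast
  have "norm (E x) \<le> norm (E h) + norm (E k)"
    using norm_triangle_ineq[of "E h" "scaleC \<i> (E k)"] by (simp add: hk(3) E_add E_scaleC norm_scaleC)
  then show ?thesis using sa[OF hk(1)] sa[OF hk(2)] hk by linarith
qed

lemma E_bounded_linear: "bounded_linear E"
  by (rule bounded_linear_intro[where K=2]) (use E_norm in \<open>auto simp: E_add E_scaleR mult.commute\<close>)

lemma Kadison_Schwarz: "cpos (E (x * cstar x) - E x * cstar (E x))"
proof -
  have Bs: "cstar (E x) \<in> B" by (simp add: cstar_subalgebraD[OF subalg])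
  have "E ((x - E x) * cstar (x - E x)) = E (x * cstar x) - E x * cstar (E x)"
    by (simp add: algebra_simps E_diff E_left E_right Bs E_cstar)
      (simp add: E_add E_left E_right E_id Bs E_cstar)
  then show ?thesis using E_cpos[OF cpos_mult_cstar[of "x - E x"]] by metis
qed

text \<open>Cauchy-Schwarz: \<open>l * cstar l\<close> is at most the scalar
  \<open>(norm l)\<^sup>2\<close>; conjugate by \<open>y\<close>, apply \<open>E\<close> and use
  \<open>Kadison_Schwarz\<close>. Through it the mere existence of a quasi-basis makes
  \<open>E\<close> faithful.\<close>

lemma E_mult_norm: "(norm (E (y * l)))\<^sup>2 \<le> (norm l)\<^sup>2 * norm (E (y * cstar y))"
proof -
  let ?z = "E (y * l)" and ?c = "(norm l)\<^sup>2" and ?e = "E (y * cstar y)"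
  have "cpos (of_real ?c - l * cstar l)"
    by (rule cpos_norm_minus) (simp_all add: cstar_identity')
  from E_cpos[OF cpos_conj'[OF this, of y]]
  have "cpos (?c *\<^sub>R ?e - E ((y * l) * cstar (y * l)))"
    by (simp add: algebra_simps E_diff of_real_def E_scaleR del: of_real_power)
  from cpos_add[OF this Kadison_Schwarz[of "y * l"]]
  have 1: "cpos (?c *\<^sub>R ?e - ?z * cstar ?z)" by simp
  have "cpos (of_real (norm ?e) - ?e)"
    by (rule cpos_norm_minus) (simp_all add: E_cstar[symmetric])
  then have "cpos (?c *\<^sub>R (of_real (norm ?e) - ?e))" by (rule cpos_scaleR) simp
  from cpos_add[OF this 1] have "cpos (of_real (?c * norm ?e) - ?z * cstar ?z)"
    by (simp add: scaleR_diff_right of_real_def del: of_real_power)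
  with cpos_mult_cstar have "norm (?z * cstar ?z) \<le> ?c * norm ?e" by (rule cpos_norm_le)
  then show ?thesis by (simp add: cstar_identity')
qed

end

section \<open>Quasi-bases, Bessel's inequality and the index\<close>

locale qexp = cexp B E for B :: "'a::unital_cstar_algebra set" and E +
  fixes L :: "'a::unital_cstar_algebra set"
  assumes qb: "quasi_basis UNIV B E L"
begin

lemma qb_right: "x = (\<Sum>l\<in>L. E (x * l) * cstar l)"
  using qb by (auto simp: quasi_basis_def)

lemma qb_left: "x = (\<Sum>l\<in>L. l * E (cstar l * x))"
proof -
  have "cstar (cstar x) = cstar (\<Sum>l\<in>L. E (cstar x * l) * cstar l)" using qb_right[of "cstar x"] by metis
  then show ?thesis by (simp add: E_cstar[symmetric])
qed

lemma faithful: "E (y * cstar y) = 0 \<Longrightarrow> y = 0"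
proof -
  assume "E (y * cstar y) = 0"
  then have "E (y * l) = 0" for l using E_mult_norm[of y l] by simp
  then show ?thesis using qb_right[of y] by simp
qed

text \<open>For the \<open>B\<close>-valued inner product \<open>E (cstar x * y)\<close> the
  \<open>cstar (c i)\<close> are orthonormal, and \<open>y l\<close> is the projection of
  \<open>l\<close> onto their right \<open>B\<close>-span. The sums of
  \<open>l * cstar (y l)\<close>, \<open>y l * cstar l\<close> and \<open>y l * cstar (y l)\<close>
  all equal \<open>?S\<close>, so the difference is the sum of the positive elements
  \<open>(l - y l) * cstar (l - y l)\<close>.\<close>

lemma bessel:
  assumes I: "finite I" and on: "\<And>i j. i \<in> I \<Longrightarrow> j \<in> I \<Longrightarrow> E (c i * cstar (c j)) = (if i = j then 1 else 0)"
  shows "cpos ((\<Sum>l\<in>L. l * cstar l) - (\<Sum>i\<in>I. cstar (c i) * c i))"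
proof -
  define y where "y l = (\<Sum>i\<in>I. cstar (c i) * E (c i * l))" for l
  let ?S = "\<Sum>i\<in>I. cstar (c i) * c i"
  have ly: "(\<Sum>l\<in>L. l * cstar (y l)) = ?S"
  proof -
    have "(\<Sum>l\<in>L. l * cstar (y l)) = (\<Sum>l\<in>L. \<Sum>i\<in>I. l * E (cstar l * cstar (c i)) * c i)"
      by (simp add: y_def sum_distrib_left E_cstar[symmetric] mult.assoc)
    also have "\<dots> = (\<Sum>i\<in>I. (\<Sum>l\<in>L. l * E (cstar l * cstar (c i))) * c i)"
      by (subst sum.swap) (simp add: sum_distrib_right)
    finally show ?thesis using qb_left by simp
  qed
  have "cstar (\<Sum>l\<in>L. l * cstar (y l)) = cstar ?S" by (simp only: ly)
  then have yl: "(\<Sum>l\<in>L. y l * cstar l) = ?S" by simp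
  have "(\<Sum>l\<in>L. y l * cstar (y l)) =
      (\<Sum>l\<in>L. \<Sum>i\<in>I. \<Sum>j\<in>I. cstar (c i) * (E (c i * l) * E (cstar l * cstar (c j))) * c j)"
    by (simp add: y_def sum_product E_cstar[symmetric] mult.assoc)
  also have "\<dots> = (\<Sum>i\<in>I. \<Sum>j\<in>I. \<Sum>l\<in>L. cstar (c i) * (E (c i * l) * E (cstar l * cstar (c j))) * c j)"
    by (subst sum.swap, rule sum.cong[OF refl], rule sum.swap)
  also have "\<dots> = (\<Sum>i\<in>I. \<Sum>j\<in>I. cstar (c i) * E (c i * (\<Sum>l\<in>L. l * E (cstar l * cstar (c j)))) * c j)"
    by (simp add: sum_distrib_left sum_distrib_right E_sum E_right mult.assoc[symmetric])
  also have "\<dots> = (\<Sum>i\<in>I. \<Sum>j\<in>I. cstar (c i) * E (c i * cstar (c j)) * c j)"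
    using qb_left by simp
  also have "\<dots> = (\<Sum>i\<in>I. \<Sum>j\<in>I. if i = j then cstar (c i) * c j else 0)"
    by (intro sum.cong refl) (simp add: on)
  also have "\<dots> = ?S" using I by simp
  finally have yy: "(\<Sum>l\<in>L. y l * cstar (y l)) = ?S" .
  have "(\<Sum>l\<in>L. (l - y l) * cstar (l - y l)) = (\<Sum>l\<in>L. l * cstar l) - ?S"
    by (simp add: algebra_simps sum.distrib sum_subtractf ly yl yy)
  then show ?thesis using cpos_sum[of L "\<lambda>l. (l - y l) * cstar (l - y l)"] cpos_mult_cstar by metis
qed

end

text \<open>Two systems of dual bases for the same \<open>f\<close> have the same sum of products:
  expand \<open>a i\<close> in the second system, exchange the sums, and collapse to
  \<open>d j\<close>. It serves for the Watatani index and again for the trace of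
  \<open>C\<close>.\<close>

lemma sum_dual_unique:
  fixes f :: "'a::semiring_0 \<Rightarrow> 'a"
  assumes "\<And>i. i \<in> I \<Longrightarrow> a i = (\<Sum>j\<in>J. c j * f (d j * a i))"
    and "\<And>j. j \<in> J \<Longrightarrow> d j = (\<Sum>i\<in>I. f (d j * a i) * b i)"
  shows "(\<Sum>i\<in>I. a i * b i) = (\<Sum>j\<in>J. c j * d j)"
proof -
  have "(\<Sum>i\<in>I. a i * b i) = (\<Sum>i\<in>I. \<Sum>j\<in>J. c j * f (d j * a i) * b i)"
    by (rule sum.cong[OF refl], subst assms(1)) (simp_all add: sum_distrib_right)
  also have "\<dots> = (\<Sum>j\<in>J. c j * (\<Sum>i\<in>I. f (d j * a i) * b i))"
    by (subst sum.swap) (simp add: sum_distrib_left mult.assoc)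
  also have "\<dots> = (\<Sum>j\<in>J. c j * d j)"
    by (rule sum.cong[OF refl]) (simp add: assms(2)[symmetric])
  finally show ?thesis .
qed

lemma watatani_index_eq:
  assumes "cstar_subalgebra B" and L: "quasi_basis UNIV B E L"
  shows "watatani_index UNIV B E = (\<Sum>l\<in>L. l * cstar l)"
proof -
  have "(\<Sum>m\<in>M. m * cstar m) = (\<Sum>l\<in>L. l * cstar l)" if M: "quasi_basis UNIV B E M" for M
  proof -
    interpret L: qexp B E L using assms by unfold_locales (auto simp: quasi_basis_def)
    interpret M: qexp B E M using assms M by unfold_locales
    show ?thesis
      by (rule sum_dual_unique[where a = "\<lambda>m. m" and b = cstar and c = "\<lambda>l. l" and d = cstar and f = E])
        (rule L.qb_left M.qb_right)+
  qed
  then show ?thesis unfolding watatani_index_def using L by (intro the_equality) blast+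
qed

section \<open>Scalars in simple algebras\<close>

lemma scalar_imp_scalars: "scaleC c 1 \<in> scalars" by (simp add: scalars_def)

text \<open>In a simple algebra the positive and the negative part of a self-adjoint central element
  cannot both be nonzero.\<close>

lemma center_scalar:
  assumes B: "cstar_subalgebra B" and simple: "cstar_simple B" and z: "z \<in> B" "\<And>b. b \<in> B \<Longrightarrow> z * b = b * z"
  shows "z \<in> scalars"
proof -
  note D = cstar_subalgebra_intros[OF B]
  define Z where "Z = B \<inter> centralizer_in UNIV B"
  have Zsub: "cstar_subalgebra Z"
    unfolding Z_def using D by (intro cstar_subalgebra_Int B cstar_subalgebra_centralizer) auto
  note DZ = cstar_subalgebra_intros[OF Zsub]
  have nzd: "x = 0 \<or> y = 0" if x: "x \<in> Z" and y: "y \<in> Z" and xy: "x * y = 0" for x y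
  proof -
    let ?I = "{w \<in> B. x * w = 0}"
    have xc: "x * b = b * x" if "b \<in> B" for b using x that by (auto simp: Z_def centralizer_in_def)
    have "x * (b * w) = 0 \<and> x * (w * b) = 0" if "b \<in> B" "x * w = 0" for b w
      using xc[OF that(1)] that(2) by (metis mult.assoc mult_zero_left mult_zero_right)
    moreover have "closed ?I"
    proof -
      have "?I = B \<inter> {w. x * w = 0}" by auto
      then show ?thesis by (auto intro!: closed_Int D closed_Collect_eq continuous_intros)
    qed
    ultimately have "closed_ideal B ?I" unfolding closed_ideal_def by (auto simp: algebra_simps D)
    then have "?I = {0} \<or> ?I = B" using simple by (simp add: cstar_simple_def)
    then show ?thesis
    proof
      assume "?I = {0}" then show ?thesis using y xy by (auto simp: Z_def)
    next
      assume "?I = B" then have "1 \<in> ?I" using D by simp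
      then show ?thesis by simp
    qed
  qed
  have di: "cpos w \<or> cpos (- w)" if w: "w \<in> Z" "cstar w = w" for w
  proof -
    obtain q where q: "q \<in> cstar_generated {w}" "cpos q" "(q + w) * (q - w) = 0"
      using sa_abs[OF w(2)] by blast
    have "q \<in> Z" using q(1) generated_minimal[OF Zsub, of "{w}"] w by auto
    then have "q + w = 0 \<or> q - w = 0" using q(3) w by (intro nzd DZ) auto
    then show ?thesis using q(2) by (metis add.inverse_unique add.commute eq_iff_diff_eq_0 minus_unique)
  qed
  have sa: "\<exists>t. w = of_real t" if w: "w \<in> Z" "cstar w = w" for w
  proof -
    have "\<exists>t. w = t *\<^sub>R 1"
    proof (rule eq_scaleR_of_dichotomy)
      show "cpos (w - t *\<^sub>R 1) \<or> cpos (t *\<^sub>R 1 - w)" for t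
        using di[of "w - t *\<^sub>R 1"] w by (simp add: DZ)
      show "cpos (w - (- norm w) *\<^sub>R 1)" using cpos_norm_plus[OF w(2) order_refl] by (simp add: of_real_def add.commute)
      show "cpos (norm w *\<^sub>R 1 - w)" using cpos_norm_minus[OF w(2) order_refl] by (simp add: of_real_def)
    qed simp
    then show ?thesis by (simp add: of_real_def)
  qed
  obtain h k where hk: "cstar h = h" "cstar k = k" "z = h + scaleC \<i> k"
    "h = (1/2) *\<^sub>R (z + cstar z)" "k = scaleC (- \<i>/2) (z - cstar z)"
    using cartesian_decomposition by blast
  have "z \<in> Z" using z by (simp add: Z_def centralizer_in_def)
  then have "h \<in> Z" "k \<in> Z" unfolding hk(4,5) by (simp_all only: DZ)
  then obtain s t where "h = of_real s" "k = of_real t" using sa hk(1,2) by blast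
  then have "z = scaleC (complex_of_real s + \<i> * complex_of_real t) 1"
    by (simp only: hk(3) of_real_scaleC scaleC_scaleC scaleC_add_left)
  then show ?thesis by (simp add: scalars_def)
qed

definition scalar_part :: "'a::unital_cstar_algebra \<Rightarrow> complex" where
  "scalar_part x = (THE c. x = scaleC c 1)"

lemma scalar_part_scaleC [simp]: "scalar_part (scaleC c 1 :: 'a::unital_cstar_algebra) = c"
  by (simp add: scalar_part_def)

lemma cpos_scaleC_one:
  assumes "cpos (scaleC c (1::'a::unital_cstar_algebra))"
  shows "\<exists>r\<ge>0. c = complex_of_real r"
proof -
  have "cnj c = c" using cpos_sa[OF assms] by simp
  then obtain r where r: "c = complex_of_real r" by (metis Reals_cases Reals_cnj_iff)
  then have "0 \<le> r" using assms cpos_of_real_iff[of r] by (metis of_real_scaleC)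
  with r show ?thesis by blast
qed

lemma le_norm_of_cpos_diff:
  fixes e :: "'a::unital_cstar_algebra"
  assumes "cpos (e - of_real m)" "cstar e = e"
  shows "m \<le> norm e"
proof -
  have "cpos (of_real (norm e) - e + (e - of_real m))"
    using assms by (intro cpos_add cpos_norm_minus) simp_all
  then have "cpos (of_real (norm e - m) :: 'a)" by simp
  then show ?thesis by (simp only: cpos_of_real_iff diff_ge_0_iff_ge)
qed

section \<open>The state that an expectation induces on the commutant\<close>

locale cexp_simple = cexp +
  assumes simple: "cstar_simple B"
begin

abbreviation C where "C \<equiv> centralizer_in UNIV B"

definition \<tau> where "\<tau> x = scalar_part (E x)"

lemma C_subalg: "cstar_subalgebra C"
  by (rule cstar_subalgebra_centralizer) (auto intro: cstar_subalgebraD[OF subalg])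

lemmas C_intros = cstar_subalgebra_intros[OF C_subalg]

lemma C_commute: "x \<in> C \<Longrightarrow> b \<in> B \<Longrightarrow> x * b = b * x"
  by (simp add: centralizer_in_def)

text \<open>By the bimodule property \<open>E x\<close> commutes with \<open>B\<close>, so it is
  central in the simple algebra \<open>B\<close>.\<close>

lemma E_C:
  assumes x: "x \<in> C"
  shows "E x = scaleC (\<tau> x) 1"
proof -
  have "E x * b = b * E x" if "b \<in> B" for b
    using C_commute[OF x that] E_left[OF that, of x] E_right[OF that, of x] by simp
  then have "E x \<in> scalars" using subalg simple E_in by (intro center_scalar)
  then show ?thesis by (auto simp: scalars_def \<tau>_def)
qed

lemma \<tau>_add: "x \<in> C \<Longrightarrow> y \<in> C \<Longrightarrow> \<tau> (x + y) = \<tau> x + \<tau> y"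
  unfolding \<tau>_def[of "x + y"] by (simp add: E_add E_C flip: scaleC_add_left)

lemma \<tau>_scaleC: "x \<in> C \<Longrightarrow> \<tau> (scaleC c x) = c * \<tau> x"
  unfolding \<tau>_def[of "scaleC c x"] by (simp add: E_scaleC E_C scaleC_scaleC)

lemma \<tau>_scaleR: "x \<in> C \<Longrightarrow> \<tau> (r *\<^sub>R x) = of_real r * \<tau> x"
  using \<tau>_scaleC[of x "of_real r"] by (simp add: scaleC_of_real)

lemma \<tau>_one [simp]: "\<tau> 1 = 1"
  using scalar_part_scaleC[of 1] by (simp add: \<tau>_def del: scalar_part_scaleC)

lemma \<tau>_zero [simp]: "\<tau> 0 = 0"
  using scalar_part_scaleC[of 0] by (simp add: \<tau>_def del: scalar_part_scaleC)

lemma \<tau>_diff: "x \<in> C \<Longrightarrow> y \<in> C \<Longrightarrow> \<tau> (x - y) = \<tau> x - \<tau> y"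
  using \<tau>_add[of x "(- 1) *\<^sub>R y"] \<tau>_scaleR[of y "-1"] by (simp add: C_intros)

lemma \<tau>_sum: "(\<And>i. i \<in> A \<Longrightarrow> f i \<in> C) \<Longrightarrow> \<tau> (sum f A) = (\<Sum>i\<in>A. \<tau> (f i))"
  by (induction A rule: infinite_finite_induct) (simp_all add: \<tau>_add C_intros)

lemma \<tau>_cstar: "x \<in> C \<Longrightarrow> \<tau> (cstar x) = cnj (\<tau> x)"
  unfolding \<tau>_def[of "cstar x"] by (simp add: E_cstar E_C)

lemma \<tau>_cpos: "x \<in> C \<Longrightarrow> cpos x \<Longrightarrow> \<exists>r\<ge>0. \<tau> x = complex_of_real r"
  using E_cpos[of x] by (intro cpos_scaleC_one) (simp add: E_C)

end

text \<open>Self-adjoint elements instead of projections, because an element can be split into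
  positive and negative parts before any projection is available.\<close>

definition orth_family :: "'a::unital_cstar_algebra set \<Rightarrow> 'a set \<Rightarrow> bool" where
  "orth_family D S \<longleftrightarrow> finite S \<and> S \<subseteq> D \<and> (\<forall>f\<in>S. cstar f = f \<and> f \<noteq> 0) \<and>
     (\<forall>f\<in>S. \<forall>g\<in>S. f \<noteq> g \<longrightarrow> f * g = 0)"

definition max_orth_family :: "'a::unital_cstar_algebra set \<Rightarrow> 'a set \<Rightarrow> bool" where
  "max_orth_family D S \<longleftrightarrow> orth_family D S \<and> (\<forall>S'. orth_family D S' \<longrightarrow> card S' \<le> card S)"

lemma sa_square_eq_0: "cstar f = f \<Longrightarrow> f * f = 0 \<Longrightarrow> f = (0::'a::unital_cstar_algebra)"
  by (metis cstar_mult_eq_0_iff)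

text \<open>Otherwise \<open>f\<close> could be replaced by the positive and the negative part of \<open>w\<close>.\<close>

lemma max_orth_family_dichotomy:
  assumes D: "cstar_subalgebra D" and S: "max_orth_family D S" and f: "f \<in> S"
    and w: "w \<in> D" "cstar w = w" "\<And>g. g \<in> S - {f} \<Longrightarrow> w * g = 0"
  shows "cpos w \<or> cpos (- w)"
proof (rule ccontr)
  assume neg: "\<not> ?thesis"
  have fin: "finite S" and SD: "S \<subseteq> D" and S1: "\<And>g. g \<in> S \<Longrightarrow> cstar g = g \<and> g \<noteq> 0"
    and S2: "\<And>g h. g \<in> S \<Longrightarrow> h \<in> S \<Longrightarrow> g \<noteq> h \<Longrightarrow> g * h = 0"
    using S by (auto simp: max_orth_family_def orth_family_def)
  obtain q where q: "q \<in> cstar_generated {w}" "cpos q" "q * q = w * w" "(q + w) * (q - w) = 0"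
    using sa_abs[OF w(2)] by blast
  have qD: "q \<in> D" using q(1) generated_minimal[OF D, of "{w}"] w by auto
  have sa: "cstar (q + w) = q + w" "cstar (q - w) = q - w" using cpos_sa[OF q(2)] w by simp_all
  have qg: "q * g = 0" if g: "g \<in> S - {f}" for g
  proof -
    have "cstar (q * g) * (q * g) = cstar g * (q * q) * g" by (simp add: cpos_sa[OF q(2)] mult.assoc)
    also have "\<dots> = cstar g * w * (w * g)" by (simp add: q(3) mult.assoc)
    also have "\<dots> = 0" by (simp add: w(3)[OF g])
    finally show ?thesis by (simp only: cstar_mult_eq_0_iff)
  qed
  have nz: "q + w \<noteq> 0" "q - w \<noteq> 0"
  proof -
    show "q + w \<noteq> 0" using neg q(2) eq_neg_iff_add_eq_0[of q w] by auto
    show "q - w \<noteq> 0" using neg q(2) by auto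
  qed
  have r0: "(q + w) * g = 0" "(q - w) * g = 0" if "g \<in> S - {f}" for g
    using qg[OF that] w(3)[OF that] by (simp_all add: distrib_right left_diff_distrib)
  have l0: "g * (q + w) = 0" "g * (q - w) = 0" if g: "g \<in> S - {f}" for g
    using arg_cong[OF r0(1)[OF g], of cstar] arg_cong[OF r0(2)[OF g], of cstar] sa S1 g by auto
  have mp: "(q - w) * (q + w) = 0" using arg_cong[OF q(4), of cstar] by (simp only: cstar_mult sa cstar_zero)
  have ne: "q + w \<noteq> q - w"
  proof
    assume "q + w = q - w"
    then have "(q + w) * (q + w) = 0" using q(4) by (simp only:)
    then show False using sa_square_eq_0[OF sa(1)] nz(1) by blast
  qed
  have ni: "q + w \<notin> S - {f}" "q - w \<notin> S - {f}"
    using r0[of "q + w"] r0[of "q - w"] sa nz sa_square_eq_0 by blast+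
  let ?S = "insert (q + w) (insert (q - w) (S - {f}))"
  have "orth_family D ?S"
    unfolding orth_family_def
  proof (intro conjI ballI impI)
    show "finite ?S" using fin by simp
    show "?S \<subseteq> D" using SD qD w(1) by (auto simp: cstar_subalgebra_intros[OF D])
    show "cstar g = g" "g \<noteq> 0" if "g \<in> ?S" for g using that sa nz S1 by auto
    show "g * h = 0" if "g \<in> ?S" "h \<in> ?S" "g \<noteq> h" for g h
      using that by (elim insertE) (simp_all add: r0 l0 mp q(4) S2)
  qed
  moreover have "card ?S = card S + 1"
    using fin card_Suc_Diff1[OF fin f] ni ne by simp
  ultimately show False using S unfolding max_orth_family_def by fastforce
qed

definition minimal_partition :: "'a::unital_cstar_algebra set \<Rightarrow> 'a set \<Rightarrow> bool" where
  "minimal_partition D P \<longleftrightarrow> finite P \<and> P \<subseteq> D \<and> (\<forall>p\<in>P. p \<noteq> 0 \<and> cstar p = p \<and> p * p = p) \<and>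
    (\<forall>p\<in>P. \<forall>q\<in>P. p \<noteq> q \<longrightarrow> p * q = 0) \<and> \<Sum>P = 1 \<and>
    (\<forall>p\<in>P. \<forall>x\<in>D. \<exists>c. p * x * p = scaleC c p)"

text \<open>In a maximal family the dichotomy, applied to \<open>h * h - t * h\<close> with
  \<open>h = f * f\<close>, makes \<open>h\<close> a multiple of a projection. Applied to
  \<open>p * x * p - t * p\<close> it makes every compression a scalar, and a nonzero remainder
  \<open>1 - \<Sum>P\<close> would enlarge the family.\<close>

lemma minimal_partition_of_max:
  assumes D: "cstar_subalgebra D" and S: "max_orth_family D S"
  shows "\<exists>P. minimal_partition D P"
proof -
  note DI = cstar_subalgebra_intros[OF D]
  have fin: "finite S" and SD: "S \<subseteq> D" and S1: "\<And>g. g \<in> S \<Longrightarrow> cstar g = g \<and> g \<noteq> 0"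
    and S2: "\<And>g h. g \<in> S \<Longrightarrow> h \<in> S \<Longrightarrow> g \<noteq> h \<Longrightarrow> g * h = 0"
    using S by (auto simp: max_orth_family_def orth_family_def)
  have "\<exists>s. s \<noteq> 0 \<and> (s *\<^sub>R (f * f)) * (s *\<^sub>R (f * f)) = s *\<^sub>R (f * f)" if f: "f \<in> S" for f
  proof -
    define h where "h = f * f"
    have sah: "cstar h = h" using S1[OF f] by (simp add: h_def)
    have h0: "h \<noteq> 0" using S1[OF f] sa_square_eq_0 by (auto simp: h_def)
    have ch: "cpos h" unfolding h_def using S1[OF f] by (intro cpos_square) simp
    have hD: "h \<in> D" using SD f by (auto simp: h_def DI)
    have "\<exists>t. h * h = t *\<^sub>R h"
    proof (rule eq_scaleR_of_dichotomy)
      show "cpos (h * h - t *\<^sub>R h) \<or> cpos (t *\<^sub>R h - h * h)" for t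
      proof -
        have "(h * h - t *\<^sub>R h) * g = 0" if "g \<in> S - {f}" for g
        proof -
          have "f * g = 0" using S2 f that by auto
          then show ?thesis by (simp add: h_def left_diff_distrib mult.assoc)
        qed
        then have "cpos (h * h - t *\<^sub>R h) \<or> cpos (- (h * h - t *\<^sub>R h))"
          using hD sah by (intro max_orth_family_dichotomy[OF D S f]) (auto simp: DI)
        then show ?thesis by simp
      qed
      show "cpos (h * h - 0 *\<^sub>R h)" using cpos_square[OF sah] by simp
      have "cpos ((of_real (norm h) - h) * h)"
        using cpos_norm_minus[OF sah order_refl] ch by (rule cpos_mult) (simp add: algebra_simps of_real_def)
      then show "cpos (norm h *\<^sub>R h - h * h)" by (simp add: left_diff_distrib of_real_def)
    qed simp
    then obtain t where t: "h * h = t *\<^sub>R h" by blast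
    moreover have "t \<noteq> 0" using t h0 sah sa_square_eq_0 by force
    ultimately show ?thesis unfolding h_def[symmetric] by (intro exI[of _ "1/t"]) simp
  qed
  then obtain s where s: "\<And>f. f \<in> S \<Longrightarrow> s f \<noteq> (0::real)"
    "\<And>f. f \<in> S \<Longrightarrow> (s f *\<^sub>R (f * f)) * (s f *\<^sub>R (f * f)) = s f *\<^sub>R (f * f)"
    by metis
  define e where "e f = s f *\<^sub>R (f * f)" for f
  have e: "e f \<in> D" "cstar (e f) = e f" "e f * e f = e f" "e f \<noteq> 0" if "f \<in> S" for f
    using s[OF that] S1[OF that] SD that sa_square_eq_0 by (auto simp: e_def DI)
  have eo: "e f * e g = 0" if "f \<in> S" "g \<in> S" "f \<noteq> g" for f g
  proof -
    have "e f * e g = (s f * s g) *\<^sub>R (f * (f * g) * g)" by (simp add: e_def mult.assoc mult.commute)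
    then show ?thesis using S2[OF that] by simp
  qed
  define P where "P = e ` S"
  have inj: "inj_on e S" using e eo by (intro inj_onI) metis
  have P: "orth_family D P" using e eo fin by (auto simp: P_def orth_family_def) metis
  then have Pm: "max_orth_family D P"
    using S card_image[OF inj] by (simp add: max_orth_family_def P_def)
  have Pp: "p * p = p" "cstar p = p" "p \<noteq> 0" if "p \<in> P" for p using that e by (auto simp: P_def)
  have Po: "p * q = 0" if "p \<in> P" "q \<in> P" "p \<noteq> q" for p q
    using P that by (auto simp: orth_family_def)
  have PD: "P \<subseteq> D" "finite P" using P by (auto simp: orth_family_def)
  have sa: "\<exists>t. p * x * p = t *\<^sub>R p" if p: "p \<in> P" and x: "x \<in> D" "cstar x = x" for p x
  proof (rule eq_scaleR_of_dichotomy)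
    show "cpos (p * x * p - t *\<^sub>R p) \<or> cpos (t *\<^sub>R p - p * x * p)" for t
    proof -
      have "(p * x * p - t *\<^sub>R p) * g = 0" if "g \<in> P - {p}" for g
      proof -
        have "p * g = 0" using Po p that by auto
        then show ?thesis by (simp add: left_diff_distrib mult.assoc)
      qed
      then have "cpos (p * x * p - t *\<^sub>R p) \<or> cpos (- (p * x * p - t *\<^sub>R p))"
        using p PD x Pp[OF p] by (intro max_orth_family_dichotomy[OF D Pm p]) (auto simp: DI mult.assoc)
      then show ?thesis by simp
    qed
    show "cpos (p * x * p - (- norm x) *\<^sub>R p)"
      using cpos_conj[OF cpos_norm_plus[OF x(2) order_refl], of p] Pp[OF p]
      by (simp add: algebra_simps of_real_def)
    show "cpos (norm x *\<^sub>R p - p * x * p)"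
      using cpos_conj[OF cpos_norm_minus[OF x(2) order_refl], of p] Pp[OF p]
      by (simp add: algebra_simps of_real_def)
  qed simp
  have min: "\<exists>c. p * x * p = scaleC c p" if p: "p \<in> P" and x: "x \<in> D" for p x
  proof -
    obtain h k where hk: "cstar h = h" "cstar k = k" "x = h + scaleC \<i> k"
      "h = (1/2) *\<^sub>R (x + cstar x)" "k = scaleC (- \<i>/2) (x - cstar x)"
      using cartesian_decomposition by blast
    have "h \<in> D" "k \<in> D" unfolding hk(4,5) using x by (simp_all only: DI)
    then obtain a b where ab: "p * h * p = a *\<^sub>R p" "p * k * p = b *\<^sub>R p" using sa[OF p] hk(1,2) by blast
    have "p * x * p = scaleC (of_real a) p + scaleC \<i> (scaleC (of_real b) p)"
      unfolding hk(3) scaleC_of_real ab[symmetric] by (simp add: distrib_left distrib_right)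
    then show ?thesis by (metis scaleC_add_left scaleC_scaleC)
  qed
  have "\<Sum>P = 1"
  proof (rule ccontr)
    assume "\<Sum>P \<noteq> 1"
    define r where "r = 1 - \<Sum>P"
    have r0: "r \<noteq> 0" using \<open>\<Sum>P \<noteq> 1\<close> by (simp add: r_def)
    have rs: "cstar r = r" using Pp by (simp add: r_def)
    have rp: "r * p = 0" if p: "p \<in> P" for p
    proof -
      have "\<Sum>P * p = (\<Sum>q\<in>P. if q = p then p else 0)"
        unfolding sum_distrib_right using Po Pp p by (intro sum.cong) auto
      then show ?thesis using p PD by (simp add: r_def left_diff_distrib)
    qed
    have pr: "p * r = 0" if p: "p \<in> P" for p
      using arg_cong[OF rp[OF p], of cstar] rs Pp[OF p] by simp
    have "r \<notin> P" using rp r0 Pp by metis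
    moreover have "r \<in> D" using PD by (auto simp: r_def intro!: DI)
    then have "orth_family D (insert r P)" using P rs r0 rp pr by (auto simp: orth_family_def)
    ultimately show False using Pm PD unfolding max_orth_family_def by fastforce
  qed
  then show ?thesis unfolding minimal_partition_def
    by (intro exI[of _ P] conjI ballI impI) (simp_all add: PD Pp Po min)
qed

locale qexp_simple = qexp B E L + cexp_simple B E for B :: "'a::unital_cstar_algebra set" and E L
begin

lemma \<tau>_faithful: "y \<in> C \<Longrightarrow> \<tau> (y * cstar y) = 0 \<Longrightarrow> y = 0"
  by (rule faithful) (simp add: E_C C_intros)

lemma \<tau>_pos: "y \<in> C \<Longrightarrow> y \<noteq> 0 \<Longrightarrow> \<exists>r>0. \<tau> (y * cstar y) = complex_of_real r"
  using \<tau>_cpos[of "y * cstar y"] \<tau>_faithful[of y]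
  by (metis C_intros(4,6) cpos_mult_cstar less_eq_real_def of_real_0)

text \<open>Divided by the square roots of \<open>\<tau> (f * f)\<close>, the members become
  orthonormal for \<open>E\<close>, whether or not \<tau> is a trace. \<open>E\<close> is applied to
  the Bessel estimate because it is \<open>E (c f * c f)\<close>, rather than
  \<open>c f * c f\<close> itself, that is 1.\<close>

lemma orth_family_card:
  assumes S: "orth_family C S"
  shows "real (card S) \<le> norm (E (\<Sum>l\<in>L. l * cstar l))"
proof -
  have fin: "finite S" and SC: "S \<subseteq> C" and S1: "\<And>g. g \<in> S \<Longrightarrow> cstar g = g \<and> g \<noteq> 0"
    and S2: "\<And>g h. g \<in> S \<Longrightarrow> h \<in> S \<Longrightarrow> g \<noteq> h \<Longrightarrow> g * h = 0"
    using S by (auto simp: orth_family_def)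
  have "\<exists>t>0. \<tau> (f * f) = complex_of_real t" if f: "f \<in> S" for f
    using \<tau>_pos[of f] S1[OF f] SC f by auto
  then obtain t where t: "\<And>f. f \<in> S \<Longrightarrow> t f > 0" "\<And>f. f \<in> S \<Longrightarrow> \<tau> (f * f) = complex_of_real (t f)"
    by metis
  have tE: "E (f * f) = of_real (t f)" if "f \<in> S" for f
    using that SC t(2)[OF that] by (subst E_C) (auto simp: C_intros of_real_scaleC)
  define c where "c f = (1 / sqrt (t f)) *\<^sub>R f" for f
  have cc: "E (c f * c f) = 1" if "f \<in> S" for f
  proof -
    have "E (c f * c f) = (1 / t f) *\<^sub>R E (f * f)"
      using t(1)[OF that] by (simp add: c_def E_scaleR real_sqrt_mult_self)
    then show ?thesis using t(1)[OF that] tE[OF that] by (simp add: of_real_def)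
  qed
  have csa: "cstar (c f) = c f" if "f \<in> S" for f using S1[OF that] by (simp add: c_def)
  have "E (c f * cstar (c g)) = (if f = g then 1 else 0)" if "f \<in> S" "g \<in> S" for f g
  proof (cases "f = g")
    case True then show ?thesis using cc csa that by simp
  next
    case False
    then have "c f * c g = 0" using S2[OF that] by (simp add: c_def)
    then show ?thesis using False csa that by simp
  qed
  with fin have "cpos ((\<Sum>l\<in>L. l * cstar l) - (\<Sum>f\<in>S. cstar (c f) * c f))" by (intro bessel) auto
  from E_cpos[OF this] have "cpos (E (\<Sum>l\<in>L. l * cstar l) - (\<Sum>f\<in>S. E (cstar (c f) * c f)))"
    by (simp add: E_diff E_sum)
  also have "(\<Sum>f\<in>S. E (cstar (c f) * c f)) = of_real (real (card S))"
    using csa cc by simp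
  finally have 1: "cpos (E (\<Sum>l\<in>L. l * cstar l) - of_real (real (card S)))" .
  from 1 show ?thesis by (rule le_norm_of_cpos_diff) (simp only: E_cstar[symmetric] cstar_sum cstar_mult cstar_cstar)
qed

lemma minimal_partition_exists:
  assumes D: "cstar_subalgebra D" and DC: "D \<subseteq> C"
  shows "\<exists>P. minimal_partition D P"
proof -
  obtain b where b: "norm (E (\<Sum>l\<in>L. l * cstar l)) < real b" using reals_Archimedean2 by blast
  have "orth_family D {}" by (simp add: orth_family_def)
  moreover have "\<forall>S. orth_family D S \<longrightarrow> card S < b"
  proof (intro allI impI)
    fix S assume "orth_family D S"
    then have "orth_family C S" using DC by (auto simp: orth_family_def)
    then show "card S < b" using orth_family_card[of S] b by linarith
  qed
  ultimately have "\<exists>S. max_orth_family D S"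
    unfolding max_orth_family_def by (rule ex_has_greatest_nat)
  then show ?thesis using minimal_partition_of_max[OF D] by blast
qed

end

section \<open>Matrix units\<close>

lemma projection_norm:
  fixes q :: "'a::unital_cstar_algebra"
  assumes "cstar q = q" "q * q = q" "q \<noteq> 0"
  shows "norm q = 1"
  using cstar_identity[of q] assms by (simp add: power2_eq_square)

lemma cpos_projection_multiple:
  fixes q :: "'a::unital_cstar_algebra"
  assumes q: "cstar q = q" "q * q = q" "q \<noteq> 0" and pos: "cpos (scaleC c q)"
  shows "\<exists>r\<ge>0. c = complex_of_real r"
proof -
  have "scaleC (cnj c) q = scaleC c q" using cpos_sa[OF pos] q by simp
  then have "cnj c = c" using q(3) by simp
  then obtain r where r: "c = complex_of_real r" by (metis Reals_cases Reals_cnj_iff)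
  have "0 \<le> r"
  proof (rule ccontr)
    assume "\<not> 0 \<le> r"
    then have "cpos ((- r) *\<^sub>R (q * q))" using q by (intro cpos_scaleR cpos_square) auto
    then have "r *\<^sub>R q = 0" using pos q by (intro cpos_antisym) (simp_all add: r scaleC_of_real)
    then show False using q \<open>\<not> 0 \<le> r\<close> by simp
  qed
  with r show ?thesis by blast
qed

lemma cstar_mult_projection:
  fixes q y :: "'a::unital_cstar_algebra"
  assumes q: "cstar q = q" "q * q = q" "q \<noteq> 0" and y: "cstar y * y = scaleC c q"
  shows "cstar y * y = (norm y)\<^sup>2 *\<^sub>R q"
proof -
  obtain r where r: "0 \<le> r" "c = complex_of_real r"
    using cpos_projection_multiple[OF q] y cpos_cstar_mult by metis
  have "(norm y)\<^sup>2 = r"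
    using cstar_identity[of y] r(1) projection_norm[OF q] by (simp add: y r(2) scaleC_of_real)
  then show ?thesis by (simp add: y r scaleC_of_real)
qed

text \<open>\<open>C\<close> as a direct sum of matrix algebras: \<open>cl\<close> names the block
  of a minimal projection and \<open>e p q\<close> is the partial isometry from \<open>q\<close> to
  \<open>p\<close>, meaningful only inside a block.\<close>

locale matrix_units =
  fixes C P :: "'a::unital_cstar_algebra set" and cl :: "'a \<Rightarrow> 'a" and e :: "'a \<Rightarrow> 'a \<Rightarrow> 'a"
  assumes C: "cstar_subalgebra C" and part: "minimal_partition C P"
    and e_in: "p \<in> P \<Longrightarrow> q \<in> P \<Longrightarrow> cl p = cl q \<Longrightarrow> e p q \<in> C"
    and e_mult: "p \<in> P \<Longrightarrow> q \<in> P \<Longrightarrow> s \<in> P \<Longrightarrow> cl p = cl q \<Longrightarrow> cl q = cl s \<Longrightarrow> e p q * e q s = e p s"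
    and e_cstar: "cstar (e p q) = e q p"
    and e_diag: "p \<in> P \<Longrightarrow> e p p = p"
    and block0: "p \<in> P \<Longrightarrow> q \<in> P \<Longrightarrow> cl p \<noteq> cl q \<Longrightarrow> x \<in> C \<Longrightarrow> p * x * q = 0"
    and block1: "p \<in> P \<Longrightarrow> q \<in> P \<Longrightarrow> cl p = cl q \<Longrightarrow> x \<in> C \<Longrightarrow> \<exists>c. p * x * q = scaleC c (e p q)"

text \<open>Blocks are the classes of Murray-von Neumann equivalence. If
  \<open>y = p * x * q\<close> is nonzero, minimality makes \<open>cstar y * y\<close> and
  \<open>y * cstar y\<close> multiples of \<open>q\<close> and \<open>p\<close> with the common
  factor \<open>(norm y)\<^sup>2\<close>, so \<open>y / norm y\<close> is a partial isometry linking
  them.\<close>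

lemma matrix_units_exist:
  assumes C: "cstar_subalgebra C" and part: "minimal_partition C P"
  shows "\<exists>cl e. matrix_units C P cl e"
proof -
  note DI = cstar_subalgebra_intros[OF C]
  have fin: "finite P" and PC: "\<And>p. p \<in> P \<Longrightarrow> p \<in> C"
    and P1: "\<And>p. p \<in> P \<Longrightarrow> p \<noteq> 0" "\<And>p. p \<in> P \<Longrightarrow> cstar p = p" "\<And>p. p \<in> P \<Longrightarrow> p * p = p"
    and min: "\<And>p x. p \<in> P \<Longrightarrow> x \<in> C \<Longrightarrow> \<exists>c. p * x * p = scaleC c p"
    using part by (auto simp: minimal_partition_def)
  define conn where "conn p q \<longleftrightarrow> (\<exists>v\<in>C. v * cstar v = p \<and> cstar v * v = q \<and> p * v = v \<and> v * q = v)" for p q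
  have iso: "conn p q" if p: "p \<in> P" and q: "q \<in> P" and x: "x \<in> C" and nz: "p * x * q \<noteq> 0" for p q x
  proof -
    define y where "y = p * x * q"
    have yC: "y \<in> C" using PC p q x by (auto simp: y_def DI)
    have py: "p * y = y" "y * q = y" using P1 p q by (simp_all add: y_def mult.assoc[symmetric]) (simp add: mult.assoc P1)
    have "cstar y * y = q * (cstar x * p * p * x) * q" using P1(2) p q by (simp add: y_def mult.assoc)
    moreover have "cstar x * p * p * x \<in> C" using PC p x by (auto simp: DI)
    ultimately obtain c where "cstar y * y = scaleC c q" using min[OF q] by metis
    then have 1: "cstar y * y = (norm y)\<^sup>2 *\<^sub>R q" using P1 q by (intro cstar_mult_projection)
    have "cstar (cstar y) * cstar y = p * (x * q * q * cstar x) * p" using P1(2) p q by (simp add: y_def mult.assoc)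
    moreover have "x * q * q * cstar x \<in> C" using PC q x by (auto simp: DI)
    ultimately obtain d where "cstar (cstar y) * cstar y = scaleC d p" using min[OF p] by metis
    then have "cstar (cstar y) * cstar y = (norm (cstar y))\<^sup>2 *\<^sub>R p" using P1 p by (intro cstar_mult_projection)
    then have 2: "y * cstar y = (norm y)\<^sup>2 *\<^sub>R p" by simp
    have y0: "norm y \<noteq> 0" using nz by (simp add: y_def)
    let ?v = "(1 / norm y) *\<^sub>R y"
    show ?thesis unfolding conn_def
      using 1 2 y0 py yC by (intro bexI[of _ ?v] conjI) (auto simp: DI power2_eq_square)
  qed
  have conn_ne: "\<exists>x\<in>C. p * x * q \<noteq> 0" if "conn p q" "p \<noteq> 0" for p q
    using that unfolding conn_def by (metis mult_zero_left)
  have refl: "conn p p" if "p \<in> P" for p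
    unfolding conn_def using that P1 PC by (intro bexI[of _ p]) auto
  have sym: "conn q p" if conn: "conn p q" for p q
  proof -
    obtain v where v: "v \<in> C" "v * cstar v = p" "cstar v * v = q" "p * v = v" "v * q = v"
      using conn by (auto simp: conn_def)
    have "cstar q = q" "cstar p = p" unfolding v(2,3)[symmetric] by simp_all
    then have "q * cstar v = cstar v" "cstar v * p = cstar v"
      using arg_cong[OF v(5), of cstar] arg_cong[OF v(4), of cstar] by simp_all
    then show ?thesis unfolding conn_def using v by (intro bexI[of _ "cstar v"]) (auto simp: DI)
  qed
  have trans: "conn p s" if conn: "conn p q" "conn q s" for p q s
  proof -
    obtain v w where v: "v \<in> C" "v * cstar v = p" "cstar v * v = q" "p * v = v" "v * q = v"
      and w: "w \<in> C" "w * cstar w = q" "cstar w * w = s" "q * w = w" "w * s = w"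
      using conn by (auto simp: conn_def)
    have "v * w * cstar (v * w) = v * (w * cstar w) * cstar v"
      "cstar (v * w) * (v * w) = cstar w * (cstar v * v) * w" by (simp_all add: mult.assoc)
    then have "v * w * cstar (v * w) = p" "cstar (v * w) * (v * w) = s" "p * (v * w) = v * w" "v * w * s = v * w"
      using v w by (simp_all add: mult.assoc) (simp_all add: mult.assoc[symmetric])
    then show ?thesis unfolding conn_def using v w by (intro bexI[of _ "v * w"]) (auto simp: DI)
  qed
  \<comment> \<open>The choice depends only on the predicate \<open>conn p\<close>, so equivalent
    projections get the same representative.\<close>
  define cl where "cl p = (SOME r. r \<in> P \<and> conn p r)" for p
  have cl: "cl p \<in> P" "conn p (cl p)" if "p \<in> P" for p
    using someI[of "\<lambda>r. r \<in> P \<and> conn p r" p] refl that unfolding cl_def by blast+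
  have cl_iff: "cl p = cl q \<longleftrightarrow> conn p q" if "p \<in> P" "q \<in> P" for p q
  proof
    assume "cl p = cl q" then show "conn p q" using cl that sym trans by metis
  next
    assume "conn p q"
    then have "conn p r \<longleftrightarrow> conn q r" for r using sym trans by blast
    then show "cl p = cl q" by (simp add: cl_def)
  qed
  have "\<exists>w. \<forall>p\<in>P. w p \<in> C \<and> w p * cstar (w p) = p \<and> cstar (w p) * w p = cl p \<and> p * w p = w p \<and> w p * cl p = w p"
    using cl(2) unfolding conn_def by (intro bchoice) blast
  then obtain w where w: "\<And>p. p \<in> P \<Longrightarrow> w p \<in> C" "\<And>p. p \<in> P \<Longrightarrow> w p * cstar (w p) = p"
    "\<And>p. p \<in> P \<Longrightarrow> cstar (w p) * w p = cl p" "\<And>p. p \<in> P \<Longrightarrow> p * w p = w p" "\<And>p. p \<in> P \<Longrightarrow> w p * cl p = w p"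
    by blast
  \<comment> \<open>Passing through the representative of the block makes the products consistent;
    independently chosen partial isometries would compose only up to phases.\<close>
  define e where "e p q = w p * cstar (w q)" for p q
  have e_in: "e p q \<in> C" if "p \<in> P" "q \<in> P" for p q using that w by (auto simp: e_def DI)
  have em: "e p q * e q s = e p s" if "p \<in> P" "q \<in> P" "s \<in> P" "cl p = cl q" for p q s
  proof -
    have "e p q * e q s = w p * (cstar (w q) * w q) * cstar (w s)" by (simp add: e_def mult.assoc)
    also have "\<dots> = w p * cl p * cstar (w s)" using that w(3)[of q] by simp
    finally show ?thesis using w(5)[of p] that by (simp add: e_def)
  qed
  have pe: "p * e p q = e p q" if "p \<in> P" for p q using w(4)[OF that] by (simp add: e_def mult.assoc[symmetric])
  have ep: "e p q * q = e p q" if "q \<in> P" for p q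
    using arg_cong[OF w(4)[OF that], of cstar] P1(2)[OF that] by (simp add: e_def mult.assoc)
  have "matrix_units C P cl e"
  proof
    show "cstar_subalgebra C" "minimal_partition C P" by fact+
    show "e p q \<in> C" if "p \<in> P" "q \<in> P" for p q using e_in that .
    show "e p q * e q s = e p s" if "p \<in> P" "q \<in> P" "s \<in> P" "cl p = cl q" for p q s using em that .
    show "cstar (e p q) = e q p" for p q by (simp add: e_def)
    show "e p p = p" if "p \<in> P" for p using w(2)[OF that] by (simp add: e_def)
    show "p * x * q = 0" if "p \<in> P" "q \<in> P" "cl p \<noteq> cl q" "x \<in> C" for p q x
      using iso[of p q x] cl_iff that by blast
    show "\<exists>c. p * x * q = scaleC c (e p q)" if "p \<in> P" "q \<in> P" "cl p = cl q" "x \<in> C" for p q x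
    proof -
      have "x * e q p \<in> C" using that e_in by (auto simp: DI)
      from min[OF \<open>p \<in> P\<close> this] obtain c where c: "p * (x * e q p) * p = scaleC c p" by blast
      have "p * x * q = p * x * (e q p * e p q)" using em[of q p q] that w(2)[of q] by (simp add: e_def)
      also have "\<dots> = p * (x * e q p) * p * e p q" using pe ep that by (simp add: mult.assoc)
      finally show ?thesis using c pe[OF \<open>p \<in> P\<close>] by auto
    qed
  qed
  then show ?thesis by blast
qed

section \<open>The trace of a finite sum of matrix algebras\<close>

context matrix_units
begin

lemmas C_in = cstar_subalgebra_intros[OF C]

lemma fin [simp]: "finite P" and P_in: "p \<in> P \<Longrightarrow> p \<in> C"
  and P_ne: "p \<in> P \<Longrightarrow> p \<noteq> 0" and P_sa: "p \<in> P \<Longrightarrow> cstar p = p" and P_idem: "p \<in> P \<Longrightarrow> p * p = p"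
  and P_orth: "p \<in> P \<Longrightarrow> q \<in> P \<Longrightarrow> p \<noteq> q \<Longrightarrow> p * q = 0" and P_sum: "\<Sum>P = 1"
  and P_min: "p \<in> P \<Longrightarrow> x \<in> C \<Longrightarrow> \<exists>c. p * x * p = scaleC c p"
  using part by (auto simp: minimal_partition_def)

lemma e_left: "p \<in> P \<Longrightarrow> q \<in> P \<Longrightarrow> cl p = cl q \<Longrightarrow> p * e p q = e p q"
  using e_mult[of p p q] e_diag by simp

lemma e_right: "p \<in> P \<Longrightarrow> q \<in> P \<Longrightarrow> cl p = cl q \<Longrightarrow> e p q * q = e p q"
  using e_mult[of p q q] e_diag by simp

lemma e_mult_if:
  assumes "p \<in> P" "q \<in> P" "s \<in> P" "t \<in> P" "cl p = cl q" "cl s = cl t"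
  shows "e p q * e s t = (if q = s then e p t else 0)"
proof (cases "q = s")
  case False
  have "e p q * e s t = (e p q * q) * (s * e s t)" using assms by (simp add: e_left e_right)
  also have "\<dots> = e p q * (q * s) * e s t" by (simp only: mult.assoc)
  finally show ?thesis using False P_orth assms by simp
qed (use assms e_mult in simp)

lemma decompose: "x = (\<Sum>p\<in>P. \<Sum>q\<in>P. p * x * q)"
proof -
  have "x = \<Sum>P * x * \<Sum>P" by (simp add: P_sum)
  then show ?thesis by (simp only: sum_distrib_left sum_distrib_right) (rule trans, assumption, rule sum.swap)
qed

definition coef :: "'a \<Rightarrow> 'a \<Rightarrow> complex" where "coef p x = (THE c. p * x * p = scaleC c p)"

lemma coef_eqI: "p \<in> P \<Longrightarrow> p * x * p = scaleC c p \<Longrightarrow> coef p x = c"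
  unfolding coef_def using P_ne by (intro the_equality) auto

lemma coef: "p \<in> P \<Longrightarrow> x \<in> C \<Longrightarrow> p * x * p = scaleC (coef p x) p"
  using P_min coef_eqI by metis

lemma coef_add: "p \<in> P \<Longrightarrow> x \<in> C \<Longrightarrow> y \<in> C \<Longrightarrow> coef p (x + y) = coef p x + coef p y"
  by (rule coef_eqI) (simp_all add: distrib_left distrib_right coef scaleC_add_left)

lemma coef_scaleC: "p \<in> P \<Longrightarrow> x \<in> C \<Longrightarrow> coef p (scaleC c x) = c * coef p x"
  by (rule coef_eqI) (simp_all add: coef scaleC_scaleC)

lemma coef_zero: "p \<in> P \<Longrightarrow> coef p 0 = 0"
  by (rule coef_eqI) simp_all

lemma coef_sum: "p \<in> P \<Longrightarrow> (\<And>i. i \<in> A \<Longrightarrow> f i \<in> C) \<Longrightarrow> coef p (sum f A) = (\<Sum>i\<in>A. coef p (f i))"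
  by (induction A rule: infinite_finite_induct) (simp_all add: coef_add coef_zero C_in)

definition T :: "'a \<Rightarrow> complex" where "T x = (\<Sum>p\<in>P. coef p x)"

lemma T_add: "x \<in> C \<Longrightarrow> y \<in> C \<Longrightarrow> T (x + y) = T x + T y"
  by (simp add: T_def coef_add sum.distrib)

lemma T_scaleC: "x \<in> C \<Longrightarrow> T (scaleC c x) = c * T x"
  by (simp add: T_def coef_scaleC sum_distrib_left)

lemma T_scaleR: "x \<in> C \<Longrightarrow> T (r *\<^sub>R x) = of_real r * T x"
  using T_scaleC[of x "of_real r"] by (simp add: scaleC_of_real)

lemma T_zero [simp]: "T 0 = 0"
  by (simp add: T_def coef_zero)

lemma T_sum: "(\<And>i. i \<in> A \<Longrightarrow> f i \<in> C) \<Longrightarrow> T (sum f A) = (\<Sum>i\<in>A. T (f i))"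
  by (induction A rule: infinite_finite_induct) (simp_all add: T_add C_in)

text \<open>Each side is the product of the entries of \<open>x\<close> at \<open>(p, q)\<close> and
  of \<open>y\<close> at \<open>(q, p)\<close>; summed over \<open>p\<close> and \<open>q\<close>
  this is the trace property.\<close>

lemma coef_swap:
  assumes "p \<in> P" "q \<in> P" "x \<in> C" "y \<in> C"
  shows "coef p (x * q * y) = coef q (y * p * x)"
proof -
  have 1: "p * (x * q * y) * p = (p * x * q) * (q * y * p)" "q * (y * p * x) * q = (q * y * p) * (p * x * q)"
    using P_idem assms by (simp_all add: mult.assoc) (simp_all add: mult.assoc[symmetric])
  show ?thesis
  proof (cases "cl p = cl q")
    case True
    then obtain a b where ab: "p * x * q = scaleC a (e p q)" "q * y * p = scaleC b (e q p)"
      using block1[of p q x] block1[of q p y] assms by auto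
    have "p * (x * q * y) * p = scaleC (a * b) p" "q * (y * p * x) * q = scaleC (a * b) q"
      unfolding 1 ab using assms True by (simp_all add: e_mult e_diag scaleC_scaleC mult.commute)
    then show ?thesis using assms by (metis coef_eqI)
  next
    case False
    then have "p * (x * q * y) * p = scaleC 0 p" "q * (y * p * x) * q = scaleC 0 q"
      unfolding 1 using block0 assms by simp_all
    then show ?thesis using assms by (metis coef_eqI)
  qed
qed

lemma T_commute:
  assumes "x \<in> C" "y \<in> C"
  shows "T (x * y) = T (y * x)"
proof -
  have *: "T (x * y) = (\<Sum>p\<in>P. \<Sum>q\<in>P. coef p (x * q * y))" if "x \<in> C" "y \<in> C" for x y
  proof -
    have "x * y = x * \<Sum>P * y" by (simp add: P_sum)
    also have "\<dots> = (\<Sum>q\<in>P. x * q * y)" by (simp add: sum_distrib_left sum_distrib_right)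
    finally show ?thesis using that P_in by (simp add: T_def coef_sum C_in)
  qed
  show ?thesis unfolding *[OF assms] *[OF assms(2,1)]
    using assms by (subst sum.swap) (simp add: coef_swap)
qed

lemma T_e: "p \<in> P \<Longrightarrow> q \<in> P \<Longrightarrow> cl p = cl q \<Longrightarrow> T (e p q) = (if p = q then 1 else 0)"
proof -
  assume pq: "p \<in> P" "q \<in> P" "cl p = cl q"
  have "coef s (e p q) = (if p = q \<and> s = p then 1 else 0)" if "s \<in> P" for s
  proof (rule coef_eqI[OF that])
    have "s * e p q * s = (s * p) * e p q * (q * s)" using pq by (simp add: e_left e_right mult.assoc) (simp add: e_left e_right mult.assoc[symmetric])
    then show "s * e p q * s = scaleC (if p = q \<and> s = p then 1 else 0) s"
      using pq that P_orth P_idem e_diag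
      by (cases "s = p"; cases "s = q") (auto simp: scaleC_of_real[of 1, simplified])
  qed
  then have "T (e p q) = (\<Sum>s\<in>P. if s = p then (if p = q then 1 else 0) else 0)"
    unfolding T_def by (intro sum.cong) auto
  then show ?thesis using pq by simp
qed

lemma T_P: "p \<in> P \<Longrightarrow> T p = 1"
  using T_e[of p p] e_diag by simp

lemma T_one: "T 1 = of_nat (card P)"
proof -
  have "T 1 = T (\<Sum>P)" by (simp only: P_sum)
  also have "\<dots> = (\<Sum>p\<in>P. T p)" using P_in by (intro T_sum) auto
  finally show ?thesis by (simp add: T_P)
qed

lemma T_nonneg: "x \<in> C \<Longrightarrow> \<exists>r\<ge>0. T (x * cstar x) = complex_of_real r"
proof -
  assume x: "x \<in> C"
  have "\<exists>r\<ge>0. coef p (x * cstar x) = complex_of_real r" if p: "p \<in> P" for p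
  proof (rule cpos_projection_multiple)
    have "p * (x * cstar x) * p = (p * x) * cstar (p * x)" by (simp add: P_sa[OF p] mult.assoc)
    then show "cpos (scaleC (coef p (x * cstar x)) p)"
      using coef[OF p, of "x * cstar x"] x cpos_mult_cstar[of "p * x"] by (simp add: C_in)
  qed (simp_all add: P_sa P_idem P_ne p)
  then obtain r where r: "\<And>p. p \<in> P \<Longrightarrow> r p \<ge> 0 \<and> coef p (x * cstar x) = complex_of_real (r p)" by metis
  then have "T (x * cstar x) = complex_of_real (\<Sum>p\<in>P. r p)" by (simp add: T_def)
  then show ?thesis using r by (intro exI[of _ "\<Sum>p\<in>P. r p"]) (simp add: sum_nonneg)
qed

definition R where "R = {(p, q). p \<in> P \<and> q \<in> P \<and> cl p = cl q}"

lemma finite_R [simp]: "finite R"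
  by (rule finite_subset[of _ "P \<times> P"]) (auto simp: R_def)

lemma R_swap: "(\<Sum>(p, q)\<in>R. f p q) = (\<Sum>(p, q)\<in>R. f q p)"
  by (rule sum.reindex_bij_witness[where i=prod.swap and j=prod.swap]) (auto simp: R_def)

lemma sum_R: "(\<Sum>(p, q)\<in>R. f p q) = (\<Sum>p\<in>P. \<Sum>q\<in>P. if cl p = cl q then f p q else 0)"
proof -
  have "(\<Sum>p\<in>P. \<Sum>q\<in>P. if cl p = cl q then f p q else 0) = (\<Sum>(p, q)\<in>P \<times> P. if cl p = cl q then f p q else 0)"
    by (rule sum.cartesian_product)
  also have "\<dots> = (\<Sum>(p, q)\<in>R. f p q)"
    by (rule sum.mono_neutral_cong_right) (auto simp: R_def split: if_splits)
  finally show ?thesis by simp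
qed

lemma T_entry:
  assumes "(p, q) \<in> R" "x \<in> C"
  shows "q * x * p = scaleC (T (x * e p q)) (e q p)"
proof -
  have pq: "p \<in> P" "q \<in> P" "cl p = cl q" using assms by (auto simp: R_def)
  then obtain c where c: "q * x * p = scaleC c (e q p)" using block1[of q p x] assms by auto
  have "T (x * e p q) = T (x * p * e p q * q)" using pq by (simp add: mult.assoc e_left e_right)
  also have "\<dots> = T (q * (x * p * e p q))"
    using pq assms P_in e_in by (intro T_commute) (auto simp: C_in)
  also have "\<dots> = T (scaleC c (e q p) * e p q)" by (simp add: c[symmetric] mult.assoc)
  also have "\<dots> = c" using pq P_in by (simp add: e_mult e_diag T_scaleC T_P)
  finally show ?thesis by (simp add: c)
qed

lemma expand: "x \<in> C \<Longrightarrow> x = (\<Sum>(p, q)\<in>R. scaleC (T (x * e p q)) (e q p))"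
proof -
  assume x: "x \<in> C"
  have "x = (\<Sum>p\<in>P. \<Sum>q\<in>P. q * x * p)" by (subst sum.swap) (rule decompose)
  also have "\<dots> = (\<Sum>p\<in>P. \<Sum>q\<in>P. if cl p = cl q then scaleC (T (x * e p q)) (e q p) else 0)"
    using T_entry block0 x by (intro sum.cong refl) (auto simp: R_def)
  finally show ?thesis by (simp add: sum_R)
qed

text \<open>\<open>u\<close> may lie outside \<open>C\<close>, where the trace property does not
  reach. The image \<open>f\<close> of a minimal projection is again minimal and not orthogonal to
  some \<open>q\<close>; comparing \<open>cstar y * y\<close> with \<open>y * cstar y\<close> for
  \<open>y = q * f\<close> gives it trace 1. Off-diagonal matrix units keep trace 0.\<close>

lemma T_unitary_conj:
  assumes u: "cstar u * u = 1" "u * cstar u = 1"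
    and inv: "\<And>x. x \<in> C \<Longrightarrow> u * x * cstar u \<in> C" "\<And>x. x \<in> C \<Longrightarrow> cstar u * x * u \<in> C" and x: "x \<in> C"
  shows "T (u * x * cstar u) = T x"
proof -
  define \<alpha> where "\<alpha> y = u * y * cstar u" for y
  have \<alpha>C: "\<alpha> y \<in> C" if "y \<in> C" for y using inv(1) that by (simp add: \<alpha>_def)
  have \<alpha>m: "\<alpha> (y * z) = \<alpha> y * \<alpha> z" for y z
  proof -
    have "\<alpha> y * \<alpha> z = u * y * (cstar u * u) * z * cstar u" by (simp add: \<alpha>_def mult.assoc)
    then show ?thesis by (simp add: u \<alpha>_def mult.assoc)
  qed
  have \<alpha>s: "cstar (\<alpha> y) = \<alpha> (cstar y)" for y by (simp add: \<alpha>_def mult.assoc)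
  have TP: "T (\<alpha> p) = 1" if p: "p \<in> P" for p
  proof -
    define f where "f = \<alpha> p"
    have f: "cstar f = f" "f * f = f" "f \<in> C"
      using p by (simp_all add: f_def \<alpha>s P_sa \<alpha>m[symmetric] P_idem \<alpha>C P_in)
    have "cstar u * f * u = (cstar u * u) * p * (cstar u * u)" by (simp add: f_def \<alpha>_def mult.assoc)
    then have f0: "f \<noteq> 0" using P_ne[OF p] by (auto simp: u)
    have "\<exists>q\<in>P. q * f \<noteq> 0"
    proof (rule ccontr)
      assume "\<not> ?thesis"
      then have "\<Sum>P * f = 0" by (simp add: sum_distrib_right)
      then show False using f0 by (simp add: P_sum)
    qed
    then obtain q where q: "q \<in> P" "q * f \<noteq> 0" by blast
    define y where "y = q * f"
    have yC: "y \<in> C" using q f P_in by (auto simp: y_def C_in)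
    have "cstar y * y = f * q * f" using f q by (simp add: y_def P_sa mult.assoc) (simp add: mult.assoc[symmetric] P_idem)
    also have "q = \<alpha> (cstar u * q * u)"
    proof -
      have "\<alpha> (cstar u * q * u) = (u * cstar u) * q * (u * cstar u)" by (simp add: \<alpha>_def mult.assoc)
      then show ?thesis by (simp add: u)
    qed
    also have "f * \<alpha> (cstar u * q * u) * f = \<alpha> (p * (cstar u * q * u) * p)" by (simp add: f_def \<alpha>m)
    also have "\<dots> = scaleC (coef p (cstar u * q * u)) f"
      using coef[OF p inv(2)[OF P_in[OF q(1)]]] by (simp add: f_def) (simp add: \<alpha>_def)
    finally have 1: "cstar y * y = (norm y)\<^sup>2 *\<^sub>R f" using f f0 by (intro cstar_mult_projection)
    have "cstar (cstar y) * cstar y = q * f * q" using f q by (simp add: y_def P_sa mult.assoc) (simp add: mult.assoc[symmetric] f)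
    also have "\<dots> = scaleC (coef q f) q" using coef q f by simp
    finally have "cstar (cstar y) * cstar y = (norm (cstar y))\<^sup>2 *\<^sub>R q"
      using q P_sa P_idem P_ne by (intro cstar_mult_projection) auto
    then have 2: "y * cstar y = (norm y)\<^sup>2 *\<^sub>R q" by simp
    have "T (cstar y * y) = T (y * cstar y)" using yC by (intro T_commute) (auto simp: C_in)
    then have "complex_of_real ((norm y)\<^sup>2) * T f = complex_of_real ((norm y)\<^sup>2) * T q"
      unfolding 1 2 using f P_in[OF q(1)] by (simp only: T_scaleR)
    moreover have "norm y \<noteq> 0" using q by (simp add: y_def)
    ultimately show ?thesis using T_P[OF q(1)] by (simp add: f_def)
  qed
  have Te: "T (\<alpha> (e p q)) = T (e p q)" if pq: "(p, q) \<in> R" for p q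
  proof (cases "p = q")
    case True then show ?thesis using pq TP by (auto simp: R_def e_diag T_P)
  next
    case False
    have P: "p \<in> P" "q \<in> P" "cl p = cl q" using pq by (auto simp: R_def)
    have "T (\<alpha> (e p q)) = T (\<alpha> p * \<alpha> (e p q))" using P by (simp add: \<alpha>m[symmetric] e_left)
    also have "\<dots> = T (\<alpha> (e p q) * \<alpha> p)" using P P_in e_in by (intro T_commute \<alpha>C) auto
    also have "\<alpha> (e p q) * \<alpha> p = \<alpha> (e p q * (q * p))" using P by (simp add: \<alpha>m[symmetric] mult.assoc[symmetric] e_right)
    also have "\<dots> = 0" using P_orth[of q p] P False by (simp add: \<alpha>_def)
    finally show ?thesis using T_e P False by simp
  qed
  have eC: "e q p \<in> C" if "(p, q) \<in> R" for p q using that e_in by (auto simp: R_def)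
  let ?c = "\<lambda>p q. T (x * e p q)"
  have "\<alpha> x = \<alpha> (\<Sum>(p, q)\<in>R. scaleC (?c p q) (e q p))" using expand[OF x] by (rule arg_cong)
  also have "\<dots> = (\<Sum>(p, q)\<in>R. scaleC (?c p q) (\<alpha> (e q p)))"
    unfolding \<alpha>_def sum_distrib_left sum_distrib_right by (intro sum.cong) auto
  finally have "T (\<alpha> x) = (\<Sum>(p, q)\<in>R. ?c p q * T (\<alpha> (e q p)))"
    using eC \<alpha>C by (simp add: T_sum T_scaleC C_in split_beta)
  also have "\<dots> = (\<Sum>(p, q)\<in>R. ?c p q * T (e q p))"
    using Te by (intro sum.cong refl) (auto simp: R_def)
  also have "\<dots> = T (\<Sum>(p, q)\<in>R. scaleC (?c p q) (e q p))"
    using eC by (simp add: T_sum T_scaleC C_in split_beta)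
  also have "\<dots> = T x" using expand[OF x] by simp
  finally show ?thesis by (simp add: \<alpha>_def)
qed

text \<open>The matrix units and their images under conjugation by \<open>u\<close> are both dual
  bases for \<open>T\<close>, as \<open>T\<close> is invariant; \<open>sum_dual_unique\<close>
  identifies the two sums.\<close>

lemma index_unitary_conj:
  assumes u: "cstar u * u = 1" "u * cstar u = 1"
    and inv: "\<And>x. x \<in> C \<Longrightarrow> u * x * cstar u \<in> C" "\<And>x. x \<in> C \<Longrightarrow> cstar u * x * u \<in> C"
  shows "u * (\<Sum>(p, q)\<in>R. e p q * e q p) * cstar u = (\<Sum>(p, q)\<in>R. e p q * e q p)"
proof -
  define \<alpha> where "\<alpha> y = u * y * cstar u" for y
  have \<alpha>C: "\<alpha> y \<in> C" if "y \<in> C" for y using inv(1) that by (simp add: \<alpha>_def)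
  have \<alpha>m: "\<alpha> (y * z) = \<alpha> y * \<alpha> z" for y z
  proof -
    have "\<alpha> y * \<alpha> z = u * y * (cstar u * u) * z * cstar u" by (simp add: \<alpha>_def mult.assoc)
    then show ?thesis by (simp add: u \<alpha>_def mult.assoc)
  qed
  have eC: "e p q \<in> C" "e q p \<in> C" if "(p, q) \<in> R" for p q using that e_in by (auto simp: R_def)
  have inv': "x = \<alpha> (cstar u * x * u)" for x
  proof -
    have "\<alpha> (cstar u * x * u) = (u * cstar u) * x * (u * cstar u)" by (simp add: \<alpha>_def mult.assoc)
    then show ?thesis by (simp add: u)
  qed
  have exp: "x = (\<Sum>(p, q)\<in>R. \<alpha> (e p q) * scaleC (T (\<alpha> (e q p) * x)) 1)" if x: "x \<in> C" for x
  proof -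
    define y where "y = cstar u * x * u"
    have y: "y \<in> C" "x = \<alpha> y" using inv(2)[OF x] inv'[of x] by (simp_all add: y_def)
    have "y = (\<Sum>(p, q)\<in>R. scaleC (T (y * e q p)) (e p q))" using expand[OF y(1)] R_swap[of "\<lambda>p q. scaleC (T (y * e p q)) (e q p)"] by simp
    then have "x = \<alpha> (\<Sum>(p, q)\<in>R. scaleC (T (y * e q p)) (e p q))" using y(2) by simp
    also have "\<dots> = (\<Sum>(p, q)\<in>R. scaleC (T (y * e q p)) (\<alpha> (e p q)))"
      unfolding \<alpha>_def sum_distrib_left sum_distrib_right by (intro sum.cong) auto
    also have "\<dots> = (\<Sum>(p, q)\<in>R. \<alpha> (e p q) * scaleC (T (\<alpha> (e q p) * x)) 1)"
    proof (intro sum.cong refl, clarify)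
      fix p q assume pq: "(p, q) \<in> R"
      have "T (\<alpha> (e q p) * x) = T (e q p * y)"
        unfolding y(2) \<alpha>m[symmetric] unfolding \<alpha>_def
        using u inv eC[OF pq] y by (intro T_unitary_conj) (auto simp: C_in)
      also have "\<dots> = T (y * e q p)" using eC[OF pq] y by (intro T_commute)
      finally show "scaleC (T (y * e q p)) (\<alpha> (e p q)) = \<alpha> (e p q) * scaleC (T (\<alpha> (e q p) * x)) 1" by simp
    qed
    finally show ?thesis .
  qed
  have exp': "x = (\<Sum>(p, q)\<in>R. scaleC (T (x * e p q)) 1 * e q p)" if "x \<in> C" for x
    using expand[OF that] by simp
  have "(\<Sum>i\<in>R. e (fst i) (snd i) * e (snd i) (fst i)) = (\<Sum>j\<in>R. \<alpha> (e (fst j) (snd j)) * \<alpha> (e (snd j) (fst j)))"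
  proof (rule sum_dual_unique[where f = "\<lambda>x. scaleC (T x) 1"])
    show "e (fst i) (snd i) = (\<Sum>j\<in>R. \<alpha> (e (fst j) (snd j)) * scaleC (T (\<alpha> (e (snd j) (fst j)) * e (fst i) (snd i))) 1)"
      if "i \<in> R" for i
      using exp[of "e (fst i) (snd i)"] eC[of "fst i" "snd i"] that by (simp add: split_beta)
    show "\<alpha> (e (snd j) (fst j)) = (\<Sum>i\<in>R. scaleC (T (\<alpha> (e (snd j) (fst j)) * e (fst i) (snd i))) 1 * e (snd i) (fst i))"
      if "j \<in> R" for j
      using exp'[OF \<alpha>C[OF eC(2)[of "fst j" "snd j"]]] that by (simp add: split_beta)
  qed
  then have eq: "(\<Sum>(p, q)\<in>R. e p q * e q p) = (\<Sum>(p, q)\<in>R. \<alpha> (e p q * e q p))"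
    by (simp add: split_beta \<alpha>m)
  have "u * (\<Sum>(p, q)\<in>R. e p q * e q p) * cstar u = (\<Sum>(p, q)\<in>R. \<alpha> (e p q * e q p))"
    by (simp add: \<alpha>_def sum_distrib_left sum_distrib_right split_beta)
  then show ?thesis by (simp only: eq)
qed

lemma index_eq: "(\<Sum>(p, q)\<in>R. e p q * e q p) = (\<Sum>p\<in>P. real (card {q \<in> P. cl q = cl p}) *\<^sub>R p)"
proof -
  have "(\<Sum>(p, q)\<in>R. e p q * e q p) = (\<Sum>(p, q)\<in>R. p)"
    by (intro sum.cong refl) (auto simp: R_def e_mult e_diag)
  also have "\<dots> = (\<Sum>p\<in>P. \<Sum>q\<in>P. if cl p = cl q then p else 0)" by (rule sum_R)
  also have "\<dots> = (\<Sum>p\<in>P. real (card {q \<in> P. cl q = cl p}) *\<^sub>R p)"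
  proof (intro sum.cong refl)
    fix p
    have "{q \<in> P. cl q = cl p} = {q \<in> P. cl p = cl q}" by auto
    then show "(\<Sum>q\<in>P. if cl p = cl q then p else 0) = real (card {q \<in> P. cl q = cl p}) *\<^sub>R p"
      by (simp add: sum.inter_filter[symmetric] scaleR_conv_of_real)
  qed
  finally show ?thesis .
qed

end

section \<open>Unitary bases of matrix algebras with blocks of equal size\<close>

text \<open>Powers of a primitive \<open>M\<close>-th root of unity, with integer exponents since
  differences of indices and complex conjugation produce negative ones.\<close>

definition uroot :: "nat \<Rightarrow> int \<Rightarrow> complex" where
  "uroot M j = cis (2 * pi * (of_int j / of_nat M))"

lemma uroot_zero [simp]: "uroot M 0 = 1"
  by (simp add: uroot_def)

lemma uroot_add: "uroot M (i + j) = uroot M i * uroot M j"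
  by (simp add: uroot_def cis_mult add_divide_distrib distrib_left)

lemma cnj_uroot: "cnj (uroot M j) = uroot M (- j)"
  by (simp add: uroot_def cis_cnj)

lemma uroot_power: "uroot M j ^ k = uroot M (int k * j)"
  by (induction k) (simp_all add: uroot_add distrib_right)

lemma uroot_multiple:
  assumes "M > 0" "int M dvd j"
  shows "uroot M j = 1"
proof -
  obtain t where "j = int M * t" using assms by blast
  then have "of_int j / real M = of_int t" using assms by simp
  then show ?thesis unfolding uroot_def by simp
qed

lemma uroot_eq_1_iff:
  assumes M: "M > 0"
  shows "uroot M j = 1 \<longleftrightarrow> int M dvd j"
proof
  assume "uroot M j = 1"
  then have "exp (\<i> * of_real (2 * pi * (of_int j / of_nat M))) = 1"
    by (simp only: uroot_def cis_conv_exp)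
  then obtain t where "2 * pi * (of_int j / of_nat M) = of_int (2 * t) * pi"
    unfolding exp_eq_1 by auto
  then have "2 * pi * (of_int j / real M - of_int t) = 0" by (simp add: right_diff_distrib)
  then have "of_int j / real M = of_int t" by simp
  then have "real_of_int j = of_int (int M * t)" using M by (simp add: field_simps)
  then have "j = int M * t" by (simp only: of_int_eq_iff)
  then show "int M dvd j" by simp
qed (use uroot_multiple M in blast)

lemma uroot_cong:
  assumes "M > 0" "int M dvd i - j"
  shows "uroot M i = uroot M j"
  using uroot_add[of M "i - j" j] uroot_multiple[OF assms] by simp

lemma sum_uroot:
  assumes M: "M > 0"
  shows "(\<Sum>k<M. uroot M (int k * j)) = (if int M dvd j then of_nat M else 0)"
proof (cases "int M dvd j")
  case True
  then show ?thesis using uroot_multiple[OF M] by simp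
next
  case False
  define z where "z = uroot M j"
  have z1: "z \<noteq> 1" using uroot_eq_1_iff[OF M] False by (simp add: z_def)
  have zM: "z ^ M = 1" using uroot_multiple[OF M] by (simp add: z_def uroot_power)
  have "(\<Sum>k<M. uroot M (int k * j)) = (\<Sum>k<M. z ^ k)" by (simp add: z_def uroot_power)
  also have "\<dots> = 0" using geometric_sum[OF z1, of M] zM by simp
  finally show ?thesis using False by simp
qed

section \<open>Block matrices with prescribed entries\<close>

context matrix_units
begin

definition umat :: "('a \<Rightarrow> 'a \<Rightarrow> complex) \<Rightarrow> 'a" where
  "umat f = (\<Sum>(p, q)\<in>R. scaleC (f p q) (e p q))"

lemma sum_R_delta:
  assumes "(p, q) \<in> R"
  shows "(\<Sum>(s, t)\<in>R. if (s, t) = (p, q) then c else 0) = c"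
proof -
  have "(\<lambda>(s, t). if (s, t) = (p, q) then c else 0) = (\<lambda>i. if i = (p, q) then c else 0)" by auto
  then show ?thesis using assms by simp
qed

lemma e_in_R: "(p, q) \<in> R \<Longrightarrow> e p q \<in> C"
  by (auto simp: R_def e_in)

lemma umat_in: "umat f \<in> C"
  unfolding umat_def by (auto intro!: C_in e_in_R)

lemma cstar_umat: "cstar (umat f) = umat (\<lambda>p q. cnj (f q p))"
proof -
  have "cstar (umat f) = (\<Sum>(p, q)\<in>R. scaleC (cnj (f p q)) (e q p))"
    by (simp add: umat_def split_beta e_cstar)
  then show ?thesis unfolding umat_def using R_swap[of "\<lambda>p q. scaleC (cnj (f p q)) (e q p)"] by simp
qed

lemma entry_umat:
  assumes "p \<in> P" "q \<in> P" "cl p = cl q"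
  shows "p * umat f * q = scaleC (f p q) (e p q)"
proof -
  have "p * umat f * q = (\<Sum>(s, t)\<in>R. scaleC (f s t) (p * e s t * q))"
    by (simp add: umat_def sum_distrib_left sum_distrib_right split_beta)
  also have "\<dots> = (\<Sum>(s, t)\<in>R. if (s, t) = (p, q) then scaleC (f p q) (e p q) else 0)"
  proof (intro sum.cong refl, clarify)
    fix s t assume st: "(s, t) \<in> R"
    have "p * e s t = (if p = s then e s t else 0)"
      using e_mult_if[of p p s t] e_diag[of p] assms st by (auto simp: R_def)
    moreover have "e s t * q = (if t = q then e s t else 0)"
      using e_mult_if[of s t q q] e_diag[of q] assms st by (auto simp: R_def)
    ultimately show "scaleC (f s t) (p * e s t * q) = (if (s, t) = (p, q) then scaleC (f p q) (e p q) else 0)"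
      by auto
  qed
  also have "\<dots> = scaleC (f p q) (e p q)" using assms by (intro sum_R_delta) (simp add: R_def)
  finally show ?thesis .
qed

lemma eq_by_entries:
  assumes "x \<in> C" "y \<in> C" and "\<And>p q. p \<in> P \<Longrightarrow> q \<in> P \<Longrightarrow> cl p = cl q \<Longrightarrow> p * x * q = p * y * q"
  shows "x = y"
proof -
  have "(\<Sum>p\<in>P. \<Sum>q\<in>P. p * x * q) = (\<Sum>p\<in>P. \<Sum>q\<in>P. p * y * q)"
    using assms block0 by (intro sum.cong refl) metis
  then show ?thesis using decompose[of x] decompose[of y] by simp
qed

lemma umat_mult: "umat f * umat g = umat (\<lambda>p q. \<Sum>s\<in>{s\<in>P. cl s = cl p}. f p s * g s q)"
proof (rule eq_by_entries)
  fix p q assume pq: "p \<in> P" "q \<in> P" "cl p = cl q"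
  have "p * (umat f * umat g) * q = p * umat f * \<Sum>P * \<Sum>P * umat g * q" by (simp add: P_sum mult.assoc)
  also have "\<dots> = (\<Sum>s\<in>P. (p * umat f * s) * (s * umat g * q))"
  proof -
    have "\<Sum>P * \<Sum>P = (\<Sum>s\<in>P. s * s)" by (simp add: P_sum P_idem)
    then have "p * umat f * (\<Sum>P * \<Sum>P) * (umat g * q) = p * umat f * (\<Sum>s\<in>P. s * s) * (umat g * q)" by (simp only:)
    then show ?thesis by (simp add: sum_distrib_left sum_distrib_right mult.assoc)
  qed
  also have "\<dots> = (\<Sum>s\<in>P. if cl s = cl p then scaleC (f p s * g s q) (e p q) else 0)"
  proof (intro sum.cong refl)
    fix s assume s: "s \<in> P"
    show "p * umat f * s * (s * umat g * q) = (if cl s = cl p then scaleC (f p s * g s q) (e p q) else 0)"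
    proof (cases "cl s = cl p")
      case True then show ?thesis using pq s by (simp add: entry_umat e_mult scaleC_scaleC mult.commute)
    next
      case False then show ?thesis using block0[of p s "umat f"] pq s umat_in by simp
    qed
  qed
  also have "\<dots> = (\<Sum>s\<in>{s\<in>P. cl s = cl p}. scaleC (f p s * g s q) (e p q))"
    by (simp add: sum.inter_filter)
  also have "\<dots> = p * umat (\<lambda>p q. \<Sum>s\<in>{s\<in>P. cl s = cl p}. f p s * g s q) * q"
    using pq by (simp add: entry_umat cvs.scale_sum_left)
  finally show "p * (umat f * umat g) * q = \<dots>" .
qed (auto intro: umat_in C_in)

lemma umat_eq_one:
  assumes "\<And>p q. p \<in> P \<Longrightarrow> q \<in> P \<Longrightarrow> cl p = cl q \<Longrightarrow> f p q = (if p = q then 1 else 0)"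
  shows "umat f = 1"
proof (rule eq_by_entries)
  fix p q assume pq: "p \<in> P" "q \<in> P" "cl p = cl q"
  show "p * umat f * q = p * 1 * q"
    using pq assms[OF pq] P_orth P_idem
    by (cases "p = q") (auto simp: entry_umat e_diag scaleC_of_real[of 1, simplified])
qed (auto intro: umat_in C_in)

lemma T_umat_mult: "x \<in> C \<Longrightarrow> T (umat f * x) = (\<Sum>(p, q)\<in>R. f p q * T (e p q * x))"
proof -
  assume x: "x \<in> C"
  have "umat f * x = (\<Sum>(p, q)\<in>R. scaleC (f p q) (e p q * x))"
    by (simp add: umat_def sum_distrib_right split_beta)
  then show ?thesis using x e_in_R by (simp add: T_sum T_scaleC C_in split_beta)
qed

lemma T_e_umat: "(p, q) \<in> R \<Longrightarrow> T (e p q * umat g) = g q p"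
proof -
  assume pq: "(p, q) \<in> R"
  then have P: "p \<in> P" "q \<in> P" "cl q = cl p" by (auto simp: R_def)
  have "T (e p q * umat g) = T (umat g * e p q)" using pq by (intro T_commute umat_in e_in_R)
  moreover have "scaleC (T (umat g * e p q)) (e q p) = scaleC (g q p) (e q p)"
    using P by (intro trans[OF T_entry[OF pq umat_in, symmetric] entry_umat]) auto
  moreover have "e q p \<noteq> 0"
  proof
    assume 0: "e q p = 0"
    have "q = e q p * e p q" using P by (simp add: e_mult e_diag)
    then show False using 0 P_ne P by simp
  qed
  ultimately show ?thesis by auto
qed

end

text \<open>Equal block sizes allow a numbering in which the quotient by \<open>n\<close> names the
  block and the remainder the position in it, so that blocks and Fourier phases become arithmetic of
  one natural number.\<close>

lemma equal_blocks_enumeration: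
  assumes fin: "finite P" and ne: "P \<noteq> {}" and cls: "\<And>p. p \<in> P \<Longrightarrow> card {q \<in> P. cl q = cl p} = n"
  shows "\<exists>N K. n > 0 \<and> bij_betw N P {..<K * n} \<and> (\<forall>p\<in>P. \<forall>q\<in>P. cl p = cl q \<longleftrightarrow> N p div n = N q div n)"
proof -
  define F where "F c = {q \<in> P. cl q = c}" for c
  have n0: "n > 0"
  proof -
    obtain p where p: "p \<in> P" using ne by blast
    then have "card {q \<in> P. cl q = cl p} > 0" using fin by (auto simp: card_gt_0_iff)
    then show ?thesis using cls[OF p] by simp
  qed
  have "\<exists>g. bij_betw g (F c) {0..<n}" if "c \<in> cl ` P" for c
  proof -
    have "card (F c) = n" using cls that by (auto simp: F_def)
    moreover have "finite (F c)" using fin by (simp add: F_def)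
    ultimately show ?thesis using ex_bij_betw_finite_nat by metis
  qed
  then obtain g where g: "\<And>c. c \<in> cl ` P \<Longrightarrow> bij_betw (g c) (F c) {0..<n}" by metis
  obtain h where h: "bij_betw h (cl ` P) {0..<card (cl ` P)}"
    using ex_bij_betw_finite_nat[of "cl ` P"] fin by blast
  define K where "K = card (cl ` P)"
  define N where "N p = h (cl p) * n + g (cl p) p" for p
  have gn: "g (cl p) p < n" if "p \<in> P" for p
    using bij_betwE[OF g[of "cl p"]] that by (auto simp: F_def)
  have hK: "h (cl p) < K" if "p \<in> P" for p
    using bij_betwE[OF h] that by (auto simp: K_def)
  have Nd: "N p div n = h (cl p)" "N p mod n = g (cl p) p" if "p \<in> P" for p
    using gn[OF that] by (simp_all add: N_def)
  have hi: "h (cl p) = h (cl q) \<longleftrightarrow> cl p = cl q" if "p \<in> P" "q \<in> P" for p q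
    using bij_betw_imp_inj_on[OF h] that by (auto simp: inj_on_eq_iff)
  have "bij_betw N P {..<K * n}"
  proof (rule bij_betw_imageI)
    show "inj_on N P"
    proof (rule inj_onI)
      fix p q assume pq: "p \<in> P" "q \<in> P" "N p = N q"
      then have c: "cl p = cl q" using Nd(1)[of p] Nd(1)[of q] hi by simp
      then have "g (cl p) p = g (cl p) q" using Nd(2)[of p] Nd(2)[of q] pq by simp
      moreover have "p \<in> F (cl p)" "q \<in> F (cl p)" using pq c by (auto simp: F_def)
      ultimately show "p = q" using bij_betw_imp_inj_on[OF g[of "cl p"]] pq by (auto simp: inj_on_eq_iff)
    qed
    show "N ` P = {..<K * n}"
    proof (intro equalityI subsetI)
      fix i assume "i \<in> N ` P"
      then obtain p where p: "p \<in> P" "i = N p" by blast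
      have "i div n < K" using Nd(1)[OF p(1)] hK[OF p(1)] p by simp
      then show "i \<in> {..<K * n}" using n0 by (simp add: less_mult_imp_div_less div_less_iff_less_mult)
    next
      fix i assume "i \<in> {..<K * n}"
      then have "i div n < K" by (simp add: less_mult_imp_div_less)
      then have "i div n \<in> h ` (cl ` P)" using bij_betw_imp_surj_on[OF h] by (simp add: K_def)
      then obtain c where "i div n = h c" and c: "c \<in> cl ` P" by (rule imageE)
      have "i mod n \<in> g c ` F c" using bij_betw_imp_surj_on[OF g[OF c]] n0 by simp
      then obtain p where p: "p \<in> P" "cl p = c" "g c p = i mod n" by (auto simp: F_def)
      then have "N p = i" by (simp add: N_def \<open>i div n = h c\<close>[symmetric])
      then show "i \<in> N ` P" using p by blast
    qed
  qed
  then show ?thesis using n0 Nd(1) hi by (intro exI[of _ N] exI[of _ K]) auto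
qed

section \<open>Fourier matrices and the resulting unitary basis\<close>

locale uniform_matrix_units = matrix_units C P cl e
  for C P :: "'a::unital_cstar_algebra set" and cl e +
  fixes N :: "'a \<Rightarrow> nat" and K n :: nat
  assumes n0: "n > 0" and N: "bij_betw N P {..<K * n}"
    and cl_N: "p \<in> P \<Longrightarrow> q \<in> P \<Longrightarrow> cl p = cl q \<longleftrightarrow> N p div n = N q div n"
begin

definition m where "m = K * n"

lemma card_P: "card P = m"
  using bij_betw_same_card[OF N] by (simp add: m_def)

lemma N_less: "p \<in> P \<Longrightarrow> N p < m"
  using bij_betwE[OF N] by (auto simp: m_def)

lemma N_inj: "p \<in> P \<Longrightarrow> q \<in> P \<Longrightarrow> N p = N q \<longleftrightarrow> p = q"
  using bij_betw_imp_inj_on[OF N] by (simp add: inj_on_eq_iff)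

lemma N_surj: "i < m \<Longrightarrow> \<exists>p\<in>P. N p = i"
  using bij_betw_imp_surj_on[OF N] unfolding m_def by (metis imageE lessThan_iff)

lemma m0: "m > 0"
proof -
  have "P \<noteq> {}" using P_sum by auto
  then show ?thesis using N_less by fastforce
qed

text \<open>Numbers the positions inside the blocks. The row \<open>p\<close> already determines the
  block, so only the place of the column within it is recorded; there are \<open>m * n\<close>
  positions, the dimension of \<open>C\<close>.\<close>

definition \<phi> where "\<phi> p q = N p * n + N q mod n"

lemma bij_\<phi>: "bij_betw (\<lambda>(p, q). \<phi> p q) R {..<m * n}"
proof (rule bij_betw_imageI)
  have d: "\<phi> p q div n = N p" "\<phi> p q mod n = N q mod n" for p q using n0 by (simp_all add: \<phi>_def)
  show "inj_on (\<lambda>(p, q). \<phi> p q) R"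
  proof (rule inj_onI, clarify)
    fix p q s t assume R: "(p, q) \<in> R" "(s, t) \<in> R" and eq: "\<phi> p q = \<phi> s t"
    have P: "p \<in> P" "q \<in> P" "s \<in> P" "t \<in> P" and c: "cl p = cl q" "cl s = cl t" using R by (auto simp: R_def)
    have "N p = N s" "N q mod n = N t mod n" using d eq by metis+
    then have ps: "p = s" using P N_inj by simp
    then have "N q div n = N t div n" using cl_N P c by metis
    then have "N q = N t" using \<open>N q mod n = N t mod n\<close> by (metis div_mult_mod_eq)
    then show "p = s \<and> q = t" using ps P N_inj by simp
  qed
  show "(\<lambda>(p, q). \<phi> p q) ` R = {..<m * n}"
  proof (intro equalityI subsetI)
    fix i assume "i \<in> (\<lambda>(p, q). \<phi> p q) ` R"
    then obtain p q where "(p, q) \<in> R" "i = \<phi> p q" by auto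
    then have "i div n < m" using d N_less by (auto simp: R_def)
    then show "i \<in> {..<m * n}" using n0 by (simp add: div_less_iff_less_mult)
  next
    fix i assume "i \<in> {..<m * n}"
    then have "i div n < m" by (simp add: less_mult_imp_div_less)
    then obtain p where p: "p \<in> P" "N p = i div n" using N_surj by blast
    define j where "j = (N p div n) * n + i mod n"
    have j: "j div n = N p div n" "j mod n = i mod n" using n0 by (simp_all add: j_def)
    have "N p div n < K" using N_less[OF p(1)] by (simp add: m_def less_mult_imp_div_less)
    then have "j < m" unfolding m_def using j(1) n0 by (simp add: div_less_iff_less_mult[symmetric])
    then obtain q where q: "q \<in> P" "N q = j" using N_surj by blast
    have "(p, q) \<in> R" using p q j cl_N by (simp add: R_def)
    moreover have "\<phi> p q = i" using p q j by (simp add: \<phi>_def)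
    ultimately show "i \<in> (\<lambda>(p, q). \<phi> p q) ` R" by force
  qed
qed

text \<open>Within a block the remainders modulo \<open>n\<close> run through all residues once, so
  this is a complete sum of roots of unity.\<close>

lemma class_sum:
  assumes p: "p \<in> P"
  shows "(\<Sum>s\<in>{s\<in>P. cl s = cl p}. uroot n (int (N s) * D)) = (if int n dvd D then of_nat n else 0)"
proof -
  have "bij_betw (\<lambda>s. N s mod n) {s\<in>P. cl s = cl p} {..<n}"
  proof (rule bij_betw_imageI)
    show "inj_on (\<lambda>s. N s mod n) {s\<in>P. cl s = cl p}"
    proof (rule inj_onI, clarify)
      fix s t assume "s \<in> P" "cl s = cl p" "t \<in> P" "cl t = cl p" "N s mod n = N t mod n"
      then show "s = t" using cl_N N_inj by (metis div_mult_mod_eq)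
    qed
    show "(\<lambda>s. N s mod n) ` {s\<in>P. cl s = cl p} = {..<n}"
    proof (intro equalityI subsetI)
      fix i assume "i \<in> {..<n}"
      then have i: "i < n" by simp
      define j where "j = (N p div n) * n + i"
      have j: "j div n = N p div n" "j mod n = i" using i by (simp_all add: j_def)
      have "N p div n < K" using N_less[OF p(1)] by (simp add: m_def less_mult_imp_div_less)
      then have "j < m" unfolding m_def using j(1) n0 by (simp add: div_less_iff_less_mult[symmetric])
      then obtain q where q: "q \<in> P" "N q = j" using N_surj by blast
      then have "cl q = cl p" using cl_N p j by simp
      then show "i \<in> (\<lambda>s. N s mod n) ` {s\<in>P. cl s = cl p}" using q j by force
    qed (use n0 in auto)
  qed
  then have "(\<Sum>i<n. uroot n (int i * D)) = (\<Sum>s\<in>{s\<in>P. cl s = cl p}. uroot n (int (N s mod n) * D))"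
    by (rule sum.reindex_bij_betw[symmetric])
  also have "\<dots> = (\<Sum>s\<in>{s\<in>P. cl s = cl p}. uroot n (int (N s) * D))"
  proof (intro sum.cong refl uroot_cong n0)
    fix s
    have "int n dvd int (N s mod n) - int (N s)"
      by (simp add: of_nat_mod mod_eq_dvd_iff[symmetric])
    then show "int n dvd int (N s mod n) * D - int (N s) * D" by (metis dvd_mult2 left_diff_distrib)
  qed
  finally show ?thesis using sum_uroot[OF n0] by simp
qed

lemma class_dvd:
  assumes "p \<in> P" "q \<in> P" "cl p = cl q"
  shows "int n dvd int (N q) - int (N p) \<longleftrightarrow> p = q"
proof
  assume "int n dvd int (N q) - int (N p)"
  then have "N q mod n = N p mod n" by (simp add: mod_eq_dvd_iff[symmetric] of_nat_mod[symmetric])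
  then show "p = q" using assms cl_N N_inj by (metis div_mult_mod_eq)
qed simp

text \<open>In each block \<open>W k\<close> is the Fourier matrix between two diagonal unitaries. The latter are powers of a
  root of unity indexed by the bijective numbering \<open>\<phi>\<close> of the positions \<open>(p, q)\<close>, which makes the
  different \<open>W k\<close> orthogonal.\<close>

definition chi where
  "chi k p q = of_real (1 / sqrt n) * uroot (m * n) (int k * int (\<phi> p q)) * uroot n (int (N p) * int (N q))"

definition W where "W k = umat (chi k)"

lemma W_in: "W k \<in> C"
  by (simp add: W_def umat_in)

lemma chi_cnj: "cnj (chi k p q) * chi l s t =
    of_real (1 / n) * uroot (m * n) (int l * int (\<phi> s t) - int k * int (\<phi> p q)) *
    uroot n (int (N s) * int (N t) - int (N p) * int (N q))"
proof -
  have "complex_of_real (1 / sqrt n) * of_real (1 / sqrt n) = of_real (1 / n)"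
    by (simp only: of_real_mult[symmetric]) (simp add: real_sqrt_mult_self)
  note h = this[symmetric]
  show ?thesis
    unfolding chi_def diff_conv_add_uminus uroot_add h
    by (simp only: complex_cnj_mult cnj_uroot complex_cnj_complex_of_real mult_ac)
qed

lemma mn0: "m * n > 0"
  using m0 n0 by simp

text \<open>For two entries in the same row the difference of their numbers \<phi> does not depend
  on the row. The factor with \<open>k\<close> therefore leaves the sum, and the orthogonality of
  the Fourier matrix remains.\<close>

lemma W_unitary_left: "cstar (W k) * W k = 1"
  unfolding W_def cstar_umat umat_mult
proof (rule umat_eq_one)
  fix p q assume pq: "p \<in> P" "q \<in> P" "cl p = cl q"
  have "(\<Sum>s\<in>{s\<in>P. cl s = cl p}. cnj (chi k s p) * chi k s q) =
     of_real (1 / n) * uroot (m * n) (int k * (int (N q mod n) - int (N p mod n))) *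
     (\<Sum>s\<in>{s\<in>P. cl s = cl p}. uroot n (int (N s) * (int (N q) - int (N p))))"
    unfolding sum_distrib_left chi_cnj
    by (intro sum.cong refl) (simp add: \<phi>_def algebra_simps)
  also have "\<dots> = (if p = q then 1 else 0)"
    using pq n0 by (simp add: class_sum class_dvd)
  finally show "(\<Sum>s\<in>{s\<in>P. cl s = cl p}. cnj (chi k s p) * chi k s q) = (if p = q then 1 else 0)" .
qed

lemma W_unitary_right: "W k * cstar (W k) = 1"
  unfolding W_def cstar_umat umat_mult
proof (rule umat_eq_one)
  fix p q assume pq: "p \<in> P" "q \<in> P" "cl p = cl q"
  have "(\<Sum>s\<in>{s\<in>P. cl s = cl p}. chi k p s * cnj (chi k q s)) =
     of_real (1 / n) * uroot (m * n) (int k * (int (N p * n) - int (N q * n))) *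
     (\<Sum>s\<in>{s\<in>P. cl s = cl p}. uroot n (int (N s) * (int (N p) - int (N q))))"
    unfolding sum_distrib_left mult.commute[of "chi k p _"] chi_cnj
    by (intro sum.cong refl) (simp add: \<phi>_def algebra_simps)
  also have "\<dots> = (if p = q then 1 else 0)"
    using pq n0 class_dvd[of q p] by (simp add: class_sum)
  finally show "(\<Sum>s\<in>{s\<in>P. cl s = cl p}. chi k p s * cnj (chi k q s)) = (if p = q then 1 else 0)" .
qed

text \<open>In each position the Fourier phases cancel against their conjugates; since \<phi> is a
  bijection, what remains is a full sum of \<open>m * n\<close>-th roots of unity. The entries have
  squared modulus \<open>1 / n\<close>, which gives \<open>m\<close> in the diagonal case.\<close>

lemma W_orthonormal:
  assumes k: "k < m * n" and l: "l < m * n"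
  shows "T (cstar (W k) * W l) = (if k = l then of_nat m else 0)"
proof -
  have "T (cstar (W k) * W l) = (\<Sum>(p, q)\<in>R. cnj (chi k q p) * chi l q p)"
    unfolding W_def cstar_umat T_umat_mult[OF umat_in]
    by (intro sum.cong refl) (auto simp: T_e_umat)
  also have "\<dots> = (\<Sum>(q, p)\<in>R. cnj (chi k q p) * chi l q p)" by (rule R_swap)
  also have "\<dots> = (\<Sum>(q, p)\<in>R. of_real (1 / n) * uroot (m * n) (int (\<phi> q p) * (int l - int k)))"
    unfolding chi_cnj by (intro sum.cong refl) (auto simp: algebra_simps)
  also have "\<dots> = (\<Sum>i<m * n. of_real (1 / n) * uroot (m * n) (int i * (int l - int k)))"
    using sum.reindex_bij_betw[OF bij_\<phi>, of "\<lambda>i. of_real (1 / n) * uroot (m * n) (int i * (int l - int k))"]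
    by (simp add: split_beta)
  also have "\<dots> = of_real (1 / n) * (if int (m * n) dvd int l - int k then of_nat (m * n) else 0)"
    by (simp only: sum_distrib_left[symmetric] sum_uroot[OF mn0])
  also have "int (m * n) dvd int l - int k \<longleftrightarrow> k = l"
  proof
    assume "int (m * n) dvd int l - int k"
    then have "l mod (m * n) = k mod (m * n)" by (simp only: mod_eq_dvd_iff[symmetric] of_nat_mod[symmetric] of_nat_eq_iff)
    then show "k = l" using k l by simp
  qed simp
  finally show ?thesis using n0 by simp
qed

text \<open>The orthogonality used here is the dual one, summing over \<open>k\<close> for two fixed
  positions. It gives completeness directly, without a dimension count.\<close>

lemma W_expand:
  assumes x: "x \<in> C"
  shows "x = (\<Sum>k<m * n. scaleC (T (x * W k) / of_nat m) (cstar (W k)))"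
proof (rule eq_by_entries)
  fix s t assume st: "s \<in> P" "t \<in> P" "cl s = cl t"
  have tsR: "(t, s) \<in> R" using st by (simp add: R_def)
  have TxW: "T (x * W k) = (\<Sum>(p, q)\<in>R. chi k p q * T (x * e p q))" for k
  proof -
    have "T (x * W k) = T (W k * x)" using x W_in by (intro T_commute)
    also have "\<dots> = (\<Sum>(p, q)\<in>R. chi k p q * T (e p q * x))" unfolding W_def by (rule T_umat_mult[OF x])
    also have "\<dots> = (\<Sum>(p, q)\<in>R. chi k p q * T (x * e p q))"
      using T_commute[OF e_in_R x] by (intro sum.cong refl) auto
    finally show ?thesis .
  qed
  have orth: "(\<Sum>k<m * n. cnj (chi k t s) * chi k p q) = (if (p, q) = (t, s) then of_nat m else 0)"
    if pq: "(p, q) \<in> R" for p q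
  proof -
    have "(\<Sum>k<m * n. cnj (chi k t s) * chi k p q) = of_real (1 / n) *
        uroot n (int (N p) * int (N q) - int (N t) * int (N s)) *
        (\<Sum>k<m * n. uroot (m * n) (int k * (int (\<phi> p q) - int (\<phi> t s))))"
      unfolding sum_distrib_left chi_cnj by (intro sum.cong refl) (simp add: algebra_simps)
    moreover have "int (m * n) dvd int (\<phi> p q) - int (\<phi> t s) \<longleftrightarrow> (p, q) = (t, s)"
    proof
      assume "int (m * n) dvd int (\<phi> p q) - int (\<phi> t s)"
      then have "\<phi> p q mod (m * n) = \<phi> t s mod (m * n)"
        by (simp only: mod_eq_dvd_iff[symmetric] of_nat_mod[symmetric] of_nat_eq_iff)
      moreover have "\<phi> p q < m * n" "\<phi> t s < m * n" using bij_betwE[OF bij_\<phi>] pq tsR by auto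
      ultimately have "\<phi> p q = \<phi> t s" by simp
      then show "(p, q) = (t, s)"
        using inj_onD[OF bij_betw_imp_inj_on[OF bij_\<phi>], of "(p, q)" "(t, s)"] pq tsR by simp
    qed auto
    ultimately show ?thesis using n0 by (auto simp: sum_uroot[OF mn0])
  qed
  have "s * (\<Sum>k<m * n. scaleC (T (x * W k) / of_nat m) (cstar (W k))) * t =
      scaleC (\<Sum>k<m * n. T (x * W k) / of_nat m * cnj (chi k t s)) (e s t)"
    unfolding W_def cstar_umat using st
    by (simp add: sum_distrib_left sum_distrib_right entry_umat scaleC_scaleC cvs.scale_sum_left)
  also have "(\<Sum>k<m * n. T (x * W k) / of_nat m * cnj (chi k t s)) =
      (\<Sum>k<m * n. \<Sum>(p, q)\<in>R. T (x * e p q) / of_nat m * (cnj (chi k t s) * chi k p q))"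
    unfolding TxW sum_divide_distrib sum_distrib_right by (intro sum.cong refl) auto
  also have "\<dots> = (\<Sum>(p, q)\<in>R. T (x * e p q) / of_nat m * (\<Sum>k<m * n. cnj (chi k t s) * chi k p q))"
    by (subst sum.swap) (simp add: sum_distrib_left split_beta)
  also have "\<dots> = (\<Sum>(p, q)\<in>R. if (p, q) = (t, s) then T (x * e t s) else 0)"
    using m0 by (intro sum.cong refl) (auto simp: orth)
  also have "\<dots> = T (x * e t s)" using tsR by (rule sum_R_delta)
  also have "scaleC (T (x * e t s)) (e s t) = s * x * t" using T_entry[OF tsR x] by simp
  finally show "s * x * t = s * (\<Sum>k<m * n. scaleC (T (x * W k) / of_nat m) (cstar (W k))) * t" by simp
qed (use x W_in in \<open>auto intro!: C_in\<close>)

end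

section \<open>Normalizers\<close>

lemma cstar_subalgebra_closure_span:
  assumes S: "1 \<in> S" "\<And>x y. x \<in> S \<Longrightarrow> y \<in> S \<Longrightarrow> x * y \<in> S" "\<And>x. x \<in> S \<Longrightarrow> cstar x \<in> S"
  shows "cstar_subalgebra (closure (cvs.span (S :: 'a::unital_cstar_algebra set)))"
proof -
  let ?V = "cvs.span S"
  have step: "f ` closure ?V \<subseteq> closure ?V" if "continuous_on UNIV f" "f ` ?V \<subseteq> closure ?V" for f :: "'a \<Rightarrow> 'a"
    using that by (intro image_closure_subset) (auto intro: continuous_on_subset)
  have mult: "x * y \<in> ?V" if x: "x \<in> ?V" and y: "y \<in> ?V" for x y
    using x
  proof (induction rule: cvs.span_induct_alt)
    case (step c s x)
    have "s * y \<in> ?V" using y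
    proof (induction rule: cvs.span_induct_alt)
      case (step d t y)
      then show ?case using S(2)[OF \<open>s \<in> S\<close>]
        by (simp add: distrib_left cvs.span_add cvs.span_scale cvs.span_base)
    qed (simp add: cvs.span_zero)
    then show ?case using step by (simp add: distrib_right cvs.span_add cvs.span_scale)
  qed (simp add: cvs.span_zero)
  have star: "cstar x \<in> ?V" if x: "x \<in> ?V" for x
    using x by (induction rule: cvs.span_induct_alt)
      (simp_all add: cvs.span_zero cvs.span_add cvs.span_scale cvs.span_base S(3))
  note sub = closure_subset[of ?V]
  have add1: "(\<lambda>y. x + y) ` closure ?V \<subseteq> closure ?V" if "x \<in> ?V" for x
    using sub that by (intro step) (auto intro!: continuous_intros cvs.span_add)
  have add2: "(\<lambda>x. x + y) ` closure ?V \<subseteq> closure ?V" if "y \<in> closure ?V" for y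
    using add1 that by (intro step) (auto intro!: continuous_intros)
  have mult1: "(\<lambda>y. x * y) ` closure ?V \<subseteq> closure ?V" if "x \<in> ?V" for x
    using sub mult that by (intro step) (auto intro!: continuous_intros)
  have mult2: "(\<lambda>x. x * y) ` closure ?V \<subseteq> closure ?V" if "y \<in> closure ?V" for y
    using mult1 that by (intro step) (auto intro!: continuous_intros)
  have scale1: "scaleC c ` closure ?V \<subseteq> closure ?V" for c
    using sub by (intro step) (auto intro!: continuous_intros cvs.span_scale)
  have star1: "cstar ` closure ?V \<subseteq> closure ?V"
    using sub star by (intro step) (auto intro!: continuous_intros)
  show ?thesis
    unfolding cstar_subalgebra_def
    using add2[unfolded image_subset_iff] mult2[unfolded image_subset_iff] scale1[unfolded image_subset_iff]
      star1[unfolded image_subset_iff] sub cvs.span_base[OF S(1)] by simp (simp add: subset_iff)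
qed

text \<open>Since \<open>S\<close> is closed under products and adjoints, only linear combinations
  and limits are missing. Hence an identity between continuous linear maps can be checked on
  normalizers.\<close>

lemma generated_dense:
  assumes S: "1 \<in> S" "\<And>x y. x \<in> S \<Longrightarrow> y \<in> S \<Longrightarrow> x * y \<in> S" "\<And>x. x \<in> S \<Longrightarrow> cstar x \<in> S"
    and X: "closed X" "cvs.subspace X" "S \<subseteq> X"
  shows "cstar_generated S \<subseteq> (X :: 'a::unital_cstar_algebra set)"
proof -
  have "cstar_generated S \<subseteq> closure (cvs.span S)"
    using cstar_subalgebra_closure_span[OF S] closure_subset cvs.span_superset
    by (intro generated_minimal) (blast intro: subset_trans)+
  also have "\<dots> \<subseteq> X" using X by (intro closure_minimal cvs.span_minimal)
  finally show ?thesis .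
qed

section \<open>Normalizers and inner automorphisms\<close>

context cexp_simple
begin

abbreviation \<N> where "\<N> \<equiv> unitary_normalizer UNIV B"

lemmas B_intros = cstar_subalgebra_intros[OF subalg]

lemma normalizer_unitary: "u \<in> \<N> \<Longrightarrow> cstar u * u = 1" "u \<in> \<N> \<Longrightarrow> u * cstar u = 1"
  by (auto simp: unitary_normalizer_def unitaries_def)

lemma normalizer_cancel [simp]:
  assumes "u \<in> \<N>"
  shows "cstar u * (u * x) = x" "u * (cstar u * x) = x"
  using normalizer_unitary[OF assms] by (simp_all add: mult.assoc[symmetric])

lemma normalizer_B: "u \<in> \<N> \<Longrightarrow> b \<in> B \<Longrightarrow> u * b * cstar u \<in> B"
  by (auto simp: unitary_normalizer_def)

lemma normalizer_B': "u \<in> \<N> \<Longrightarrow> b \<in> B \<Longrightarrow> cstar u * b * u \<in> B"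
proof -
  assume u: "u \<in> \<N>" and b: "b \<in> B"
  then obtain c where "c \<in> B" "b = u * c * cstar u" by (auto simp: unitary_normalizer_def)
  then show ?thesis using u by (simp add: mult.assoc normalizer_unitary)
qed

lemma normalizerI:
  assumes "cstar u * u = 1" "u * cstar u = 1" "\<And>b. b \<in> B \<Longrightarrow> u * b * cstar u \<in> B" "\<And>b. b \<in> B \<Longrightarrow> cstar u * b * u \<in> B"
  shows "u \<in> \<N>"
proof -
  have "b \<in> (\<lambda>b. u * b * cstar u) ` B" if "b \<in> B" for b
  proof
    have "u * (cstar u * b * u) * cstar u = (u * cstar u) * b * (u * cstar u)" by (simp add: mult.assoc)
    then show "b = u * (cstar u * b * u) * cstar u" by (simp add: assms)
  qed (use assms that in auto)
  then show ?thesis using assms by (auto simp: unitary_normalizer_def unitaries_def)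
qed

lemma normalizer_one: "1 \<in> \<N>"
  by (rule normalizerI) simp_all

lemma normalizer_cstar: "u \<in> \<N> \<Longrightarrow> cstar u \<in> \<N>"
  by (rule normalizerI) (simp_all add: normalizer_unitary normalizer_B normalizer_B')

lemma normalizer_mult: "u \<in> \<N> \<Longrightarrow> v \<in> \<N> \<Longrightarrow> u * v \<in> \<N>"
proof (rule normalizerI)
  assume u: "u \<in> \<N>" and v: "v \<in> \<N>"
  show "cstar (u * v) * (u * v) = 1" "u * v * cstar (u * v) = 1"
    using u v by (simp_all add: mult.assoc normalizer_unitary)
  show "u * v * b * cstar (u * v) \<in> B" if "b \<in> B" for b
    using normalizer_B[OF u normalizer_B[OF v that]] by (simp add: mult.assoc)
  show "cstar (u * v) * b * (u * v) \<in> B" if "b \<in> B" for b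
    using normalizer_B'[OF v normalizer_B'[OF u that]] by (simp add: mult.assoc)
qed

lemma normalizer_C:
  assumes u: "u \<in> \<N>" and c: "c \<in> C"
  shows "u * c * cstar u \<in> C"
proof -
  have "u * c * cstar u * b = b * (u * c * cstar u)" if b: "b \<in> B" for b
  proof -
    have "c * (cstar u * b * u) = (cstar u * b * u) * c" using C_commute[OF c normalizer_B'[OF u b]] .
    then have "u * (c * (cstar u * b * u)) * cstar u = u * ((cstar u * b * u) * c) * cstar u" by simp
    then show ?thesis using u by (simp add: mult.assoc normalizer_unitary)
  qed
  then show ?thesis by (simp add: centralizer_in_def)
qed

lemma normalizer_C': "u \<in> \<N> \<Longrightarrow> c \<in> C \<Longrightarrow> cstar u * c * u \<in> C"
  using normalizer_C[OF normalizer_cstar, of u c] by simp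

text \<open>Conjugation by \<open>u\<close> agrees on \<open>B\<close> with conjugation by
  \<open>w\<close>. The condition is phrased as a factorisation of \<open>u\<close> into
  \<open>w\<close> and an element of \<open>C\<close>, which is the form used for
  expansions.\<close>

definition acts_inner :: "'a \<Rightarrow> bool" where
  "acts_inner u \<longleftrightarrow> (\<exists>w\<in>unitaries B. cstar w * u \<in> C)"

lemma acts_inner_one: "acts_inner 1"
  unfolding acts_inner_def by (rule bexI[of _ 1]) (auto simp: unitaries_def B_intros C_intros)

lemma acts_inner_cstar:
  assumes "acts_inner u"
  shows "acts_inner (cstar u)"
proof -
  obtain w where w: "w \<in> B" "cstar w * w = 1" "w * cstar w = 1" and c: "cstar w * u \<in> C"
    using assms by (auto simp: acts_inner_def unitaries_def)
  have "cstar (cstar w * u) \<in> C" using c by (rule C_intros)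
  then have cu: "cstar u * w \<in> C" by simp
  have "w * cstar u = w * (cstar u * w) * cstar w" by (simp add: mult.assoc w)
  also have "\<dots> = cstar u * w * (w * cstar w)"
    unfolding C_commute[OF cu w(1), symmetric] by (simp only: mult.assoc)
  finally have "cstar (cstar w) * cstar u \<in> C" using cu by (simp add: w)
  then show ?thesis unfolding acts_inner_def using w by (intro bexI[of _ "cstar w"]) (auto simp: unitaries_def B_intros)
qed

text \<open>An intertwiner \<open>y\<close> in \<open>B\<close> between the identity and \<open>Ad u\<close> is a multiple of a unitary, because
  \<open>cstar y * y\<close> and \<open>y * cstar y\<close> are central in the simple algebra \<open>B\<close>.\<close>

lemma acts_inner_of_intertwiner:
  assumes u: "u \<in> \<N>" and y: "y \<in> B" "y \<noteq> 0" and int: "\<And>b. b \<in> B \<Longrightarrow> y * b = u * b * cstar u * y"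
  shows "acts_inner u"
proof -
  have ys: "b * cstar y = cstar y * (u * b * cstar u)" if "b \<in> B" for b
    using arg_cong[OF int[of "cstar b"], of cstar] that by (simp add: B_intros mult.assoc)
  have 1: "cstar y * y * b = b * (cstar y * y)" if b: "b \<in> B" for b
  proof -
    have "cstar y * y * b = cstar y * (u * b * cstar u) * y" using int[OF b] by (simp add: mult.assoc)
    also have "\<dots> = b * (cstar y * y)" using ys[OF b] by (simp add: mult.assoc[symmetric])
    finally show ?thesis .
  qed
  have 2: "y * cstar y * d = d * (y * cstar y)" if d: "d \<in> B" for d
  proof -
    define b where "b = cstar u * d * u"
    have b: "b \<in> B" "u * b * cstar u = d" using u d normalizer_B' by (simp_all add: b_def mult.assoc normalizer_unitary)
    have "y * cstar y * d = y * (cstar y * (u * b * cstar u))" unfolding b(2) by (simp only: mult.assoc)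
    also have "\<dots> = y * b * cstar y" unfolding ys[OF b(1), symmetric] by (simp only: mult.assoc)
    also have "\<dots> = d * (y * cstar y)" unfolding int[OF b(1)] b(2) by (simp only: mult.assoc)
    finally show ?thesis .
  qed
  obtain c where c: "cstar y * y = scaleC c 1"
    using center_scalar[OF subalg simple _ 1] y by (auto simp: scalars_def B_intros)
  obtain d where d: "y * cstar y = scaleC d 1"
    using center_scalar[OF subalg simple _ 2] y by (auto simp: scalars_def B_intros)
  have "cstar y * y = (norm y)\<^sup>2 *\<^sub>R 1" using c by (intro cstar_mult_projection) auto
  moreover have "cstar (cstar y) * cstar y = (norm (cstar y))\<^sup>2 *\<^sub>R 1"
    using d by (intro cstar_mult_projection) auto
  ultimately have yy: "cstar y * y = (norm y)\<^sup>2 *\<^sub>R 1" "y * cstar y = (norm y)\<^sup>2 *\<^sub>R 1" by simp_all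
  define w where "w = (1 / norm y) *\<^sub>R y"
  have w: "cstar w * w = 1" "w * cstar w = 1" "w \<in> B"
    using y yy by (auto simp: w_def power2_eq_square B_intros)
  have wint: "w * b = u * b * cstar u * w" if "b \<in> B" for b using int[OF that] by (simp add: w_def)
  have "cstar w * u * b = b * (cstar w * u)" if b: "b \<in> B" for b
  proof -
    have "cstar w * (u * b * cstar u * w) * cstar w * u = cstar w * u * b * (cstar u * ((w * cstar w) * u))"
      by (simp only: mult.assoc)
    then have "cstar w * u * b = cstar w * (u * b * cstar u * w) * cstar w * u"
      using u w(2) by (simp add: normalizer_unitary)
    also have "\<dots> = (cstar w * w) * b * (cstar w * u)" unfolding wint[OF b, symmetric] by (simp add: mult.assoc)
    finally show ?thesis by (simp add: w)
  qed
  then have "cstar w * u \<in> C" by (simp add: centralizer_in_def)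
  then show ?thesis using w by (auto simp: acts_inner_def unitaries_def)
qed

text \<open>\<open>E (u * c)\<close> lies in \<open>B\<close> and intertwines the identity with
  conjugation by \<open>u\<close>, so it cannot be nonzero when \<open>u\<close> is outer. This
  holds for every expectation onto \<open>B\<close>, and is used for \<open>E\<close> and for
  \<open>F\<close> alike.\<close>

lemma E_outer:
  assumes u: "u \<in> \<N>" "\<not> acts_inner u" and c: "c \<in> C"
  shows "E (u * c) = 0"
proof (rule ccontr)
  assume nz: "E (u * c) \<noteq> 0"
  have "E (u * c) * b = u * b * cstar u * E (u * c)" if b: "b \<in> B" for b
  proof -
    have "E (u * c) * b = E (u * c * b)" using E_right[OF b] by simp
    also have "u * c * b = u * b * cstar u * (u * c)"
      using C_commute[OF c b] u by (simp add: mult.assoc)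
    also have "E (u * b * cstar u * (u * c)) = u * b * cstar u * E (u * c)"
      using normalizer_B[OF u(1) b] by (rule E_left)
    finally show ?thesis .
  qed
  then have "acts_inner u" using u nz by (intro acts_inner_of_intertwiner[OF u(1) E_in])
  then show False using u by simp
qed

lemma E_outer':
  assumes u: "u \<in> \<N>" "\<not> acts_inner u" and c: "c \<in> C" "d \<in> C"
  shows "E (c * u * d) = 0"
proof -
  have "c * u * d = u * ((cstar u * c * u) * d)" using u by (simp add: mult.assoc)
  then show ?thesis using E_outer[OF u, of "cstar u * c * u * d"] normalizer_C'[OF u(1)] c
    by (simp add: C_intros)
qed

end

context qexp_simple
begin

text \<open>Normalizers from different classes are orthonormal by \<open>E_outer\<close>, and here
  each term \<open>cstar (c i) * c i\<close> in the Bessel inequality is 1, so the norm of the index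
  bounds the size of a pairwise inequivalent set. A largest such set meets every class.\<close>

lemma coset_representatives:
  "\<exists>G. finite G \<and> G \<subseteq> \<N> \<and> (\<forall>u\<in>G. \<forall>v\<in>G. u \<noteq> v \<longrightarrow> \<not> acts_inner (cstar u * v)) \<and>
     (\<forall>v\<in>\<N>. \<exists>u\<in>G. acts_inner (cstar u * v))"
proof -
  define Q where "Q G \<longleftrightarrow> finite G \<and> G \<subseteq> \<N> \<and> (\<forall>u\<in>G. \<forall>v\<in>G. u \<noteq> v \<longrightarrow> \<not> acts_inner (cstar u * v))" for G
  let ?I = "\<Sum>l\<in>L. l * cstar l"
  obtain b where b: "norm ?I < real b" using reals_Archimedean2 by blast
  have "card G < b" if Q: "Q G" for G
  proof -
    have "E (cstar u * cstar (cstar v)) = (if u = v then 1 else 0)" if "u \<in> G" "v \<in> G" for u v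
      using E_outer[of "cstar u * v" 1] Q that
      by (auto simp: Q_def normalizer_unitary C_intros normalizer_mult normalizer_cstar subset_iff)
    then have "cpos (?I - (\<Sum>u\<in>G. cstar (cstar u) * cstar u))"
      using Q by (intro bessel) (auto simp: Q_def)
    moreover have "(\<Sum>u\<in>G. cstar (cstar u) * cstar u) = (\<Sum>u\<in>G. 1)"
      using Q by (intro sum.cong) (auto simp: Q_def normalizer_unitary subset_iff)
    ultimately have "cpos (?I - of_real (real (card G)))" by simp
    then have "real (card G) \<le> norm ?I" by (rule le_norm_of_cpos_diff) simp
    then show ?thesis using b by linarith
  qed
  then have "\<forall>G. Q G \<longrightarrow> card G < b" by blast
  moreover have "Q {}" by (simp add: Q_def)
  ultimately have "\<exists>G. Q G \<and> (\<forall>G'. Q G' \<longrightarrow> card G' \<le> card G)" by (intro ex_has_greatest_nat)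
  then obtain G where G: "Q G" and max: "\<And>G'. Q G' \<Longrightarrow> card G' \<le> card G" by blast
  have "\<exists>u\<in>G. acts_inner (cstar u * v)" if v: "v \<in> \<N>" for v
  proof (rule ccontr)
    assume none: "\<not> ?thesis"
    have "v \<notin> G" using none acts_inner_one normalizer_unitary[OF v] by metis
    moreover have "\<not> acts_inner (cstar v * u)" if "u \<in> G" for u
    proof
      assume "acts_inner (cstar v * u)"
      from acts_inner_cstar[OF this] show False using none that by simp
    qed
    then have "Q (insert v G)" using G none v by (auto simp: Q_def)
    ultimately show False using max[of "insert v G"] G by (simp add: Q_def)
  qed
  then have "\<forall>v\<in>\<N>. \<exists>u\<in>G. acts_inner (cstar u * v)" by blast
  with G show ?thesis unfolding Q_def by (intro exI[of _ G] conjI) simp_all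
qed

end

section \<open>The minimal expectation\<close>

locale regular_exp = qexp_simple B E L for B :: "'a::unital_cstar_algebra set" and E L +
  assumes simpleA: "cstar_simple (UNIV :: 'a set)" and regular: "regular_inclusion UNIV B"
begin

text \<open>The index of the unnormalised trace of \<open>C\<close> is fixed by all normalizers, hence central in the
  simple algebra \<open>A\<close>; so all blocks of \<open>C\<close> have the same size.\<close>

lemma uniform_matrix_units_exist: "\<exists>P cl e N K n. uniform_matrix_units C P cl e N K n"
proof -
  obtain P where part: "minimal_partition C P" using minimal_partition_exists[OF C_subalg order_refl] by blast
  obtain cl e where "matrix_units C P cl e" using matrix_units_exist[OF C_subalg part] by blast
  then interpret M: matrix_units C P cl e .
  define z where "z = (\<Sum>(p, q)\<in>M.R. e p q * e q p)"
  define n where "n p = card {q \<in> P. cl q = cl p}" for p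
  have z: "z = (\<Sum>p\<in>P. real (n p) *\<^sub>R p)" by (simp add: z_def n_def M.index_eq)
  have zs: "cstar z = z" by (simp add: z M.P_sa)
  have "u * z = z * u" if u: "u \<in> \<N>" for u
  proof -
    have "u * z * cstar u = z"
      unfolding z_def using u by (intro M.index_unitary_conj) (simp_all add: normalizer_unitary normalizer_C normalizer_C')
    then have "z * u = u * z * cstar u * u" by simp
    then show ?thesis using u by (simp add: mult.assoc normalizer_unitary)
  qed
  then have "cstar_generated \<N> \<subseteq> centralizer_in UNIV {z}"
    using zs by (intro generated_minimal cstar_subalgebra_centralizer) (auto simp: centralizer_in_def)
  then have "x \<in> centralizer_in UNIV {z}" for x using regular by (auto simp: regular_inclusion_def)
  then have "z * x = x * z" for x by (simp add: centralizer_in_def)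
  then obtain c where c: "z = scaleC c 1"
    using center_scalar[OF cstar_subalgebra_UNIV simpleA, of z] by (auto simp: scalars_def)
  have nc: "complex_of_real (real (n p)) = c" if p: "p \<in> P" for p
  proof -
    have "z * p = (\<Sum>q\<in>P. if q = p then real (n p) *\<^sub>R p else 0)"
      unfolding z sum_distrib_right using M.P_orth M.P_idem p by (intro sum.cong) auto
    then have "scaleC c p = scaleC (complex_of_real (real (n p))) p"
      unfolding scaleC_of_real using p by (simp add: c)
    then show ?thesis using M.P_ne[OF p] by auto
  qed
  have ne: "P \<noteq> {}" using M.P_sum by auto
  then obtain p0 where p0: "p0 \<in> P" by blast
  have "card {q \<in> P. cl q = cl p} = n p0" if "p \<in> P" for p
    using nc[OF that] nc[OF p0] unfolding n_def by (metis of_nat_eq_iff of_real_of_nat_eq)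
  from equal_blocks_enumeration[OF M.fin ne this]
  obtain N K where "n p0 > 0" "bij_betw N P {..<K * n p0}"
    "\<forall>p\<in>P. \<forall>q\<in>P. cl p = cl q \<longleftrightarrow> N p div n p0 = N q div n p0" by blast
  then have "uniform_matrix_units C P cl e N K (n p0)" by unfold_locales auto
  then show ?thesis by blast
qed

end

locale traced_exp = regular_exp B E L + M: uniform_matrix_units "centralizer_in UNIV B" P cl e N K n
  for B :: "'a::unital_cstar_algebra set" and E L P cl e N K n
begin

lemma T_normalizer: "u \<in> \<N> \<Longrightarrow> x \<in> C \<Longrightarrow> M.T (u * x * cstar u) = M.T x"
  by (intro M.T_unitary_conj) (simp_all add: normalizer_unitary normalizer_C normalizer_C')

text \<open>With \<open>\<rho>\<close> the density of \<open>\<tau>\<close> relative to the trace, \<open>a\<close> is the inverse square root of \<open>m * \<rho>\<close>.\<close>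

lemma density:
  "\<exists>a b. a \<in> C \<and> cstar a = a \<and> a * b = 1 \<and> b * a = 1 \<and>
    (\<forall>x\<in>C. \<tau> (a * x * a) = M.T x / of_nat M.m) \<and> (a * a = 1 \<longrightarrow> a = 1)"
proof -
  \<comment> \<open>The indices are transposed so that \<open>M.T (\<rho> * e q p)\<close> is
    \<open>\<tau> (e q p)\<close>.\<close>
  define \<rho> where "\<rho> = M.umat (\<lambda>p q. \<tau> (e q p))"
  have \<rho>C: "\<rho> \<in> C" by (simp add: \<rho>_def M.umat_in)
  have \<rho>: "M.T (\<rho> * x) = \<tau> x" if x: "x \<in> C" for x
  proof -
    have eC: "e q p \<in> C" if "(p, q) \<in> M.R" for p q using that by (auto simp: M.R_def M.e_in)
    have "\<tau> x = \<tau> (\<Sum>(p, q)\<in>M.R. scaleC (M.T (x * e p q)) (e q p))" using M.expand[OF x] by simp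
    also have "\<dots> = (\<Sum>(p, q)\<in>M.R. M.T (x * e p q) * \<tau> (e q p))"
      using eC by (simp add: \<tau>_sum \<tau>_scaleC C_intros split_beta)
    also have "\<dots> = (\<Sum>(p, q)\<in>M.R. \<tau> (e q p) * M.T (e p q * x))"
      using M.T_commute[OF M.e_in_R x] by (intro sum.cong refl) (auto simp: mult.commute)
    also have "\<dots> = M.T (\<rho> * x)" unfolding \<rho>_def by (rule M.T_umat_mult[OF x, symmetric])
    finally show ?thesis ..
  qed
  have \<rho>s: "cstar \<rho> = \<rho>"
  proof (rule M.eq_by_entries)
    fix p q assume pq: "p \<in> P" "q \<in> P" "cl p = cl q"
    then show "p * cstar \<rho> * q = p * \<rho> * q"
      using \<tau>_cstar[OF M.e_in[of p q]] by (simp add: \<rho>_def M.cstar_umat M.entry_umat M.e_cstar)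
  qed (use \<rho>C in \<open>auto intro: C_intros\<close>)
  \<comment> \<open>Spectral decomposition of \<rho>: it is central in its commutant
    \<open>D\<close>, so a minimal partition of \<open>D\<close> consists of
    eigenprojections.\<close>
  define D where "D = C \<inter> centralizer_in UNIV {\<rho>}"
  have D: "cstar_subalgebra D"
    unfolding D_def using \<rho>s by (intro cstar_subalgebra_Int C_subalg cstar_subalgebra_centralizer) auto
  then obtain Q where Q: "minimal_partition D Q" using minimal_partition_exists[of D] by (auto simp: D_def)
  have Q1: "finite Q" "\<Sum>Q = 1" and QD: "\<And>q. q \<in> Q \<Longrightarrow> q \<in> D"
    and Q2: "\<And>q. q \<in> Q \<Longrightarrow> q \<noteq> 0" "\<And>q. q \<in> Q \<Longrightarrow> cstar q = q" "\<And>q. q \<in> Q \<Longrightarrow> q * q = q"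
    and Q3: "\<And>p q. p \<in> Q \<Longrightarrow> q \<in> Q \<Longrightarrow> p \<noteq> q \<Longrightarrow> p * q = 0"
    and Q4: "\<And>q x. q \<in> Q \<Longrightarrow> x \<in> D \<Longrightarrow> \<exists>c. q * x * q = scaleC c q"
    using Q by (auto simp: minimal_partition_def)
  have QC: "q \<in> C" and Q\<rho>: "q * \<rho> = \<rho> * q" if "q \<in> Q" for q
    using QD[OF that] by (auto simp: D_def centralizer_in_def)
  have "\<exists>r>0. \<rho> * q = r *\<^sub>R q" if q: "q \<in> Q" for q
  proof -
    have "\<rho> \<in> D" using \<rho>C by (simp add: D_def centralizer_in_def)
    then obtain c where "q * \<rho> * q = scaleC c q" using Q4[OF q] by blast
    then have c: "\<rho> * q = scaleC c q" using Q\<rho>[OF q] Q2[OF q] by (simp add: mult.assoc)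
    obtain s where s: "s > 0" "\<tau> (q * cstar q) = complex_of_real s" using \<tau>_pos QC[OF q] Q2(1)[OF q] by blast
    obtain r where r: "r \<ge> 0" "M.T (q * cstar q) = complex_of_real r" using M.T_nonneg QC[OF q] by blast
    \<comment> \<open>The eigenvalue is the quotient of \<open>\<tau> q\<close>, positive by
      faithfulness, and the nonnegative trace of \<open>q\<close>; hence it is positive.\<close>
    have "complex_of_real s = M.T (\<rho> * q)" using \<rho>[OF QC[OF q]] s Q2 q by simp
    also have "\<dots> = c * complex_of_real r" using r QC q Q2 by (simp add: c M.T_scaleC)
    finally have sc: "complex_of_real s = c * complex_of_real r" .
    then have "r \<noteq> 0" using s by auto
    then have "c = complex_of_real (s / r)" using sc by (simp add: field_simps)
    then have "\<rho> * q = (s / r) *\<^sub>R q" by (simp only: c scaleC_of_real)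
    then show ?thesis using s r \<open>r \<noteq> 0\<close> by (intro exI[of _ "s / r"]) simp
  qed
  then obtain r where r: "\<And>q. q \<in> Q \<Longrightarrow> r q > 0" "\<And>q. q \<in> Q \<Longrightarrow> \<rho> * q = r q *\<^sub>R q" by metis
  \<comment> \<open>\<open>S f\<close> is functional calculus in \<rho>, with \<open>f\<close> given
    on the eigenprojections.\<close>
  define S where "S f = (\<Sum>q\<in>Q. f q *\<^sub>R q)" for f :: "'a \<Rightarrow> real"
  have Sq: "S f * q = f q *\<^sub>R q" if "q \<in> Q" for f q
  proof -
    have "S f * q = (\<Sum>p\<in>Q. if p = q then f q *\<^sub>R q else 0)"
      unfolding S_def sum_distrib_right using that Q2 Q3 by (intro sum.cong) auto
    then show ?thesis using that Q1 by simp
  qed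
  have SS: "S f * S g = S (\<lambda>q. f q * g q)" for f g
  proof -
    have "S f * S g = (\<Sum>q\<in>Q. g q *\<^sub>R (S f * q))" unfolding S_def[of g] by (simp add: sum_distrib_left)
    also have "\<dots> = S (\<lambda>q. f q * g q)" unfolding S_def[of "\<lambda>q. f q * g q"]
      by (intro sum.cong refl) (simp add: Sq mult.commute)
    finally show ?thesis .
  qed
  have S1: "S f = of_real c" if "\<And>q. q \<in> Q \<Longrightarrow> f q = c" for f c
  proof -
    have "S f = (\<Sum>q\<in>Q. c *\<^sub>R q)" unfolding S_def using that by (intro sum.cong) auto
    then show ?thesis by (simp only: scaleR_sum_right[symmetric] Q1 of_real_def)
  qed
  have SC: "S f \<in> C" for f unfolding S_def using QC by (auto intro!: C_intros)
  have \<rho>S: "\<rho> = S r"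
  proof -
    have "\<rho> = \<rho> * \<Sum>Q" by (simp add: Q1)
    then show ?thesis using r(2) by (simp add: sum_distrib_left S_def)
  qed
  define m where "m = real M.m"
  have m: "m > 0" using M.m0 by (simp add: m_def)
  define a where "a = S (\<lambda>q. 1 / sqrt (m * r q))"
  define b where "b = S (\<lambda>q. sqrt (m * r q))"
  have pos: "m * r q > 0" if "q \<in> Q" for q using m r(1)[OF that] by simp
  have aC: "a \<in> C" by (simp add: a_def SC)
  have sq: "sqrt (m * r q) \<noteq> 0" if "q \<in> Q" for q using m r(1)[OF that] by simp
  have "a * b = of_real 1" unfolding a_def b_def SS by (rule S1) (use sq in simp)
  moreover have "b * a = of_real 1" unfolding a_def b_def SS by (rule S1) (use sq in simp)
  ultimately have ab: "a * b = 1" "b * a = 1" by simp_all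
  have as: "cstar a = a" by (simp add: a_def S_def Q2)
  have a\<rho>a: "a * \<rho> * a = of_real (1 / m)"
    unfolding a_def \<rho>S SS
  proof (rule S1)
    fix q assume "q \<in> Q"
    then have "sqrt (m * r q) * sqrt (m * r q) = m * r q" "r q > 0" using pos r by (simp_all add: less_imp_le)
    then show "1 / sqrt (m * r q) * r q * (1 / sqrt (m * r q)) = 1 / m" using m by (simp add: field_simps)
  qed
  have "\<tau> (a * x * a) = M.T x / of_nat M.m" if x: "x \<in> C" for x
  proof -
    have "\<tau> (a * x * a) = M.T ((\<rho> * a * x) * a)" using \<rho>[of "a * x * a"] aC x by (simp add: C_intros mult.assoc)
    also have "\<dots> = M.T (a * (\<rho> * a * x))" using aC x \<rho>C by (intro M.T_commute) (auto intro!: C_intros)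
    also have "a * (\<rho> * a * x) = (1 / m) *\<^sub>R x"
      using a\<rho>a by (simp only: mult.assoc[symmetric]) (simp add: of_real_def)
    finally show ?thesis using x by (simp add: M.T_scaleR m_def)
  qed
  \<comment> \<open>The coefficients of \<open>a\<close> are positive and so are determined by their
    squares.\<close>
  moreover have "a = 1" if "a * a = 1"
  proof -
    have "S (\<lambda>q. 1 / sqrt (m * r q)) = of_real 1"
    proof (rule S1)
      fix q assume q: "q \<in> Q"
      have "q = (a * a) * q" using that by simp
      also have "\<dots> = (1 / (m * r q)) *\<^sub>R q"
        unfolding a_def SS using q pos[OF q] by (simp add: Sq real_sqrt_mult_self)
      finally have "(1 / (m * r q)) *\<^sub>R q = 1 *\<^sub>R q" by simp
      then have "1 / (m * r q) = 1" using Q2(1)[OF q] by (simp only: scaleR_cancel_right) simp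
      then show "1 / sqrt (m * r q) = 1" by (simp add: divide_eq_1_iff)
    qed
    then show ?thesis by (simp add: a_def)
  qed
  ultimately show ?thesis using aC as ab by blast
qed

end

text \<open>\<open>F\<close> is the competitor in the minimality argument.\<close>

locale trace_exp = traced_exp B E L P cl e N K n
  for B :: "'a::unital_cstar_algebra set" and E L P cl e N K n +
  fixes a b :: 'a
  assumes a: "a \<in> C" "cstar a = a" "a * b = 1" "b * a = 1"
    and \<tau>_a: "x \<in> C \<Longrightarrow> \<tau> (a * x * a) = M.T x / of_nat M.m"
    and a_one: "a * a = 1 \<Longrightarrow> a = 1"
begin

definition F where "F x = E (a * x * a)"

lemma F_C: "x \<in> C \<Longrightarrow> F x = scaleC (M.T x / of_nat M.m) 1"
  unfolding F_def using a by (subst E_C) (simp_all add: \<tau>_a C_intros)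

lemma F_one: "F 1 = 1"
proof -
  have "M.T 1 / of_nat M.m = 1" using M.T_one M.card_P M.m0 by simp
  then show ?thesis using F_C[of 1] by (simp add: C_intros scaleC_of_real[of 1, simplified])
qed

lemma F_left: "b' \<in> B \<Longrightarrow> F (b' * x) = b' * F x"
  unfolding F_def using C_commute[OF a(1), of b'] E_left[of b' "a * x * a"]
  by (simp add: mult.assoc[symmetric])

lemma F_right: "b' \<in> B \<Longrightarrow> F (x * b') = F x * b'"
  unfolding F_def using C_commute[OF a(1), of b'] E_right[of b' "a * x * a"]
  by (simp add: mult.assoc)

text \<open>\<open>F\<close> is positive because \<open>a\<close> is self-adjoint,
  \<open>B\<close>-bilinear because \<open>a\<close> commutes with \<open>B\<close>, and unital
  because on \<open>C\<close> it is the normalised trace.\<close>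

lemma F_cexp: "cond_expectation UNIV B F"
  unfolding cond_expectation_def
proof (intro conjI ballI allI)
  show "F (x + y) = F x + F y" "F (scaleC c x) = scaleC c (F x)" for x y c
    by (simp_all add: F_def distrib_left distrib_right E_add E_scaleC)
  show "F x = x" if "x \<in> B" for x using F_left[OF that, of 1] by (simp add: F_one)
  show "F x \<in> cstar_pos B" if x: "x \<in> cstar_pos UNIV" for x
  proof -
    obtain y where y: "x = cstar y * y" using x by (auto simp: cstar_pos_def)
    have "a * x * a = cstar (y * a) * (y * a)" by (simp add: y a mult.assoc)
    then have "a * x * a \<in> cstar_pos UNIV" unfolding cstar_pos_def by blast
    then show ?thesis using cexp by (auto simp: F_def cond_expectation_def)
  qed
qed (auto simp: F_def F_left[unfolded F_def] F_right[unfolded F_def])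

sublocale F: cexp_simple B F
  using subalg F_cexp simple by unfold_locales

abbreviation d where "d \<equiv> M.m * n"

text \<open>Orthonormality combines that of the \<open>M.W k\<close> within a coset with
  \<open>F.E_outer'\<close> between cosets. The expansion is linear and continuous in
  \<open>x\<close>, so by regularity it is enough to verify it for normalizers.\<close>

lemma basis:
  assumes G: "finite G" "G \<subseteq> \<N>" "\<And>u v. u \<in> G \<Longrightarrow> v \<in> G \<Longrightarrow> u \<noteq> v \<Longrightarrow> \<not> acts_inner (cstar u * v)"
    "\<And>v. v \<in> \<N> \<Longrightarrow> \<exists>u\<in>G. acts_inner (cstar u * v)"
  defines "\<Lambda> \<equiv> (\<lambda>(u, k). u * M.W k) ` (G \<times> {..<d})"
  shows "unitary_orthonormal_quasi_basis UNIV B F \<Lambda>"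
proof -
  let ?f = "\<lambda>(u, k). u * M.W k"
  note W = M.W_unitary_left M.W_unitary_right M.W_in
  have orth: "F (cstar (u * M.W k) * (v * M.W l)) = (if u = v \<and> k = l then 1 else 0)"
    if uv: "u \<in> G" "v \<in> G" and kl: "k < d" "l < d" for u v k l
  proof (cases "u = v")
    case True
    have "cstar (u * M.W k) * (v * M.W l) = cstar (M.W k) * M.W l"
      using uv G(2) True by (simp add: mult.assoc subset_iff)
    then show ?thesis
      using True kl M.W_orthonormal[OF kl] M.m0 by (simp add: F_C C_intros W scaleC_of_real[of 1, simplified])
  next
    case False
    have "cstar u * v \<in> \<N>" using uv G(2) by (auto intro: normalizer_mult normalizer_cstar)
    moreover have "\<not> acts_inner (cstar u * v)" using G(3) uv False by blast
    ultimately have "F (cstar (M.W k) * (cstar u * v) * M.W l) = 0"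
      by (intro F.E_outer') (auto intro: C_intros W)
    then show ?thesis using False by (simp add: mult.assoc)
  qed
  have one_ne: "(1::'a) \<noteq> 0" by simp
  \<comment> \<open>A quasi-basis is a set, so distinct indices must give distinct products; a
    coincidence would make an inner product both 1 and 0.\<close>
  have inj: "inj_on ?f (G \<times> {..<d})"
  proof (rule inj_onI, clarify)
    fix u k v l assume uv: "u \<in> G" "v \<in> G" "k < d" "l < d" and eq: "u * M.W k = v * M.W l"
    have "F (cstar (u * M.W k) * (v * M.W l)) = 1" using orth[of u u k k] uv eq by simp
    then show "u = v \<and> k = l" using orth[of u v k l] uv one_ne by metis
  qed
  have "x = (\<Sum>y\<in>\<Lambda>. F (x * y) * cstar y)" for x
  proof -
    define Pr where "Pr x = (\<Sum>(u, k)\<in>G \<times> {..<d}. F (x * (u * M.W k)) * cstar (u * M.W k))" for x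
    have bl: "bounded_linear Pr"
      unfolding Pr_def split_beta
      by (intro bounded_linear_sum bounded_linear_compose[OF bounded_linear_mult_left]
          bounded_linear_compose[OF F.E_bounded_linear] bounded_linear_mult_left)
    have sc: "Pr (scaleC c x) = scaleC c (Pr x)" for c x
      by (simp add: Pr_def split_beta F.E_scaleC cvs.scale_sum_right)
    let ?X = "{x. Pr x = x}"
    have "closed ?X"
      by (intro closed_Collect_eq continuous_intros linear_continuous_on bl)
    moreover have "cvs.subspace ?X"
      by (rule cvs.subspaceI) (simp_all add: sc linear_simps[OF bl])
    moreover have "\<N> \<subseteq> ?X"
    proof
      fix v assume v: "v \<in> \<N>"
      \<comment> \<open>The coset of \<open>cstar v\<close> is the relevant one since basis elements
        multiply on the right: with this \<open>u\<close> the product \<open>v * u\<close> lies in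
        \<open>B * C\<close>.\<close>
      then obtain u where u: "u \<in> G" "acts_inner (cstar u * cstar v)" using G(4) normalizer_cstar by blast
      then obtain w where w: "w \<in> B" "cstar w * w = 1" "w * cstar w = 1" and c: "cstar w * (cstar u * cstar v) \<in> C"
        by (auto simp: acts_inner_def unitaries_def)
      define c where "c = cstar (cstar w * (cstar u * cstar v))"
      have cC: "c \<in> C" unfolding c_def using c by (rule C_intros)
      have uN: "u \<in> \<N>" using u G by blast
      have cw: "c * cstar w = cstar w * c" using C_commute[OF cC] w(1) by (simp add: B_intros)
      have "v = c * cstar w * cstar u"
      proof -
        have "c * cstar w * cstar u = v * (u * (w * cstar w) * cstar u)" by (simp add: c_def mult.assoc)
        then show ?thesis by (simp add: w uN normalizer_unitary)
      qed
      then have vcw: "v = cstar w * c * cstar u" by (simp add: cw)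
      have t0: "F (v * (u' * M.W k)) * cstar (u' * M.W k) = 0" if u': "u' \<in> G" "u' \<noteq> u" for u' k
      proof -
        have "cstar u * u' \<in> \<N>" using u' u G(2) by (auto intro: normalizer_mult normalizer_cstar)
        moreover have "\<not> acts_inner (cstar u * u')" using G(3) u' u by blast
        ultimately have "F (c * (cstar u * u') * M.W k) = 0" by (intro F.E_outer' cC W)
        moreover have "F (v * (u' * M.W k)) = cstar w * F (c * (cstar u * u') * M.W k)"
          using F_left[of "cstar w" "c * (cstar u * u') * M.W k"] w by (simp add: vcw mult.assoc B_intros)
        ultimately show ?thesis by simp
      qed
      have t1: "F (v * (u * M.W k)) * cstar (u * M.W k) =
          cstar w * scaleC (M.T (c * M.W k) / of_nat M.m) (cstar (M.W k)) * cstar u" for k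
      proof -
        have "F (v * (u * M.W k)) = cstar w * F (c * M.W k)"
          using F_left[of "cstar w" "c * M.W k"] w uN by (simp add: vcw mult.assoc B_intros)
        then show ?thesis by (simp add: F_C cC W C_intros mult.assoc)
      qed
      have "Pr v = (\<Sum>u'\<in>G. \<Sum>k<d. F (v * (u' * M.W k)) * cstar (u' * M.W k))"
        unfolding Pr_def by (rule sum.cartesian_product[symmetric])
      also have "\<dots> = (\<Sum>u'\<in>G. if u' = u then \<Sum>k<d. F (v * (u * M.W k)) * cstar (u * M.W k) else 0)"
        using t0 by (intro sum.cong refl) (auto simp del: cstar_mult)
      also have "\<dots> = (\<Sum>k<d. F (v * (u * M.W k)) * cstar (u * M.W k))" using u G(1) by simp
      also have "\<dots> = cstar w * (\<Sum>k<d. scaleC (M.T (c * M.W k) / of_nat M.m) (cstar (M.W k))) * cstar u"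
        by (simp only: t1 sum_distrib_left sum_distrib_right)
      also have "\<dots> = v" using M.W_expand[OF cC] by (simp add: vcw)
      finally show "v \<in> ?X" by simp
    qed
    ultimately have "cstar_generated \<N> \<subseteq> ?X"
      by (intro generated_dense normalizer_one normalizer_mult normalizer_cstar)
    then have "Pr x = x" using regular by (auto simp: regular_inclusion_def)
    moreover have "(\<Sum>y\<in>\<Lambda>. F (x * y) * cstar y) = (\<Sum>i\<in>G \<times> {..<d}. F (x * ?f i) * cstar (?f i))"
      unfolding \<Lambda>_def by (simp only: sum.reindex[OF inj] o_def)
    ultimately show ?thesis by (simp add: Pr_def split_beta)
  qed
  moreover have "finite \<Lambda>" using G by (simp add: \<Lambda>_def)
  ultimately have "quasi_basis UNIV B F \<Lambda>" using F_cexp by (simp add: quasi_basis_def)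
  moreover have "orthonormal_for F \<Lambda>"
    unfolding orthonormal_for_def
  proof (intro ballI)
    fix x y assume "x \<in> \<Lambda>" "y \<in> \<Lambda>"
    then obtain u k v l where "x = u * M.W k" "y = v * M.W l" "u \<in> G" "v \<in> G" "k < d" "l < d"
      by (auto simp: \<Lambda>_def)
    then show "F (cstar x * y) = (if x = y then 1 else 0)"
      using orth[of u v k l] inj_onD[OF inj, of "(u, k)" "(v, l)"] by (auto simp del: cstar_mult)
  qed
  moreover have "\<Lambda> \<subseteq> unitaries UNIV"
  proof
    fix x assume "x \<in> \<Lambda>"
    then obtain u k where x: "x = u * M.W k" "u \<in> G" by (auto simp: \<Lambda>_def)
    have "u * M.W k * cstar (u * M.W k) = u * (M.W k * cstar (M.W k)) * cstar u"
      "cstar (u * M.W k) * (u * M.W k) = cstar (M.W k) * (cstar u * u) * M.W k" by (simp_all add: mult.assoc)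
    then show "x \<in> unitaries UNIV" using x G(2) W by (simp add: unitaries_def normalizer_unitary subset_iff)
  qed
  ultimately show ?thesis by (simp add: unitary_orthonormal_quasi_basis_def)
qed

text \<open>The indices are compared through one system: \<Lambda> for \<open>F\<close> and its
  right multiples by \<open>a\<close> for \<open>E\<close>. Applying \<open>F\<close> to their
  difference gives \<open>card \<Lambda> * (1 - s)\<close>, with \<open>s\<close> the value of
  \<open>F\<close> at \<sigma>, so minimality yields \<open>s \<le> 1\<close>.\<close>

lemma minimal_imp_eq:
  assumes min: "minimal_cond_expectation UNIV B E"
    and G: "G \<subseteq> \<N>" and \<Lambda>: "\<Lambda> = (\<lambda>(u, k). u * M.W k) ` (G \<times> {..<d})"
    and basis: "unitary_orthonormal_quasi_basis UNIV B F \<Lambda>"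
  shows "F = E"
proof -
  have qF: "quasi_basis UNIV B F \<Lambda>" and un: "\<And>l. l \<in> \<Lambda> \<Longrightarrow> l * cstar l = 1"
    using basis by (auto simp: unitary_orthonormal_quasi_basis_def unitaries_def)
  have fin: "finite \<Lambda>" and exp: "x = (\<Sum>l\<in>\<Lambda>. F (x * l) * cstar l)" for x
    using qF by (auto simp: quasi_basis_def)
  define \<sigma> where "\<sigma> = a * a"
  have \<sigma>C: "\<sigma> \<in> C" "cstar \<sigma> = \<sigma>" using a by (simp_all add: \<sigma>_def C_intros)
  have inj: "inj_on (\<lambda>l. l * a) \<Lambda>"
    by (rule inj_onI) (metis a(3) mult.assoc mult_1_right)
  \<comment> \<open>Expand \<open>b * x\<close> for \<open>F\<close> and multiply by
    \<open>a\<close>. Since \<open>a\<close> commutes with \<open>B\<close>, the coefficient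
    \<open>F (b * x * l)\<close> turns into \<open>E (x * (l * a))\<close> and the factor
    \<open>a\<close> ends up beside \<open>cstar l\<close>.\<close>
  have "x = (\<Sum>l\<in>\<Lambda>. E (x * (l * a)) * cstar (l * a))" for x
  proof -
    have "a * (b * x) = a * (\<Sum>l\<in>\<Lambda>. F (b * x * l) * cstar l)" using exp[of "b * x"] by simp
    also have "\<dots> = (\<Sum>l\<in>\<Lambda>. E (x * (l * a)) * cstar (l * a))"
    proof -
      have "a * (F (b * x * l) * cstar l) = E (x * (l * a)) * cstar (l * a)" for l
      proof -
        have "a * (b * x * l) * a = x * (l * a)" using a(3) by (simp add: mult.assoc[symmetric])
        then have "a * F (b * x * l) = E (x * (l * a)) * a"
          unfolding F_def using C_commute[OF a(1), of "E (x * (l * a))"] by simp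
        then show ?thesis by (simp add: mult.assoc[symmetric] a(2))
      qed
      then show ?thesis by (simp only: sum_distrib_left)
    qed
    finally show ?thesis using a(3) by (simp add: mult.assoc[symmetric])
  qed
  then have qE: "quasi_basis UNIV B E ((\<lambda>l. l * a) ` \<Lambda>)"
    using cexp fin by (simp add: quasi_basis_def sum.reindex[OF inj])
  have iE: "watatani_index UNIV B E = (\<Sum>l\<in>\<Lambda>. l * \<sigma> * cstar l)"
    using watatani_index_eq[OF subalg qE] by (simp add: sum.reindex[OF inj] a(2) \<sigma>_def mult.assoc)
  have iF: "watatani_index UNIV B F = of_real (real (card \<Lambda>))"
    using watatani_index_eq[OF subalg qF] by (simp add: un)
  have "finite_index UNIV B F" using qF by (auto simp: finite_index_def)
  then have "cpos (watatani_index UNIV B F - watatani_index UNIV B E)"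
    using min cstar_pos_cpos by (auto simp: minimal_cond_expectation_def)
  from F.E_cpos[OF this] have pos: "cpos (F (of_real (real (card \<Lambda>)) - (\<Sum>l\<in>\<Lambda>. l * \<sigma> * cstar l)))"
    by (simp only: iE iF)
  obtain s where s: "M.T \<sigma> / of_nat M.m = complex_of_real s"
    using M.T_nonneg[OF a(1)] by (auto simp: \<sigma>_def a(2)) (metis of_real_divide of_real_of_nat_eq)
  \<comment> \<open>Neither factor of \<open>l = u * M.W k\<close> changes the trace:
    \<open>u\<close> is a normalizer and \<open>M.W k\<close> is a unitary of
    \<open>C\<close>.\<close>
  have F\<sigma>: "F (l * \<sigma> * cstar l) = of_real s" if l: "l \<in> \<Lambda>" for l
  proof -
    obtain u k where u: "u \<in> \<N>" "l = u * M.W k" using l \<Lambda> G by auto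
    have WC: "M.W k * \<sigma> * cstar (M.W k) \<in> C" by (auto intro!: C_intros \<sigma>C M.W_in)
    have "l * \<sigma> * cstar l = u * (M.W k * \<sigma> * cstar (M.W k)) * cstar u" by (simp add: u mult.assoc)
    then have "F (l * \<sigma> * cstar l) = scaleC (M.T (u * (M.W k * \<sigma> * cstar (M.W k)) * cstar u) / of_nat M.m) 1"
      using normalizer_C[OF u(1) WC] by (simp only: F_C)
    also have "M.T (u * (M.W k * \<sigma> * cstar (M.W k)) * cstar u) = M.T (M.W k * \<sigma> * cstar (M.W k))"
      by (rule T_normalizer[OF u(1) WC])
    also have "\<dots> = M.T (cstar (M.W k) * (M.W k * \<sigma>))"
      by (intro M.T_commute C_intros \<sigma>C M.W_in)
    also have "\<dots> = M.T \<sigma>" by (simp add: mult.assoc[symmetric] M.W_unitary_left)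
    finally show ?thesis by (simp only: s of_real_scaleC)
  qed
  have "cpos (of_real (real (card \<Lambda>) - real (card \<Lambda>) * s) :: 'a)"
    using pos by (simp add: F.E_diff F.E_sum F\<sigma> F.E_of_real[of "real (card \<Lambda>)", simplified])
  then have "real (card \<Lambda>) * s \<le> real (card \<Lambda>)" by (simp only: cpos_of_real_iff diff_ge_0_iff_ge)
  moreover have "card \<Lambda> > 0"
  proof -
    have "\<Lambda> \<noteq> {}" using exp[of 1] by auto
    then show ?thesis using fin by (simp add: card_gt_0_iff)
  qed
  ultimately have s1: "s \<le> 1" by simp
  have \<tau>\<sigma>: "\<tau> \<sigma> = 1" using \<tau>_a[of 1] M.T_one M.card_P M.m0 by (simp add: \<sigma>_def C_intros)
  have \<tau>\<sigma>\<sigma>: "\<tau> (\<sigma> * \<sigma>) = complex_of_real s"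
    using \<tau>_a[OF \<sigma>C(1)] s by (simp add: \<sigma>_def mult.assoc)
  \<comment> \<open>\<open>\<tau> \<sigma>\<close> is the value of \<open>F\<close> at 1 and
    \<open>\<tau> (\<sigma> * \<sigma>)\<close> its value at \<sigma>, so the result is
    \<open>1 - 2 + s\<close>, at most 0; faithfulness then forces
    \<open>\<sigma> = 1\<close>.\<close>
  have "\<tau> ((1 - \<sigma>) * cstar (1 - \<sigma>)) = \<tau> (1 - \<sigma> - \<sigma> + \<sigma> * \<sigma>)"
    by (simp add: \<sigma>C algebra_simps)
  also have "\<dots> = complex_of_real (s - 1)"
    by (simp add: \<tau>_add \<tau>_diff \<tau>\<sigma> \<tau>\<sigma>\<sigma> \<sigma>C C_intros)
  finally have t: "\<tau> ((1 - \<sigma>) * cstar (1 - \<sigma>)) = complex_of_real (s - 1)" .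
  have "1 - \<sigma> = 0"
  proof (rule ccontr)
    assume "1 - \<sigma> \<noteq> 0"
    then obtain r where "r > 0" "\<tau> ((1 - \<sigma>) * cstar (1 - \<sigma>)) = complex_of_real r"
      using \<tau>_pos[of "1 - \<sigma>"] \<sigma>C by (auto simp: C_intros)
    then have "complex_of_real r = complex_of_real (s - 1)" using t by (simp only:)
    then show False using \<open>r > 0\<close> s1 by (simp only: of_real_eq_iff)
  qed
  then have a1: "a = 1" using a_one by (simp add: \<sigma>_def)
  have "F x = E x" for x
  proof -
    have "F x = E (a * x * a)" by (rule F_def)
    also have "a * x * a = x" by (simp add: a1)
    finally show ?thesis .
  qed
  then show ?thesis by (rule ext)
qed

lemma basis_C:
  assumes FE: "F = E"
  shows "unitary_orthonormal_quasi_basis C scalars (restrict E C) (M.W ` {..<d})"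
proof -
  have FC: "E x = scaleC (M.T x / of_nat M.m) 1" if "x \<in> C" for x using F_C[OF that] FE by simp
  have sC: "scaleC c 1 \<in> C" for c by (intro C_intros)
  have orth: "E (cstar (M.W k) * M.W l) = (if k = l then 1 else 0)" if kl: "k < d" "l < d" for k l
    using M.W_orthonormal[OF kl] M.m0 M.W_in by (simp add: FC C_intros scaleC_of_real[of 1, simplified])
  have inj: "inj_on M.W {..<d}"
  proof (rule inj_onI)
    fix k l assume kl: "k \<in> {..<d}" "l \<in> {..<d}" and eq: "M.W k = M.W l"
    then have "E (cstar (M.W k) * M.W l) = 1" using orth[of k k] by simp
    then show "k = l" using orth[of k l] kl by (auto split: if_splits)
  qed
  have "cond_expectation C scalars (restrict E C)"
    unfolding cond_expectation_def
  proof (intro conjI ballI allI)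
    \<comment> \<open>Positivity has to be witnessed inside \<open>scalars\<close>: the nonnegative
      number \<open>r\<close> is \<open>cstar z * z\<close> for \<open>z\<close> its square
      root.\<close>
    show "restrict E C x \<in> cstar_pos scalars" if x: "x \<in> cstar_pos C" for x
    proof -
      obtain y where y: "y \<in> C" "x = cstar y * y" using x by (auto simp: cstar_pos_def)
      have xC: "x \<in> C" using y by (auto intro!: C_intros)
      obtain r where r: "r \<ge> 0" "\<tau> x = complex_of_real r"
        using \<tau>_cpos[OF xC] y cpos_cstar_mult by blast
      let ?z = "scaleC (complex_of_real (sqrt r)) (1::'a)"
      have "cstar ?z * ?z = scaleC (complex_of_real (sqrt r) * complex_of_real (sqrt r)) 1"
        by (simp add: scaleC_scaleC)
      also have "complex_of_real (sqrt r) * complex_of_real (sqrt r) = complex_of_real r"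
        using r(1) by (simp only: of_real_mult[symmetric] real_sqrt_mult_self abs_of_nonneg)
      also have "scaleC (complex_of_real r) (1::'a) = restrict E C x" using E_C[OF xC] r xC by simp
      finally have "restrict E C x = cstar ?z * ?z" ..
      then show ?thesis
        unfolding cstar_pos_def by (intro CollectI exI[of _ ?z] conjI scalar_imp_scalars)
    qed
    show "restrict E C ` C \<subseteq> scalars" using FC by (auto simp: scalars_def)
  qed (use sC in \<open>auto simp: scalars_def E_add E_scaleC C_intros\<close>)
  moreover have "x = (\<Sum>l\<in>M.W ` {..<d}. restrict E C (x * l) * cstar l)" if x: "x \<in> C" for x
    using M.W_expand[OF x] x M.W_in by (simp add: sum.reindex[OF inj] FC C_intros)
  ultimately have "quasi_basis C scalars (restrict E C) (M.W ` {..<d})"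
    using M.W_in by (auto simp: quasi_basis_def)
  moreover have "orthonormal_for (restrict E C) (M.W ` {..<d})"
    unfolding orthonormal_for_def using M.W_in
    by (auto simp: C_intros orth inj_on_eq_iff[OF inj] simp del: cstar_mult)
  moreover have "M.W ` {..<d} \<subseteq> unitaries C"
    using M.W_in M.W_unitary_left M.W_unitary_right by (auto simp: unitaries_def)
  ultimately show ?thesis by (simp add: unitary_orthonormal_quasi_basis_def)
qed

end

theorem corollary3p10:
  fixes B :: "'a::unital_cstar_algebra set" and E\<^sub>0 \<tau>\<^sub>0 :: "'a \<Rightarrow> 'a"
  assumes "cstar_subalgebra B"
    and "cstar_simple (UNIV :: 'a set)" and "cstar_simple B"
    and "regular_inclusion UNIV B"
    and "\<exists>E. finite_index UNIV B E"
    and "minimal_cond_expectation UNIV B E\<^sub>0"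
    and "\<tau>\<^sub>0 = restrict E\<^sub>0 (centralizer_in UNIV B)"
  shows "(\<exists>L. unitary_orthonormal_quasi_basis (centralizer_in UNIV B) scalars \<tau>\<^sub>0 L) \<and>
         (\<exists>L. unitary_orthonormal_quasi_basis UNIV B E\<^sub>0 L)"
proof -
  obtain L where L: "quasi_basis UNIV B E\<^sub>0 L"
    using assms(6) by (auto simp: minimal_cond_expectation_def finite_index_def)
  interpret regular_exp B E\<^sub>0 L
    using assms L by unfold_locales (auto simp: quasi_basis_def)
  obtain P cl e N K n where "uniform_matrix_units C P cl e N K n" using uniform_matrix_units_exist by blast
  then interpret M: uniform_matrix_units C P cl e N K n .
  interpret traced_exp B E\<^sub>0 L P cl e N K n ..
  obtain a b where "a \<in> C" "cstar a = a" "a * b = 1" "b * a = 1"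
    "\<forall>x\<in>C. \<tau> (a * x * a) = M.T x / of_nat M.m" "a * a = 1 \<longrightarrow> a = 1"
    using density by blast
  then interpret trace_exp B E\<^sub>0 L P cl e N K n a b by unfold_locales auto
  obtain G where G: "finite G" "G \<subseteq> \<N>" "\<forall>u\<in>G. \<forall>v\<in>G. u \<noteq> v \<longrightarrow> \<not> acts_inner (cstar u * v)"
    "\<forall>v\<in>\<N>. \<exists>u\<in>G. acts_inner (cstar u * v)"
    using coset_representatives by blast
  then have basis: "unitary_orthonormal_quasi_basis UNIV B F ((\<lambda>(u, k). u * M.W k) ` (G \<times> {..<d}))"
    by (intro basis) auto
  have "F = E\<^sub>0" using minimal_imp_eq[OF assms(6) G(2) refl basis] .
  then show ?thesis using basis basis_C unfolding assms(7) by auto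
qed

end
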